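(* Let $H$ be self-adjoint in $\mathcal H$, let $V$ be symmetric and relatively $H$-bounded with $H$-bound $<1$, and let $f\in\mathscr W_1(\mathbb R)$, i.e. $f\in C^1(\mathbb R)$ with $f,(fu)'\in W_0(\mathbb R)$. Then $$f(H+V)-f(H)=T^{H+V,H}_{(fu)^{[1]}}\big(V(H-i)^{-1}\big)-f(H+V)V(H-i)^{-1}.$$
   Context: $\mathcal H$ is a separable Hilbert space. $u(x)=x-i$. $W_0(\mathbb R)$ is the set of $g\in C_0(\mathbb R)$ with $g(x)=\int e^{ixy}d\mu(y)$ for a finite complex Borel measure $\mu$. $V$ is relatively $H$-bounded if $\mathrm{dom}H\subseteq\mathrm{dom}V$ and $\|V\psi\|\le a\|H\psi\|+b\|\psi\|$ ($\psi\in\mathrm{dom}H$) for some $a,b\ge0$; the infimum of such $a$ is the $H$-bound. By Kato–Rellich, $H+V$ is self-adjoint on $\mathrm{dom}H$. For self-adjoint $A,B$ and bounded $X$, with $\nu$ the finite complex measure such that $(fu)'(\lambda)=\int e^{ix\lambda}d\nu(x)$, $T^{A,B}_{(fu)^{[1]}}(X)\psi=\int_{\mathbb R}\int_0^1e^{isxA}Xe^{i(1-s)xB}\psi\,ds\,d\nu(x)$ (Bochner integral). *)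

theory Defs
  imports "HOL-Analysis.Analysis"
begin

text \<open>A complex Hilbert space: a Banach space with a complex scalar multiplication
  compatible with the real one, and a complex inner product (conjugate-linear in the first,
  linear in the second argument) inducing the norm. Separability of a metric space is
  second countability.\<close>

class chilbert = banach + second_countable_topology +
  fixes hscaleC :: "complex \<Rightarrow> 'a \<Rightarrow> 'a"
    and hinner :: "'a \<Rightarrow> 'a \<Rightarrow> complex"
  assumes hscaleC_add_right: "hscaleC c (x + y) = hscaleC c x + hscaleC c y"
    and hscaleC_add_left: "hscaleC (c + d) x = hscaleC c x + hscaleC d x"
    and hscaleC_hscaleC: "hscaleC c (hscaleC d x) = hscaleC (c * d) x"
    and hscaleC_one: "hscaleC 1 x = x"
    and scaleR_hscaleC: "scaleR r x = hscaleC (complex_of_real r) x"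
    and hinner_conj: "hinner x y = cnj (hinner y x)"
    and hinner_add_right: "hinner x (y + z) = hinner x y + hinner x z"
    and hinner_hscaleC_right: "hinner x (hscaleC c y) = c * hinner x y"
    and hinner_self_norm: "hinner x x = complex_of_real ((norm x)\<^sup>2)"

definition csubspace :: "'a::chilbert set \<Rightarrow> bool" where
  "csubspace D \<longleftrightarrow> 0 \<in> D \<and> (\<forall>x\<in>D. \<forall>y\<in>D. x + y \<in> D) \<and> (\<forall>c. \<forall>x\<in>D. hscaleC c x \<in> D)"

definition clinear_on :: "'a::chilbert set \<Rightarrow> ('a \<Rightarrow> 'a) \<Rightarrow> bool" where
  "clinear_on D A \<longleftrightarrow> csubspace D \<and> (\<forall>x\<in>D. \<forall>y\<in>D. A (x + y) = A x + A y)
     \<and> (\<forall>c. \<forall>x\<in>D. A (hscaleC c x) = hscaleC c (A x))"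

definition bounded_clinear_op :: "('a::chilbert \<Rightarrow> 'a) \<Rightarrow> bool" where
  "bounded_clinear_op T \<longleftrightarrow> clinear_on UNIV T \<and> (\<exists>K. \<forall>x. norm (T x) \<le> K * norm x)"

text \<open>Self-adjoint: densely defined, \<open>A \<subseteq> A*\<close> and \<open>dom A* \<subseteq> dom A\<close> (i.e. \<open>A = A*\<close>).\<close>
definition self_adjoint :: "'a::chilbert set \<Rightarrow> ('a \<Rightarrow> 'a) \<Rightarrow> bool" where
  "self_adjoint D A \<longleftrightarrow> clinear_on D A \<and> closure D = UNIV
     \<and> (\<forall>x\<in>D. \<forall>y\<in>D. hinner (A x) y = hinner x (A y))
     \<and> {y. \<exists>z. \<forall>x\<in>D. hinner (A x) y = hinner x z} \<subseteq> D"

definition symmetric_op :: "'a::chilbert set \<Rightarrow> ('a \<Rightarrow> 'a) \<Rightarrow> bool" where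
  "symmetric_op D A \<longleftrightarrow> clinear_on D A \<and> closure D = UNIV
     \<and> (\<forall>x\<in>D. \<forall>y\<in>D. hinner (A x) y = hinner x (A y))"

definition rel_bounded :: "'a::chilbert set \<Rightarrow> ('a \<Rightarrow> 'a) \<Rightarrow> 'a set \<Rightarrow> ('a \<Rightarrow> 'a) \<Rightarrow> bool" where
  "rel_bounded DH H DV V \<longleftrightarrow> DH \<subseteq> DV \<and>
     (\<exists>a b. 0 \<le> a \<and> 0 \<le> b \<and> (\<forall>\<psi>\<in>DH. norm (V \<psi>) \<le> a * norm (H \<psi>) + b * norm \<psi>))"

definition rel_bound :: "'a::chilbert set \<Rightarrow> ('a \<Rightarrow> 'a) \<Rightarrow> ('a \<Rightarrow> 'a) \<Rightarrow> real" where
  "rel_bound DH H V = Inf {a. 0 \<le> a \<and>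
     (\<exists>b. 0 \<le> b \<and> (\<forall>\<psi>\<in>DH. norm (V \<psi>) \<le> a * norm (H \<psi>) + b * norm \<psi>))}"

definition proj_valued_measure :: "(real set \<Rightarrow> 'a::chilbert \<Rightarrow> 'a) \<Rightarrow> bool" where
  "proj_valued_measure E \<longleftrightarrow>
     (\<forall>B\<in>sets borel. bounded_clinear_op (E B) \<and> E B \<circ> E B = E B
        \<and> (\<forall>x y. hinner (E B x) y = hinner x (E B y)))
     \<and> E UNIV = id
     \<and> (\<forall>B\<in>sets borel. \<forall>C\<in>sets borel. E (B \<inter> C) = E B \<circ> E C)
     \<and> (\<forall>x. countably_additive (sets borel) (\<lambda>B. ennreal (Re (hinner x (E B x)))))"

definition spec_meas :: "(real set \<Rightarrow> 'a::chilbert \<Rightarrow> 'a) \<Rightarrow> 'a \<Rightarrow> real measure" where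
  "spec_meas E x = measure_of UNIV (sets borel) (\<lambda>B. ennreal (Re (hinner x (E B x))))"

definition spectral_resolution :: "'a::chilbert set \<Rightarrow> ('a \<Rightarrow> 'a) \<Rightarrow> (real set \<Rightarrow> 'a \<Rightarrow> 'a) \<Rightarrow> bool" where
  "spectral_resolution D A E \<longleftrightarrow> proj_valued_measure E
     \<and> D = {x. integrable (spec_meas E x) (\<lambda>t. t\<^sup>2)}
     \<and> (\<forall>x\<in>D. hinner x (A x) = complex_of_real (LINT t|spec_meas E x. t))"

text \<open>Functional calculus \<open>f(A) = \<integral> f dE\<close> for bounded Borel \<open>f\<close>.\<close>
definition fcalc :: "'a::chilbert set \<Rightarrow> ('a \<Rightarrow> 'a) \<Rightarrow> (real \<Rightarrow> complex) \<Rightarrow> 'a \<Rightarrow> 'a" where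
  "fcalc D A f = (let E = (SOME E. spectral_resolution D A E) in
     THE F. bounded_clinear_op F \<and> (\<forall>x. hinner x (F x) = (LINT t|spec_meas E x. f t)))"

definition resolv_i :: "'a::chilbert set \<Rightarrow> ('a \<Rightarrow> 'a) \<Rightarrow> 'a \<Rightarrow> 'a" where
  "resolv_i D A = (THE R. \<forall>\<psi>. R \<psi> \<in> D \<and> A (R \<psi>) - hscaleC \<i> (R \<psi>) = \<psi>)"

text \<open>A finite complex Borel measure on the real line, represented as \<open>h d\<rho>\<close>
  with \<open>\<rho>\<close> a finite positive Borel measure and \<open>h \<in> L^1(\<rho>)\<close>;
  integration: \<open>\<integral> g d\<mu> = \<integral> g h d\<rho>\<close>.\<close>
definition cmeasure_rep :: "real measure \<Rightarrow> (real \<Rightarrow> complex) \<Rightarrow> bool" where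
  "cmeasure_rep \<rho> h \<longleftrightarrow> finite_measure \<rho> \<and> sets \<rho> = sets borel \<and> integrable \<rho> h"

definition W0 :: "(real \<Rightarrow> complex) \<Rightarrow> bool" where
  "W0 g \<longleftrightarrow> continuous_on UNIV g \<and> (g \<longlongrightarrow> 0) at_top \<and> (g \<longlongrightarrow> 0) at_bot
     \<and> (\<exists>\<rho> h. cmeasure_rep \<rho> h \<and>
          (\<forall>x. g x = (LINT y|\<rho>. exp (\<i> * complex_of_real (x * y)) * h y)))"

definition fu_deriv :: "(real \<Rightarrow> complex) \<Rightarrow> real \<Rightarrow> complex" where
  "fu_deriv f x = vector_derivative (\<lambda>t. f t * (complex_of_real t - \<i>)) (at x)"

definition W1 :: "(real \<Rightarrow> complex) \<Rightarrow> bool" where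
  "W1 f \<longleftrightarrow> (\<forall>x. f differentiable (at x))
     \<and> continuous_on UNIV (\<lambda>x. vector_derivative f (at x))
     \<and> W0 f \<and> W0 (fu_deriv f)"

text \<open>\<open>T^{A,B}_{(fu)^{[1]}}(X)\<psi> = \<integral>_\<real> \<integral>_0^1 e^{isxA} X e^{i(1-s)xB}\<psi> ds d\<nu>(x)\<close>,
  with \<open>\<nu> = h d\<rho>\<close>.\<close>
definition DOI :: "'a::chilbert set \<Rightarrow> ('a \<Rightarrow> 'a) \<Rightarrow> 'a set \<Rightarrow> ('a \<Rightarrow> 'a)
    \<Rightarrow> real measure \<Rightarrow> (real \<Rightarrow> complex) \<Rightarrow> ('a \<Rightarrow> 'a) \<Rightarrow> 'a \<Rightarrow> 'a" where
  "DOI DA A DB B \<rho> h X \<psi> = (LINT x|\<rho>. hscaleC (h x)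
      (LINT s:{0..1}|lborel.
         fcalc DA A (\<lambda>t. exp (\<i> * complex_of_real (s * x * t)))
           (X (fcalc DB B (\<lambda>t. exp (\<i> * complex_of_real ((1 - s) * x * t))) \<psi>))))"

end

theory Submission
  imports Defs "HOL-Probability.Probability"
begin

text \<open>
  Write \<open>A = H + V\<close>, \<open>R = (H - \<i>)\<^sup>-\<^sup>1\<close> and \<open>G t = f t * (t - \<i>)\<close>. For \<open>\<xi>\<close> in the common domain, differentiating
  \<open>s \<mapsto> e\<^bsup>\<i>sxA\<^esup> e\<^bsup>\<i>(1-s)xH\<^esup> \<xi>\<close> gives Duhamel's formula, and
  \<open>G t = G 0 + \<integral> (e\<^bsup>\<i>xt\<^esup> - 1) / (\<i>x) d\<nu>(x)\<close> because \<open>G'\<close> is the Fourier transform of \<open>\<nu>\<close>. Together with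
  Fubini they yield \<open>f(A) (A - \<i>) \<xi> - f(H) (H - \<i>) \<xi> = \<integral> \<integral>\<^sub>0\<^sup>1 e\<^bsup>\<i>sxA\<^esup> V e\<^bsup>\<i>(1-s)xH\<^esup> \<xi> ds d\<nu>(x)\<close>; put
  \<open>\<xi> = R \<psi>\<close>, note that \<open>R\<close> commutes with \<open>e\<^bsup>\<i>yH\<^esup>\<close> and that \<open>(A - \<i>) R = 1 + V R\<close>. All identities between
  operators are checked on the diagonal \<open>\<langle>\<xi>, \<cdot> \<xi>\<rangle>\<close>, where they become integrals against the positive spectral
  measures, and then polarised.

  The spectral theorem is obtained through the Cayley transform \<open>W\<close>: the numbers \<open>\<langle>\<psi>, W\<^sup>n \<psi>\<rangle>\<close> are the
  trigonometric moments of a weak limit of Fejer means (Helly selection), which carries no mass at \<open>1\<close> by the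
  mean ergodic theorem and is transported to the real line.\<close>

section \<open>Complex Hilbert spaces and self-adjoint operators\<close>

text \<open>The factor \<open>u\<close> is there because \<open>V\<close> is unbounded: Duhamel's
  formula for \<open>f\<close> alone would leave a bare \<open>V\<close> between the two groups,
  whereas the difference for \<open>f u\<close>, evaluated on \<open>R \<psi>\<close>, leaves the
  bounded operator \<open>V R\<close>. The price is that \<open>G = f u\<close> may grow linearly,
  so that \<open>G(A)\<close> lies outside the bounded calculus. Hence \<open>G\<close> occurs only
  under integrals against the spectral measure of a vector of the common domain, where
  \<open>t\<close> is integrable, and as a superposition of functions
  \<open>(e^(ixt) - 1)/(ix)\<close>, each at most \<open>|t|\<close> in modulus. This gives the
  majorant \<open>|h(x)| |t|\<close> for Fubini without any moment condition on the complex measure.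
  The functional calculus is given as the operator with a prescribed diagonal, relative to a
  spectral resolution picked by choice. The spectral theorem therefore enters as an existence
  statement, and every argument about the picked resolution has to start from its defining
  properties, which describe the operator only through its domain and its quadratic form.\<close>

lemma hinner_add_left: "hinner (x + y) z = hinner x z + hinner y (z::'a::chilbert)"
  by (metis complex_cnj_add hinner_add_right hinner_conj)

lemma hinner_hscaleC_left: "hinner (hscaleC c x) y = cnj c * hinner x (y::'a::chilbert)"
  by (metis complex_cnj_mult hinner_hscaleC_right hinner_conj)

lemma hinner_scaleR_right: "hinner x (scaleR r y) = r *\<^sub>R hinner x (y::'a::chilbert)"
  by (simp add: scaleR_hscaleC hinner_hscaleC_right scaleR_conv_of_real)

lemma hinner_scaleR_left: "hinner (scaleR r x) y = r *\<^sub>R hinner x (y::'a::chilbert)"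
  by (simp add: scaleR_hscaleC hinner_hscaleC_left scaleR_conv_of_real)

lemma hinner_zero_right [simp]: "hinner x (0::'a::chilbert) = 0"
  using hinner_add_right[of x 0 0] by simp

lemma hinner_zero_left [simp]: "hinner (0::'a::chilbert) x = 0"
  using hinner_add_left[of 0 0 x] by simp

lemma hinner_minus_right: "hinner x (- y) = - hinner x (y::'a::chilbert)"
  using hinner_add_right[of x y "-y"] by (simp add: eq_neg_iff_add_eq_0 add.commute)

lemma hinner_minus_left: "hinner (- x) y = - hinner x (y::'a::chilbert)"
  using hinner_add_left[of x "-x" y] by (simp add: eq_neg_iff_add_eq_0 add.commute)

lemma hinner_diff_right: "hinner x (y - z) = hinner x y - hinner x (z::'a::chilbert)"
  using hinner_add_right[of x y "-z"] by (simp add: hinner_minus_right)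

lemma hinner_diff_left: "hinner (x - y) z = hinner x z - hinner y (z::'a::chilbert)"
  using hinner_add_left[of x "-y" z] by (simp add: hinner_minus_left)

lemmas hinner_simps = hinner_add_left hinner_add_right hinner_diff_left hinner_diff_right
  hinner_minus_left hinner_minus_right hinner_hscaleC_left hinner_hscaleC_right

lemma hinner_self_eq_0: "hinner x x = 0 \<longleftrightarrow> x = (0::'a::chilbert)"
  by (simp add: hinner_self_norm)

lemma hscaleC_zero_right [simp]: "hscaleC c (0::'a::chilbert) = 0"
  using hscaleC_add_right[of c 0 "0::'a"] by simp

lemma hscaleC_zero_left [simp]: "hscaleC 0 (x::'a::chilbert) = 0"
  using hscaleC_add_left[of 0 0 x] by simp

lemma hscaleC_minus_right: "hscaleC c (- x) = - hscaleC c (x::'a::chilbert)"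
  using hscaleC_add_right[of c x "-x"] by (simp add: eq_neg_iff_add_eq_0 add.commute)

lemma hscaleC_minus_left: "hscaleC (- c) x = - hscaleC c (x::'a::chilbert)"
  using hscaleC_add_left[of c "-c" x] by (simp add: eq_neg_iff_add_eq_0 add.commute)

lemma hscaleC_diff_right: "hscaleC c (x - y) = hscaleC c x - hscaleC c (y::'a::chilbert)"
  using hscaleC_add_right[of c x "-y"] by (simp add: hscaleC_minus_right)

lemma hinner_eqI: "(\<And>z. hinner z x = hinner z y) \<Longrightarrow> x = (y::'a::chilbert)"
  by (metis eq_iff_diff_eq_0 hinner_diff_right hinner_self_eq_0)

text \<open>The norm is tied directly only to real scaling; complex homogeneity has to come from the
  inner product.\<close>

lemma norm_hscaleC [simp]: "norm (hscaleC c x) = cmod c * norm (x::'a::chilbert)"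
proof -
  have "complex_of_real ((norm (hscaleC c x))\<^sup>2) = complex_of_real ((cmod c * norm x)\<^sup>2)"
    unfolding hinner_self_norm[symmetric] hinner_hscaleC_left hinner_hscaleC_right
    using complex_norm_square[of c] by (simp add: power_mult_distrib hinner_self_norm mult_ac)
  hence "(norm (hscaleC c x))\<^sup>2 = (cmod c * norm x)\<^sup>2" using of_real_eq_iff by blast
  thus ?thesis by (simp add: power2_eq_iff_nonneg)
qed

lemma Re_hinner_self: "Re (hinner x x) = (norm (x::'a::chilbert))\<^sup>2"
  by (simp add: hinner_self_norm)

lemma norm_add_sq: "(norm (x + y))\<^sup>2 = (norm x)\<^sup>2 + (norm y)\<^sup>2 + 2 * Re (hinner x (y::'a::chilbert))"
proof -
  have "Re (hinner y x) = Re (hinner x y)" by (subst hinner_conj) simp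
  thus ?thesis unfolding Re_hinner_self[symmetric] by (simp add: hinner_simps)
qed

lemma norm_diff_sq: "(norm (x - y))\<^sup>2 = (norm x)\<^sup>2 + (norm y)\<^sup>2 - 2 * Re (hinner x (y::'a::chilbert))"
  using norm_add_sq[of x "-y"] by (simp add: hinner_minus_right)

lemma hinner_Cauchy_Schwarz: "cmod (hinner x y) \<le> norm x * norm (y::'a::chilbert)"
proof (cases "y = 0")
  case False
  define a where "a = hinner y x"
  \<comment> \<open>\<open>c\<close> is the coefficient of the orthogonal projection of
    \<open>x\<close> onto the line of \<open>y\<close>; the inequality is the nonnegativity of the
    squared norm of \<open>x - c y\<close>.\<close>
  define c where "c = a / complex_of_real ((norm y)\<^sup>2)"
  have n: "(norm y)\<^sup>2 > 0" using False by simp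
  have xy: "hinner x y = cnj a" unfolding a_def by (subst hinner_conj) simp
  have cc: "(cmod c * norm y)\<^sup>2 = (cmod a)\<^sup>2 / (norm y)\<^sup>2"
    using n unfolding c_def norm_divide norm_of_real by (simp add: field_simps power2_eq_square)
  have "Re (hinner x (hscaleC c y)) = (cmod a)\<^sup>2 / (norm y)\<^sup>2"
  proof -
    have "hinner x (hscaleC c y) = complex_of_real ((cmod a)\<^sup>2 / (norm y)\<^sup>2)"
      unfolding hinner_hscaleC_right xy c_def
      using complex_norm_square[of a] by simp
    thus ?thesis by simp
  qed
  hence "0 \<le> (norm x)\<^sup>2 - (cmod a)\<^sup>2 / (norm y)\<^sup>2"
    using norm_diff_sq[of x "hscaleC c y"] zero_le_power2[of "norm (x - hscaleC c y)"] cc by simp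
  hence "(cmod a)\<^sup>2 \<le> (norm x * norm y)\<^sup>2"
    using n by (simp add: power_mult_distrib field_simps)
  hence "cmod a \<le> norm x * norm y" by (rule power2_le_imp_le) simp
  thus ?thesis by (simp add: xy)
qed simp

text \<open>Over the reals the sesquilinear form is bilinear, so limits, sums, continuity and the
  product rule for derivatives come from the general theory.\<close>

lemma bounded_bilinear_hinner: "bounded_bilinear (hinner :: 'a::chilbert \<Rightarrow> 'a \<Rightarrow> complex)"
  by (rule bounded_bilinear.intro)
     (auto simp: hinner_simps hinner_scaleR_left hinner_scaleR_right
        intro!: exI[of _ 1] hinner_Cauchy_Schwarz)

lemma bounded_bilinear_hscaleC: "bounded_bilinear (hscaleC :: complex \<Rightarrow> 'a::chilbert \<Rightarrow> 'a)"
  by (rule bounded_bilinear.intro)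
     (auto simp: hscaleC_add_left hscaleC_add_right hscaleC_hscaleC scaleR_hscaleC scaleR_conv_of_real
        mult.commute intro!: exI[of _ 1])

lemmas tendsto_hinner = bounded_bilinear.tendsto[OF bounded_bilinear_hinner]
lemmas tendsto_hscaleC = bounded_bilinear.tendsto[OF bounded_bilinear_hscaleC]
lemmas continuous_on_hinner = bounded_bilinear.continuous_on[OF bounded_bilinear_hinner]
lemmas continuous_on_hscaleC = bounded_bilinear.continuous_on[OF bounded_bilinear_hscaleC]
lemmas hinner_sum_left = bounded_bilinear.sum_left[OF bounded_bilinear_hinner]
lemmas hinner_sum_right = bounded_bilinear.sum_right[OF bounded_bilinear_hinner]

section \<open>Linear operators on subspaces and polarisation\<close>

lemma csubspaceD:
  assumes "csubspace D"
  shows "0 \<in> D" "x \<in> D \<Longrightarrow> y \<in> D \<Longrightarrow> x + y \<in> D" "x \<in> D \<Longrightarrow> hscaleC c x \<in> D"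
    "x \<in> D \<Longrightarrow> scaleR r x \<in> D" "x \<in> D \<Longrightarrow> - x \<in> D" "x \<in> D \<Longrightarrow> y \<in> D \<Longrightarrow> x - y \<in> D"
proof -
  show 1: "0 \<in> D" and 2: "\<And>x y. x \<in> D \<Longrightarrow> y \<in> D \<Longrightarrow> x + y \<in> D" and 3: "\<And>x c. x \<in> D \<Longrightarrow> hscaleC c x \<in> D"
    using assms unfolding csubspace_def by auto
  show "x \<in> D \<Longrightarrow> scaleR r x \<in> D" using 3 by (simp add: scaleR_hscaleC)
  have 4: "x \<in> D \<Longrightarrow> - x \<in> D" for x using 3[of x "-1"] by (simp add: hscaleC_minus_left hscaleC_one)
  then show "x \<in> D \<Longrightarrow> - x \<in> D" .
  show "x \<in> D \<Longrightarrow> y \<in> D \<Longrightarrow> x - y \<in> D" using 2[of x "-y"] 4[of y] by simp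
qed

lemma csubspace_UNIV [simp]: "csubspace UNIV"
  by (simp add: csubspace_def)

lemma clinear_onD:
  assumes "clinear_on D A"
  shows "csubspace D" "x \<in> D \<Longrightarrow> y \<in> D \<Longrightarrow> A (x + y) = A x + A y"
    "x \<in> D \<Longrightarrow> A (hscaleC c x) = hscaleC c (A x)"
    "A 0 = 0" "x \<in> D \<Longrightarrow> A (- x) = - A x" "x \<in> D \<Longrightarrow> y \<in> D \<Longrightarrow> A (x - y) = A x - A y"
proof -
  show 1: "csubspace D" and 2: "\<And>x y. x \<in> D \<Longrightarrow> y \<in> D \<Longrightarrow> A (x + y) = A x + A y"
    and 3: "\<And>x c. x \<in> D \<Longrightarrow> A (hscaleC c x) = hscaleC c (A x)"
    using assms unfolding clinear_on_def by auto
  show "A 0 = 0" using 2[of 0 0] csubspaceD(1)[OF 1] by simp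
  have 4: "x \<in> D \<Longrightarrow> A (- x) = - A x" for x
    using 3[of x "-1"] by (simp add: hscaleC_minus_left hscaleC_one)
  then show "x \<in> D \<Longrightarrow> A (- x) = - A x" .
  show "x \<in> D \<Longrightarrow> y \<in> D \<Longrightarrow> A (x - y) = A x - A y"
    using 2[of x "-y"] 4[of y] csubspaceD(5)[OF 1] by simp
qed

lemma bounded_clinear_opD:
  assumes "bounded_clinear_op T"
  shows "T (x + y) = T x + T y" "T (hscaleC c x) = hscaleC c (T x)" "T 0 = 0" "T (- x) = - T x"
    "T (x - y) = T x - T y" "clinear_on UNIV T"
  using assms clinear_onD[of UNIV T] unfolding bounded_clinear_op_def by auto

lemma bounded_clinear_op_bounded_linear:
  assumes "bounded_clinear_op T"
  shows "bounded_linear T"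
proof -
  obtain K where "\<And>x. norm (T x) \<le> K * norm x" using assms unfolding bounded_clinear_op_def by blast
  then show ?thesis
    by (intro bounded_linear_intro[where K=K])
       (auto simp: bounded_clinear_opD[OF assms] scaleR_hscaleC mult.commute)
qed

lemma bounded_clinear_opI:
  assumes "\<And>x y. T (x + y) = T x + T y" "\<And>c x. T (hscaleC c x) = hscaleC c (T x)"
    "\<And>x. norm (T x) \<le> K * norm x"
  shows "bounded_clinear_op T"
  using assms unfolding bounded_clinear_op_def clinear_on_def by auto

lemma bounded_clinear_op_id: "bounded_clinear_op id"
  by (rule bounded_clinear_opI[where K=1]) auto

lemma bounded_clinear_op_add:
  assumes "bounded_clinear_op S" "bounded_clinear_op T"
  shows "bounded_clinear_op (\<lambda>x. S x + T x)"
proof -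
  obtain K L where "\<And>x. norm (S x) \<le> K * norm x" "\<And>x. norm (T x) \<le> L * norm x"
    using assms unfolding bounded_clinear_op_def by metis
  then have "norm (S x + T x) \<le> (K + L) * norm x" for x
    by (metis add_mono distrib_right norm_triangle_le)
  then show ?thesis
    by (intro bounded_clinear_opI[where K="K+L"])
       (auto simp: bounded_clinear_opD[OF assms(1)] bounded_clinear_opD[OF assms(2)] hscaleC_add_right)
qed

lemma bounded_clinear_op_scale:
  assumes "bounded_clinear_op S"
  shows "bounded_clinear_op (\<lambda>x. hscaleC c (S x))"
proof -
  obtain K where "\<And>x. norm (S x) \<le> K * norm x"
    using assms unfolding bounded_clinear_op_def by metis
  then have "norm (hscaleC c (S x)) \<le> (cmod c * K) * norm x" for x
    by (simp add: mult.assoc mult_left_mono)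
  then show ?thesis
    by (intro bounded_clinear_opI[where K="cmod c * K"])
       (auto simp: bounded_clinear_opD[OF assms(1)] hscaleC_add_right hscaleC_hscaleC mult.commute)
qed

lemma bounded_clinear_op_compose:
  assumes "bounded_clinear_op S" "bounded_clinear_op T"
  shows "bounded_clinear_op (\<lambda>x. S (T x))"
proof -
  obtain K where "\<And>x. norm (S (T x)) \<le> norm x * K"
    using bounded_linear.bounded[OF bounded_linear_compose[OF assms[THEN bounded_clinear_op_bounded_linear]]]
    by blast
  then show ?thesis
    by (intro bounded_clinear_opI[where K=K])
       (auto simp: bounded_clinear_opD[OF assms(1)] bounded_clinear_opD[OF assms(2)] mult.commute)
qed

text \<open>The coefficient \<open>1 / \<i> ^ k\<close> selects the cross term that is linear in \<open>y\<close>.\<close>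

definition polar :: "('a::chilbert \<Rightarrow> complex) \<Rightarrow> 'a \<Rightarrow> 'a \<Rightarrow> complex" where
  "polar q x y = (\<Sum>k<4. q (x + hscaleC (\<i> ^ k) y) / \<i> ^ k) / 4"

lemma sum_lt4: "(\<Sum>k<4. g k) = g 0 + g (1::nat) + g 2 + (g 3 :: 'b::comm_monoid_add)"
  by (simp add: numeral_eq_Suc add.assoc)

lemma i_pow3: "\<i> ^ 3 = - \<i>"
  by (simp add: power3_eq_cube)

lemma polarization:
  assumes "clinear_on D A" "x \<in> D" "y \<in> D"
  shows "polar (\<lambda>v. hinner v (A v)) x y = hinner x (A y)"
proof -
  note D = csubspaceD[OF clinear_onD(1)[OF assms(1)]]
  have "A (x + hscaleC c y) = A x + hscaleC c (A y)" for c
    using clinear_onD[OF assms(1)] D assms by simp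
  from this this[of 1] show ?thesis
    unfolding polar_def sum_lt4
    by (simp only: hinner_simps i_pow3) (simp add: hinner_simps field_simps)
qed

lemma dense_hinner_eqI:
  assumes "closure D = UNIV" "\<And>x. x \<in> D \<Longrightarrow> hinner x y = hinner x (z::'a::chilbert)"
  shows "y = z"
proof (rule hinner_eqI)
  fix x
  obtain X where X: "\<And>n. X n \<in> D" "X \<longlonglongrightarrow> x"
    using assms(1) closure_sequential[of x D] by auto
  have "(\<lambda>n. hinner (X n) y) \<longlonglongrightarrow> hinner x y" "(\<lambda>n. hinner (X n) z) \<longlonglongrightarrow> hinner x z"
    by (intro tendsto_hinner X tendsto_const)+
  then show "hinner x y = hinner x z" using assms(2) X(1) LIMSEQ_unique by simp
qed

text \<open>Equal diagonals give equal matrix elements only against vectors of \<open>D\<close>;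
  density of \<open>D\<close> then identifies the images.\<close>

lemma polarization_eq:
  assumes "clinear_on D A" "clinear_on D B" "closure D = UNIV"
    and "\<And>x. x \<in> D \<Longrightarrow> hinner x (A x) = hinner x (B x)" "y \<in> D"
  shows "A y = B y"
proof -
  note D = csubspaceD[OF clinear_onD(1)[OF assms(1)]]
  have "hinner x (A y) = hinner x (B y)" if "x \<in> D" for x
    using polarization[OF assms(1) that assms(5)] polarization[OF assms(2) that assms(5)]
      assms(4) that assms(5) D unfolding polar_def by simp
  then show ?thesis by (rule dense_hinner_eqI[OF assms(3)])
qed

lemma bounded_clinear_op_eqI:
  assumes "bounded_clinear_op S" "bounded_clinear_op T" "\<And>x. hinner x (S x) = hinner x (T x)"
  shows "S = T"
  using polarization_eq[of UNIV S T] assms bounded_clinear_opD(6) by fastforce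

text \<open>Minimises \<open>x \<mapsto> \<parallel>x\<parallel>\<^sup>2 - 2 Re (L x)\<close>; the minimiser represents \<open>L\<close>.\<close>

lemma Riesz_representation:
  fixes L :: "'a::chilbert \<Rightarrow> complex"
  assumes S: "csubspace S" "closed S"
    and Ladd: "\<And>x y. x \<in> S \<Longrightarrow> y \<in> S \<Longrightarrow> L (x + y) = L x + L y"
    and Lscale: "\<And>c x. x \<in> S \<Longrightarrow> L (hscaleC c x) = c * L x"
    and Lbound: "\<And>x. x \<in> S \<Longrightarrow> cmod (L x) \<le> K * norm x"
  obtains z where "z \<in> S" "\<And>x. x \<in> S \<Longrightarrow> L x = hinner z x"
proof -
  note Sub = csubspaceD[OF S(1)]
  define F where "F x = (norm x)\<^sup>2 - 2 * Re (L x)" for x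
  have Lsc: "L (scaleR r x) = complex_of_real r * L x" if "x \<in> S" for r x
    using Lscale[OF that] by (simp add: scaleR_hscaleC)
  have Ldiff: "L (x - y) = L x - L y" if "x \<in> S" "y \<in> S" for x y
    using Ladd[OF that(1) Sub(5)[OF that(2)]] Lsc[OF that(2), of "-1"] by simp
  \<comment> \<open>Completing the square: \<open>F x\<close> is at least
    \<open>|x|^2 - 2 K |x|\<close>.\<close>
  have Flow: "F x \<ge> - K\<^sup>2" if "x \<in> S" for x
  proof -
    have "Re (L x) \<le> K * norm x" using Lbound[OF that] complex_Re_le_cmod order_trans by blast
    moreover have "0 \<le> (norm x - K)\<^sup>2" by simp
    ultimately show ?thesis unfolding F_def power2_diff by (simp add: mult.commute)
  qed
  define m where "m = Inf (F ` S)"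
  have bdd: "bdd_below (F ` S)" using Flow by (intro bdd_belowI) auto
  have mle: "m \<le> F x" if "x \<in> S" for x unfolding m_def using bdd that by (intro cInf_lower) auto
  have "\<exists>x\<in>S. F x < m + 1 / real (Suc n)" for n
  proof -
    have "Inf (F ` S) < m + 1 / real (Suc n)" unfolding m_def by simp
    moreover have "F ` S \<noteq> {}" using Sub(1) by auto
    ultimately have "\<exists>v\<in>F ` S. v < m + 1 / real (Suc n)"
      by (intro cInf_lessD)
    then show ?thesis by auto
  qed
  then obtain X where X: "\<And>n. X n \<in> S" "\<And>n. F (X n) < m + 1 / real (Suc n)" by metis
  \<comment> \<open>Parallelogram law, with \<open>F\<close> at least \<open>m\<close> at the
    midpoint: two near-minimisers are close to each other, which makes a minimising sequence
    Cauchy.\<close>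
  have par: "(norm (x - y))\<^sup>2 \<le> 2 * (F x + F y - 2 * m)" if "x \<in> S" "y \<in> S" for x y
  proof -
    have mid: "scaleR (1/2) (x + y) \<in> S" using that Sub by blast
    have "F (scaleR (1/2) (x + y)) = (norm (x + y))\<^sup>2 / 4 - Re (L x + L y)"
      unfolding F_def Lsc[OF Sub(2)[OF that]] Ladd[OF that] norm_scaleR power_mult_distrib
      by (simp add: power2_eq_square field_simps)
    moreover have "(norm (x - y))\<^sup>2 = 2 * (norm x)\<^sup>2 + 2 * (norm y)\<^sup>2 - (norm (x + y))\<^sup>2"
      unfolding norm_add_sq norm_diff_sq by simp
    ultimately show ?thesis using mle[OF mid] unfolding F_def by simp
  qed
  have "Cauchy X"
  proof (rule metric_CauchyI)
    fix e :: real assume e: "e > 0"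
    obtain N where N: "inverse (real (Suc N)) < e\<^sup>2 / 4" using reals_Archimedean[of "e\<^sup>2/4"] e by auto
    have "dist (X a) (X b) < e" if "a \<ge> N" "b \<ge> N" for a b
    proof -
      have "1 / real (Suc a) \<le> inverse (real (Suc N))" "1 / real (Suc b) \<le> inverse (real (Suc N))"
        using that by (auto simp: field_simps)
      with X(2)[of a] X(2)[of b] N have "F (X a) < m + e\<^sup>2 / 4" "F (X b) < m + e\<^sup>2 / 4"
        by linarith+
      hence "(norm (X a - X b))\<^sup>2 < e\<^sup>2"
        using par[OF X(1)[of a] X(1)[of b]] by (simp add: field_simps)
      thus ?thesis using e by (simp add: dist_norm power_less_imp_less_base)
    qed
    thus "\<exists>M. \<forall>m\<ge>M. \<forall>n\<ge>M. dist (X m) (X n) < e" by blast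
  qed
  then obtain z where z: "X \<longlonglongrightarrow> z" using Cauchy_convergent_iff convergent_def by blast
  have zS: "z \<in> S" using S(2) X(1) z closed_sequentially by blast
  have LX: "(\<lambda>n. L (X n)) \<longlonglongrightarrow> L z"
  proof (rule LIM_zero_cancel, rule Lim_null_comparison)
    show "\<forall>\<^sub>F n in sequentially. norm (L (X n) - L z) \<le> K * norm (X n - z)"
      by (rule always_eventually) (use Lbound[OF Sub(6)[OF X(1) zS]] Ldiff[OF X(1) zS] in simp)
    show "(\<lambda>n. K * norm (X n - z)) \<longlonglongrightarrow> 0"
      using z by (intro tendsto_mult_right_zero tendsto_norm_zero LIM_zero)
  qed
  have "(\<lambda>n. F (X n)) \<longlonglongrightarrow> F z" unfolding F_def by (intro tendsto_intros z LX)
  moreover have "(\<lambda>n. m + 1 / real (Suc n)) \<longlonglongrightarrow> m + 0"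
    by (intro tendsto_intros LIMSEQ_Suc[OF lim_1_over_n])
  ultimately have "F z \<le> m + 0" by (rule LIMSEQ_le) (use X(2) in \<open>auto intro: less_imp_le\<close>)
  then have Fz: "F z \<le> m" by simp
  have re: "Re (hinner z x) = Re (L x)" if x: "x \<in> S" for x
  proof -
    define d where "d = Re (hinner z x) - Re (L x)"
    have q: "0 \<le> t\<^sup>2 * (norm x)\<^sup>2 + 2 * t * d" for t
    proof -
      have "z + scaleR t x \<in> S" using zS x Sub by blast
      hence "F z \<le> F (z + scaleR t x)" using mle Fz by force
      also have "F (z + scaleR t x) = F z + t\<^sup>2 * (norm x)\<^sup>2 + 2 * t * d"
        unfolding F_def norm_add_sq Ladd[OF zS Sub(4)[OF x]] Lsc[OF x] d_def hinner_scaleR_right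
        by (simp add: power_mult_distrib algebra_simps)
      finally show ?thesis by simp
    qed
    have "d = 0"
    proof (rule ccontr)
      assume d: "d \<noteq> 0"
      \<comment> \<open>A quadratic in \<open>t\<close> that vanishes at 0 and is never negative has
        no linear term. The value \<open>t = - d / n\<close> exhibits this, and the added 1 keeps
        the divisor positive when \<open>x = 0\<close>.\<close>
      define n where "n = (norm x)\<^sup>2 + 1"
      have n: "n > 0" "(norm x)\<^sup>2 = n - 1" unfolding n_def by (auto simp: add_nonneg_pos)
      have "0 \<le> (- d / n)\<^sup>2 * (n - 1) + 2 * (- d / n) * d" using q[of "-d/n"] n by simp
      also have "\<dots> = - (d\<^sup>2 / n) - d\<^sup>2 / n\<^sup>2" using n(1)
        by (simp add: power2_eq_square field_simps)
      finally show False using d n(1)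
        by (smt (verit) divide_pos_pos zero_less_power2)
    qed
    thus ?thesis unfolding d_def by simp
  qed
  have "L x = hinner z x" if x: "x \<in> S" for x
  proof (rule complex_eqI)
    show "Re (L x) = Re (hinner z x)" using re[OF x] by simp
    show "Im (L x) = Im (hinner z x)"
      using re[OF Sub(3)[OF x, of \<i>]] Lscale[OF x] by (simp add: hinner_hscaleC_right)
  qed
  with zS show thesis using that by blast
qed

text \<open>The vector representing \<open>hinner y\<close> on \<open>S\<close> is the orthogonal
  projection \<open>z\<close> of \<open>y\<close>; then \<open>y - z\<close> is orthogonal to
  \<open>S\<close>, hence zero.\<close>

lemma closed_csubspace_UNIV:
  assumes "csubspace S" "closed S" "\<And>y. (\<And>x. x \<in> S \<Longrightarrow> hinner x y = 0) \<Longrightarrow> y = 0"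
  shows "S = (UNIV :: 'a::chilbert set)"
proof -
  have "y \<in> S" for y
  proof -
    obtain z where z: "z \<in> S" "\<And>x. x \<in> S \<Longrightarrow> hinner y x = hinner z x"
      by (rule Riesz_representation[OF assms(1,2), of "hinner y" "norm y"])
         (auto simp: hinner_simps hinner_Cauchy_Schwarz)
    have "hinner x (y - z) = 0" if "x \<in> S" for x
      using z(2)[OF that] by (metis eq_iff_diff_eq_0 hinner_conj hinner_diff_right)
    then have "y - z = 0" by (rule assms(3))
    then show ?thesis using z(1) by simp
  qed
  then show ?thesis by auto
qed

section \<open>Self-adjointness and the shifts by imaginary numbers\<close>

text \<open>The last two facts say that the adjoint is contained in the operator: the definition
  supplies membership in the domain, and density identifies \<open>z\<close> with
  \<open>A y\<close>.\<close>

lemma self_adjointD: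
  assumes "self_adjoint D A"
  shows "clinear_on D A" "closure D = UNIV" "csubspace D"
    "x \<in> D \<Longrightarrow> y \<in> D \<Longrightarrow> hinner (A x) y = hinner x (A y)"
    "(\<And>x. x \<in> D \<Longrightarrow> hinner (A x) y = hinner x z) \<Longrightarrow> y \<in> D"
    "(\<And>x. x \<in> D \<Longrightarrow> hinner (A x) y = hinner x z) \<Longrightarrow> A y = z"
proof -
  show 1: "clinear_on D A" "closure D = UNIV" "csubspace D"
    using assms clinear_onD unfolding self_adjoint_def by auto
  show 2: "\<And>x y. x \<in> D \<Longrightarrow> y \<in> D \<Longrightarrow> hinner (A x) y = hinner x (A y)"
    using assms unfolding self_adjoint_def by auto
  show 3: "(\<And>x. x \<in> D \<Longrightarrow> hinner (A x) y = hinner x z) \<Longrightarrow> y \<in> D"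
    using assms unfolding self_adjoint_def by blast
  assume a: "\<And>x. x \<in> D \<Longrightarrow> hinner (A x) y = hinner x z"
  show "A y = z"
    by (rule dense_hinner_eqI[OF 1(2)]) (use a 2 3 in metis)
qed

lemma self_adjoint_closed:
  assumes "self_adjoint D A" "\<And>n. X n \<in> D" "X \<longlonglongrightarrow> x" "(\<lambda>n. A (X n)) \<longlonglongrightarrow> y"
  shows "x \<in> D" "A x = y"
proof -
  have "hinner (A v) x = hinner v y" if "v \<in> D" for v
  proof -
    have "(\<lambda>n. hinner (A v) (X n)) \<longlonglongrightarrow> hinner (A v) x" "(\<lambda>n. hinner v (A (X n))) \<longlonglongrightarrow> hinner v y"
      by (intro tendsto_hinner assms tendsto_const)+
    then show ?thesis using self_adjointD(4)[OF assms(1) that assms(2)] LIMSEQ_unique by simp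
  qed
  then show "x \<in> D" "A x = y" using self_adjointD(5,6)[OF assms(1)] by blast+
qed

lemma hinner_symmetric_real:
  assumes "hinner (A x) x = hinner x (A x)"
  shows "Im (hinner x (A x)) = 0"
  using assms hinner_conj[of x "A x"] by (metis Reals_cnj_iff complex_is_Real_iff)

text \<open>The cross term is the real part of \<open>\<i> c\<close> times the real number
  \<open><x, A x>\<close>, hence zero. All resolvent bounds below rest on this identity.\<close>

lemma norm_shift_sq:
  assumes "hinner (A x) x = hinner x (A x)"
  shows "(norm (A x - hscaleC (\<i> * complex_of_real c) x))\<^sup>2 = (norm (A x))\<^sup>2 + c\<^sup>2 * (norm x)\<^sup>2"
  unfolding norm_diff_sq
  using hinner_symmetric_real[of A x, OF assms] assms
  by (simp add: hinner_hscaleC_right norm_mult power_mult_distrib)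

text \<open>The range is closed because the shift is bounded below and \<open>A\<close> is closed. A
  vector orthogonal to the range lies in \<open>D\<close> and satisfies
  \<open>A y = - \<i> c y\<close>, which forces \<open>y = 0\<close> since \<open><y, A y>\<close>
  is real.\<close>

lemma self_adjoint_shift_surj:
  assumes sa: "self_adjoint D A" and c: "c \<noteq> 0"
  shows "\<exists>x\<in>D. A x - hscaleC (\<i> * complex_of_real c) x = y"
proof -
  define B where "B x = A x - hscaleC (\<i> * complex_of_real c) x" for x
  note A = clinear_onD[OF self_adjointD(1)[OF sa]] and D = csubspaceD[OF self_adjointD(3)[OF sa]]
  have Badd: "x \<in> D \<Longrightarrow> y \<in> D \<Longrightarrow> B (x + y) = B x + B y" for x y
    unfolding B_def using A by (simp add: hscaleC_add_right)
  have Bscale: "x \<in> D \<Longrightarrow> B (hscaleC k x) = hscaleC k (B x)" for x k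
    unfolding B_def using A by (simp add: hscaleC_diff_right hscaleC_hscaleC mult.commute)
  have Bdiff: "x \<in> D \<Longrightarrow> y \<in> D \<Longrightarrow> B (x - y) = B x - B y" for x y
    unfolding B_def using A by (simp add: hscaleC_diff_right)
  have low: "\<bar>c\<bar> * norm x \<le> norm (B x)" "norm (A x) \<le> norm (B x)" if "x \<in> D" for x
  proof -
    have eq: "(norm (B x))\<^sup>2 = (norm (A x))\<^sup>2 + (\<bar>c\<bar> * norm x)\<^sup>2"
      unfolding B_def using norm_shift_sq[of A x c] self_adjointD(4)[OF sa that that]
      by (simp add: power_mult_distrib)
    show "\<bar>c\<bar> * norm x \<le> norm (B x)" "norm (A x) \<le> norm (B x)"
      by (rule power2_le_imp_le; use eq in simp)+
  qed
  have "B ` D = UNIV"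
  proof (rule closed_csubspace_UNIV)
    show "csubspace (B ` D)"
      unfolding csubspace_def
    proof (intro conjI ballI allI)
      have "B 0 = 0" unfolding B_def using A by simp
      then show "0 \<in> B ` D" using D(1) by (metis image_eqI)
      fix u assume "u \<in> B ` D"
      then obtain x where x: "x \<in> D" "u = B x" by auto
      show "hscaleC k u \<in> B ` D" for k
        unfolding x(2) Bscale[OF x(1), symmetric] by (rule imageI) (rule D(3)[OF x(1)])
      fix v assume "v \<in> B ` D"
      then obtain y where y: "y \<in> D" "v = B y" by auto
      show "u + v \<in> B ` D"
        unfolding x(2) y(2) Badd[OF x(1) y(1), symmetric] by (rule imageI) (rule D(2)[OF x(1) y(1)])
    qed
    show "closed (B ` D)"
      unfolding closed_sequential_limits
    proof (intro allI impI, elim conjE)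
      fix Y l assume Y: "\<forall>n. Y n \<in> B ` D" and l: "Y \<longlonglongrightarrow> l"
      then have "\<forall>n. \<exists>x. x \<in> D \<and> Y n = B x" by auto
      then obtain X where X: "\<And>n. X n \<in> D" "\<And>n. Y n = B (X n)" using choice by metis
      have cY: "Cauchy Y" using l by (rule LIMSEQ_imp_Cauchy)
      have "Cauchy X"
      proof (rule metric_CauchyI)
        fix e :: real assume e: "e > 0"
        then obtain M where M: "\<And>a b. a \<ge> M \<Longrightarrow> b \<ge> M \<Longrightarrow> dist (Y a) (Y b) < \<bar>c\<bar> * e"
          using metric_CauchyD[OF cY, of "\<bar>c\<bar> * e"] c by auto
        have "dist (X a) (X b) < e" if "a \<ge> M" "b \<ge> M" for a b
        proof -
          have "\<bar>c\<bar> * norm (X a - X b) \<le> norm (Y a - Y b)"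
            using low(1)[of "X a - X b"] X D Bdiff by simp
          also have "\<dots> < \<bar>c\<bar> * e" using M[OF that] by (simp add: dist_norm)
          finally show ?thesis using c by (simp add: dist_norm)
        qed
        then show "\<exists>M. \<forall>m\<ge>M. \<forall>n\<ge>M. dist (X m) (X n) < e" by blast
      qed
      then obtain x where x: "X \<longlonglongrightarrow> x" using Cauchy_convergent_iff convergent_def by blast
      have "A (X n) = Y n + hscaleC (\<i> * complex_of_real c) (X n)" for n
        using X(2) unfolding B_def by simp
      then have "(\<lambda>n. A (X n)) \<longlonglongrightarrow> l + hscaleC (\<i> * complex_of_real c) x"
        using x l by (simp add: tendsto_add tendsto_hscaleC)
      then have "x \<in> D" "A x = l + hscaleC (\<i> * complex_of_real c) x"
        using self_adjoint_closed[OF sa X(1) x] by auto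
      then show "l \<in> B ` D" by (intro image_eqI[of _ _ x]) (auto simp: B_def)
    qed
    fix y assume orth: "\<And>x. x \<in> B ` D \<Longrightarrow> hinner x y = 0"
    have "hinner (A x) y = hinner x (hscaleC (- \<i> * complex_of_real c) y)" if "x \<in> D" for x
    proof -
      have "hinner (B x) y = 0" using orth that by blast
      then show ?thesis unfolding B_def by (simp add: hinner_simps eq_neg_iff_add_eq_0)
    qed
    then have yD: "y \<in> D" and Ay: "A y = hscaleC (- \<i> * complex_of_real c) y"
      using self_adjointD(5,6)[OF sa] by blast+
    have "hinner (A y) y = hinner y (A y)" using self_adjointD(4)[OF sa yD yD] .
    then have "2 * (\<i> * complex_of_real c) * hinner y y = 0"
      unfolding Ay by (simp add: hinner_simps)
    then show "y = 0" using c by (simp add: hinner_self_eq_0)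
  qed
  then obtain x where "x \<in> D" "y = B x" by blast
  then show ?thesis unfolding B_def by auto
qed

lemma self_adjoint_shift_inj:
  assumes sa: "self_adjoint D A" and c: "c \<noteq> 0" and xy: "x \<in> D" "y \<in> D"
    and eq: "A x - hscaleC (\<i> * complex_of_real c) x = A y - hscaleC (\<i> * complex_of_real c) y"
  shows "x = y"
proof -
  note A = clinear_onD[OF self_adjointD(1)[OF sa]] and D = csubspaceD[OF self_adjointD(3)[OF sa]]
  have "A (x - y) - hscaleC (\<i> * complex_of_real c) (x - y) = 0"
    using eq unfolding A(6)[OF xy] hscaleC_diff_right by (simp add: algebra_simps)
  then have "(norm (A (x - y)))\<^sup>2 + c\<^sup>2 * (norm (x - y))\<^sup>2 = 0"
    using norm_shift_sq[of A "x-y" c, OF self_adjointD(4)[OF sa D(6)[OF xy] D(6)[OF xy]]]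
    by (simp only: norm_zero power_zero_numeral)
  then have "c\<^sup>2 * (norm (x - y))\<^sup>2 = 0"
    by (smt (verit) zero_le_mult_iff zero_le_power2)
  then show ?thesis using c by simp
qed

text \<open>For \<open>y\<close> in the domain of the adjoint, surjectivity of one shift yields
  \<open>v\<close> in \<open>D\<close> with the same image under the adjoint shift; then
  \<open>y - v\<close> is orthogonal to the range of the other shift, which is the whole
  space.\<close>

lemma self_adjointI_surj:
  assumes lin: "clinear_on D A" and dense: "closure D = UNIV"
    and sym: "\<And>x y. x \<in> D \<Longrightarrow> y \<in> D \<Longrightarrow> hinner (A x) y = hinner x (A y)"
    and surj: "\<And>y. \<exists>x\<in>D. A x - hscaleC (\<i> * complex_of_real c) x = y"
      "\<And>y. \<exists>x\<in>D. A x + hscaleC (\<i> * complex_of_real c) x = y"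
  shows "self_adjoint D A"
proof -
  note A = clinear_onD[OF lin]
  have "y \<in> D" if z: "\<And>x. x \<in> D \<Longrightarrow> hinner (A x) y = hinner x z" for y z
  proof -
    obtain v where v: "v \<in> D" "A v - hscaleC (\<i> * complex_of_real c) v = z - hscaleC (\<i> * complex_of_real c) y"
      using surj(1) by blast
    have "y = v"
    proof (rule hinner_eqI)
      fix u
      obtain x where x: "x \<in> D" "A x + hscaleC (\<i> * complex_of_real c) x = u" using surj(2) by blast
      have "hinner u y = hinner x (z - hscaleC (\<i> * complex_of_real c) y)"
        unfolding x(2)[symmetric] by (simp add: hinner_simps z[OF x(1)])
      also have "\<dots> = hinner u v"
        unfolding x(2)[symmetric] v(2)[symmetric] by (simp add: hinner_simps sym[OF x(1) v(1)])
      finally show "hinner u y = hinner u v" .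
    qed
    then show ?thesis using v by simp
  qed
  then show ?thesis unfolding self_adjoint_def using lin dense sym by blast
qed

section \<open>Perturbation by a relatively bounded operator\<close>

text \<open>With \<open>R = (H - \<i> c)^-1\<close> the equation for \<open>x = R u\<close> reads
  \<open>u = y - V (R u)\<close>. Since \<open>|H R u|\<close> is at most \<open>|u|\<close> and
  \<open>|R u|\<close> at most \<open>|u| / |c|\<close>, the right-hand side is a contraction with
  constant \<open>a + b / |c|\<close>.\<close>

lemma Kato_Rellich_surj:
  assumes sa: "self_adjoint D H" and V: "clinear_on D V" and c: "c \<noteq> 0"
    and bound: "\<And>x. x \<in> D \<Longrightarrow> norm (V x) \<le> a * norm (H x) + b * norm x" and nn: "0 \<le> a" "0 \<le> b"
    and small: "a + b / \<bar>c\<bar> < 1"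
  shows "\<exists>x\<in>D. H x + V x - hscaleC (\<i> * complex_of_real c) x = y"
proof -
  note H = clinear_onD[OF self_adjointD(1)[OF sa]] and D = csubspaceD[OF self_adjointD(3)[OF sa]]
  note V' = clinear_onD[OF V]
  obtain R where R: "\<And>y. R y \<in> D" "\<And>y. H (R y) - hscaleC (\<i> * complex_of_real c) (R y) = y"
    using self_adjoint_shift_surj[OF sa c] by metis
  have Rdiff: "R (u - v) = R u - R v" for u v
  proof (rule self_adjoint_shift_inj[OF sa c R(1) D(6)[OF R(1) R(1)]])
    have "H (R u - R v) - hscaleC (\<i> * complex_of_real c) (R u - R v)
        = (H (R u) - hscaleC (\<i> * complex_of_real c) (R u)) - (H (R v) - hscaleC (\<i> * complex_of_real c) (R v))"
      by (simp only: H(6)[OF R(1) R(1)] hscaleC_diff_right) simp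
    then show "H (R (u - v)) - hscaleC (\<i> * complex_of_real c) (R (u - v))
        = H (R u - R v) - hscaleC (\<i> * complex_of_real c) (R u - R v)"
      by (simp only: R(2))
  qed
  have VR: "norm (V (R u)) \<le> (a + b / \<bar>c\<bar>) * norm u" for u
  proof -
    have eq: "(norm u)\<^sup>2 = (norm (H (R u)))\<^sup>2 + (\<bar>c\<bar> * norm (R u))\<^sup>2"
      using norm_shift_sq[of H "R u" c] self_adjointD(4)[OF sa R(1) R(1)] R(2)
      by (simp add: power_mult_distrib)
    have 1: "norm (H (R u)) \<le> norm u" by (rule power2_le_imp_le; use eq in simp)
    have "\<bar>c\<bar> * norm (R u) \<le> norm u" by (rule power2_le_imp_le; use eq in simp)
    then have 2: "norm (R u) \<le> norm u / \<bar>c\<bar>" using c by (simp add: field_simps)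
    have "norm (V (R u)) \<le> a * norm (H (R u)) + b * norm (R u)" using bound R(1) by blast
    also have "\<dots> \<le> a * norm u + b * (norm u / \<bar>c\<bar>)"
      using 1 2 nn by (intro add_mono mult_left_mono) auto
    finally show ?thesis by (simp add: distrib_right)
  qed
  define g where "g u = y - V (R u)" for u
  have "\<exists>!u. g u = u"
  proof (rule banach_fix_type[of "a + b / \<bar>c\<bar>"])
    show "\<forall>x y. dist (g x) (g y) \<le> (a + b / \<bar>c\<bar>) * dist x y"
    proof (intro allI)
      fix u v
      have "g u - g v = - V (R (u - v))"
        unfolding g_def Rdiff using V'(6)[OF R(1) R(1)] by simp
      then show "dist (g u) (g v) \<le> (a + b / \<bar>c\<bar>) * dist u v"
        using VR[of "u - v"] by (simp add: dist_norm)
    qed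
  qed (use nn small c in \<open>auto intro!: add_nonneg_nonneg\<close>)
  then obtain u where u: "y - V (R u) = u" unfolding g_def by blast
  have "H (R u) + V (R u) - hscaleC (\<i> * complex_of_real c) (R u) = y"
    using R(2)[of u] u by (simp add: algebra_simps)
  then show ?thesis using R(1) by blast
qed

theorem Kato_Rellich:
  assumes sa: "self_adjoint D H" and V: "symmetric_op DV V"
    and rb: "rel_bounded D H DV V" and rb1: "rel_bound D H V < 1"
  shows "self_adjoint D (\<lambda>x. H x + V x)"
proof -
  define S where "S = {a. 0 \<le> a \<and> (\<exists>b. 0 \<le> b \<and> (\<forall>\<psi>\<in>D. norm (V \<psi>) \<le> a * norm (H \<psi>) + b * norm \<psi>))}"
  have DV: "D \<subseteq> DV" and "S \<noteq> {}" using rb unfolding rel_bounded_def S_def by auto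
  moreover have "Inf S < 1" using rb1 unfolding rel_bound_def S_def .
  ultimately obtain a where "a \<in> S" "a < 1" using cInf_lessD by metis
  then obtain b where ab: "0 \<le> a" "a < 1" "0 \<le> b" "\<And>x. x \<in> D \<Longrightarrow> norm (V x) \<le> a * norm (H x) + b * norm x"
    unfolding S_def by blast
  \<comment> \<open>Chosen so that \<open>b / c = (1 - a) b / (b + 1)\<close>, which is strictly
    below \<open>1 - a\<close>.\<close>
  define c where "c = (b + 1) / (1 - a)"
  have c: "c > 0" using ab unfolding c_def by simp
  have small: "a + b / \<bar>c\<bar> < 1" using ab c unfolding c_def by (simp add: field_simps)
  note H = clinear_onD[OF self_adjointD(1)[OF sa]] and D = csubspaceD[OF self_adjointD(3)[OF sa]]
  have Vlin: "clinear_on D V"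
    using V DV H(1) unfolding symmetric_op_def clinear_on_def by blast
  have Vsym: "hinner (V x) y = hinner x (V y)" if "x \<in> D" "y \<in> D" for x y
    using V DV that unfolding symmetric_op_def by blast
  show ?thesis
  proof (rule self_adjointI_surj[where c = c])
    show "clinear_on D (\<lambda>x. H x + V x)"
      using H clinear_onD[OF Vlin] unfolding clinear_on_def by (auto simp: hscaleC_add_right)
    show "\<exists>x\<in>D. H x + V x - hscaleC (\<i> * complex_of_real c) x = y" for y
      using Kato_Rellich_surj[OF sa Vlin _ ab(4,1,3) small] c by auto
    show "\<exists>x\<in>D. H x + V x + hscaleC (\<i> * complex_of_real c) x = y" for y
      using Kato_Rellich_surj[OF sa Vlin _ ab(4,1,3), of "-c"] c small by (auto simp: hscaleC_minus_left)
  qed (use self_adjointD(2,4)[OF sa] Vsym in \<open>auto simp: hinner_simps\<close>)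
qed

section \<open>Operator calculi generated by bounded pointwise limits\<close>

definition bounded_borel :: "(real \<Rightarrow> complex) set" where
  "bounded_borel = {g \<in> borel_measurable borel. \<exists>C. \<forall>t. cmod (g t) \<le> C}"

lemma bounded_borelI:
  "g \<in> borel_measurable borel \<Longrightarrow> (\<And>t. cmod (g t) \<le> C) \<Longrightarrow> g \<in> bounded_borel"
  unfolding bounded_borel_def by blast

lemma bounded_borel_measurable: "g \<in> bounded_borel \<Longrightarrow> g \<in> borel_measurable borel"
  unfolding bounded_borel_def by blast

lemma bounded_borel_bound:
  assumes "g \<in> bounded_borel"
  obtains C where "C \<ge> 0" "\<And>t. cmod (g t) \<le> C"
  using assms unfolding bounded_borel_def by (smt (verit, best) mem_Collect_eq norm_ge_zero)

lemma bounded_borel_const [simp]: "(\<lambda>t. c) \<in> bounded_borel"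
  by (rule bounded_borelI[where C="cmod c"]) auto

lemma bounded_borel_indicator: "B \<in> sets borel \<Longrightarrow> indicator B \<in> bounded_borel"
  by (rule bounded_borelI[where C=1]) (auto simp: indicator_def)

lemma bounded_borel_add:
  assumes "g \<in> bounded_borel" "k \<in> bounded_borel"
  shows "(\<lambda>t. g t + k t) \<in> bounded_borel"
proof -
  obtain C E where "\<And>t. cmod (g t) \<le> C" "\<And>t. cmod (k t) \<le> E"
    using bounded_borel_bound assms by metis
  then show ?thesis using assms[THEN bounded_borel_measurable]
    by (intro bounded_borelI[where C="C+E"]) (auto intro: norm_triangle_mono)
qed

lemma bounded_borel_mult:
  assumes "g \<in> bounded_borel" "k \<in> bounded_borel"
  shows "(\<lambda>t. g t * k t) \<in> bounded_borel"
proof -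
  obtain C E where "0 \<le> C" "\<And>t. cmod (g t) \<le> C" "\<And>t. cmod (k t) \<le> E"
    using bounded_borel_bound assms by metis
  then show ?thesis using assms[THEN bounded_borel_measurable]
    by (intro bounded_borelI[where C="C*E"]) (auto simp: norm_mult intro: mult_mono)
qed

lemma bounded_borel_scale: "g \<in> bounded_borel \<Longrightarrow> (\<lambda>t. c * g t) \<in> bounded_borel"
  by (intro bounded_borel_mult) auto

lemma bounded_borel_cnj:
  assumes "g \<in> bounded_borel"
  shows "(\<lambda>t. cnj (g t)) \<in> bounded_borel"
proof -
  obtain C where "\<And>t. cmod (g t) \<le> C"
    using bounded_borel_bound assms by metis
  moreover have "cnj \<in> borel_measurable borel"
    by (intro borel_measurable_continuous_onI continuous_intros)
  ultimately show ?thesis using assms[THEN bounded_borel_measurable]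
    by (intro bounded_borelI[where C=C]) (auto intro: measurable_compose)
qed

lemma integrable_bounded_borel:
  assumes "g \<in> bounded_borel" "finite_measure M" "sets M = sets borel"
  shows "integrable M g"
proof -
  obtain C where C: "\<And>t. cmod (g t) \<le> C" using bounded_borel_bound assms by metis
  have "g \<in> borel_measurable M"
    using bounded_borel_measurable[OF assms(1)] measurable_cong_sets[OF assms(3) refl] by blast
  then show ?thesis
    using C by (intro finite_measure.integrable_const_bound[OF assms(2), of _ C]) auto
qed

inductive_set bgen :: "(real \<Rightarrow> complex) set \<Rightarrow> (real \<Rightarrow> complex) set" for G where
  base: "g \<in> G \<Longrightarrow> g \<in> bgen G"
| add: "g \<in> bgen G \<Longrightarrow> k \<in> bgen G \<Longrightarrow> (\<lambda>t. g t + k t) \<in> bgen G"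
| scale: "g \<in> bgen G \<Longrightarrow> (\<lambda>t. c * g t) \<in> bgen G"
| lim: "(\<And>n. s n \<in> bgen G) \<Longrightarrow> (\<And>n t. cmod (s n t) \<le> C) \<Longrightarrow> (\<And>t. (\<lambda>n. s n t) \<longlonglongrightarrow> g t)
    \<Longrightarrow> g \<in> bgen G"

lemma bounded_borel_lim:
  assumes "\<And>n. s n \<in> bounded_borel" "\<And>n t. cmod (s n t) \<le> C" "\<And>t. (\<lambda>n. s n t) \<longlonglongrightarrow> g t"
  shows "g \<in> bounded_borel"
proof (rule bounded_borelI)
  show "g \<in> borel_measurable borel"
    by (rule borel_measurable_LIMSEQ_metric[of s]) (use assms bounded_borel_measurable in auto)
  show "cmod (g t) \<le> C" for t
    by (rule LIMSEQ_le_const2[OF tendsto_norm[OF assms(3)]]) (use assms(2) in auto)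
qed

lemma bgen_bounded_borel:
  assumes "g \<in> bgen G" "G \<subseteq> bounded_borel"
  shows "g \<in> bounded_borel"
  using assms(1)
proof (induction rule: bgen.induct)
  case (lim s C g)
  then show ?case using bounded_borel_lim by blast
qed (use assms(2) bounded_borel_add bounded_borel_scale in auto)

text \<open>The induction for a fixed right factor is run twice: with a generator as that factor,
  which settles products of a generator with any element, and then with an arbitrary
  element.\<close>

lemma bgen_mult:
  assumes G: "\<And>d e. d \<in> G \<Longrightarrow> e \<in> G \<Longrightarrow> (\<lambda>t. d t * e t) \<in> G" and sub: "G \<subseteq> bounded_borel"
    and g: "g \<in> bgen G" and k: "k \<in> bgen G"
  shows "(\<lambda>t. g t * k t) \<in> bgen G"
proof -
  have step: "(\<lambda>t. g t * k t) \<in> bgen G"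
    if k: "k \<in> bounded_borel" "\<And>d. d \<in> G \<Longrightarrow> (\<lambda>t. d t * k t) \<in> bgen G" and g: "g \<in> bgen G" for g k
    using g
  proof (induction rule: bgen.induct)
    case (base g)
    then show ?case by (rule k(2))
  next
    case (add g l)
    then show ?case using bgen.add by (simp add: distrib_right)
  next
    case (scale l c)
    then show ?case using bgen.scale[of "\<lambda>t. l t * k t" G c] by (simp add: mult.assoc)
  next
    case (lim s C l)
    obtain E where E: "0 \<le> E" "\<And>t. cmod (k t) \<le> E" using bounded_borel_bound[OF k(1)] by blast
    have C: "0 \<le> C" using lim.hyps(2) norm_ge_zero order_trans by blast
    show ?case
    proof (rule bgen.lim[where s="\<lambda>n t. s n t * k t" and C="C * E"])
      show "cmod (s n t * k t) \<le> C * E" for n t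
        unfolding norm_mult using E C lim.hyps(2) by (intro mult_mono) auto
    qed (use lim in \<open>auto intro!: tendsto_mult tendsto_const\<close>)
  qed
  have "(\<lambda>t. d t * k t) \<in> bgen G" if d: "d \<in> G" for d
    using step[OF subsetD[OF sub d] bgen.base[OF G[OF _ d]] k] by (simp add: mult.commute)
  then show ?thesis using step[OF bgen_bounded_borel[OF k sub] _ g] by blast
qed

lemma bounded_borel_subset_bgen:
  assumes ind: "\<And>B. B \<in> sets borel \<Longrightarrow> indicator B \<in> bgen G"
  shows "bounded_borel \<subseteq> bgen G"
proof -
  have zero: "(\<lambda>t. 0) \<in> bgen G" using ind[of "{}"] by (simp add: indicator_def[abs_def])
  \<comment> \<open>Boundedness is carried as a premise inside the induction claim: the
    measurable-function induction passes through unbounded functions, and in the monotone limit the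
    bound of \<open>u\<close> must serve every approximant.\<close>
  have nonneg: "(\<exists>C. \<forall>t. u t \<le> C) \<longrightarrow> (\<lambda>t. complex_of_real (u t)) \<in> bgen G"
    if "u \<in> borel_measurable borel" "\<And>t. 0 \<le> u t" for u :: "real \<Rightarrow> real"
    using that
  proof (induction rule: borel_measurable_induct_real)
    case (set A)
    have "(\<lambda>t. complex_of_real (indicator A t)) = indicator A" by (auto simp: indicator_def)
    then show ?case using ind[OF set] by simp
  next
    case (mult u c)
    show ?case
    proof
      assume "\<exists>C. \<forall>t. c * u t \<le> C"
      then obtain C where C: "\<And>t. c * u t \<le> C" by auto
      show "(\<lambda>t. complex_of_real (c * u t)) \<in> bgen G"
      proof (cases "c = 0")
        case False
        then have "u t \<le> C / c" for t using C[of t] mult(1) by (simp add: field_simps)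
        then have "(\<lambda>t. complex_of_real c * complex_of_real (u t)) \<in> bgen G"
          using mult.IH by (intro bgen.scale) blast
        then show ?thesis by simp
      qed (use zero in simp)
    qed
  next
    case (add u v)
    show ?case
    proof
      assume "\<exists>C. \<forall>t. v t + u t \<le> C"
      then obtain C where C: "\<And>t. v t + u t \<le> C" by auto
      have "u t \<le> C" "v t \<le> C" for t
        using C[of t] add(2)[of t] add.hyps(4)[of t] by linarith+
      then have "(\<lambda>t. complex_of_real (v t) + complex_of_real (u t)) \<in> bgen G"
        using add.IH by (intro bgen.add) blast+
      then show "(\<lambda>t. complex_of_real (v t + u t)) \<in> bgen G" by simp
    qed
  next
    case (seq U)
    show ?case
    proof
      assume "\<exists>C. \<forall>t. u t \<le> C"
      then obtain C where C: "\<And>t. u t \<le> C" by auto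
      have le: "U i t \<le> u t" for i t
        using incseq_le[of "\<lambda>i. U i t"] seq.hyps(3,4) by (auto simp: incseq_def le_fun_def)
      show "(\<lambda>t. complex_of_real (u t)) \<in> bgen G"
      proof (rule bgen.lim[where s="\<lambda>n t. complex_of_real (U n t)" and C=C])
        show "(\<lambda>t. complex_of_real (U n t)) \<in> bgen G" for n
          using seq.IH[of n] le C order_trans by blast
        show "cmod (complex_of_real (U n t)) \<le> C" for n t
          using seq(2)[of n t] le[of n t] C[of t] by simp
      qed (use seq.hyps(4) in \<open>auto intro: tendsto_of_real\<close>)
    qed
  qed
  show ?thesis
  proof
    fix g assume g: "g \<in> bounded_borel"
    obtain C where C: "C \<ge> 0" "\<And>t. cmod (g t) \<le> C" using bounded_borel_bound[OF g] by blast
    note [measurable] = bounded_borel_measurable[OF g]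
    have "(\<lambda>t. complex_of_real (max 0 (u t))) \<in> bgen G"
      if [measurable]: "u \<in> borel_measurable borel" and "\<And>t. \<bar>u t\<bar> \<le> C" for u
    proof -
      have "max 0 (u t) \<le> C" for t using that(2)[of t] C(1) by auto
      then show ?thesis using nonneg[of "\<lambda>t. max 0 (u t)"] by auto
    qed
    then have parts: "(\<lambda>t. complex_of_real (max 0 (Re (g t)))) \<in> bgen G"
      "(\<lambda>t. complex_of_real (max 0 (- Re (g t)))) \<in> bgen G"
      "(\<lambda>t. complex_of_real (max 0 (Im (g t)))) \<in> bgen G"
      "(\<lambda>t. complex_of_real (max 0 (- Im (g t)))) \<in> bgen G"
      by (simp_all add: order_trans[OF abs_Re_le_cmod C(2)] order_trans[OF abs_Im_le_cmod C(2)])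
    have "(\<lambda>t. (complex_of_real (max 0 (Re (g t))) + (-1) * complex_of_real (max 0 (- Re (g t))))
        + (\<i> * complex_of_real (max 0 (Im (g t))) + (-\<i>) * complex_of_real (max 0 (- Im (g t))))) \<in> bgen G"
      by (intro bgen.add bgen.scale parts)
    also have "(\<lambda>t. (complex_of_real (max 0 (Re (g t))) + (-1) * complex_of_real (max 0 (- Re (g t))))
        + (\<i> * complex_of_real (max 0 (Im (g t))) + (-\<i>) * complex_of_real (max 0 (- Im (g t))))) = g"
      by (rule ext, rule complex_eqI) (auto simp: max_def)
    finally show "g \<in> bgen G" .
  qed
qed

section \<open>Operators determined by their quadratic forms\<close>

lemma norm_polar_le:
  assumes "\<And>x. cmod (q x) \<le> C * (norm (x::'a::chilbert))\<^sup>2" "C \<ge> 0"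
  shows "cmod (polar q x y) \<le> C * (norm x + norm y)\<^sup>2"
proof -
  have "cmod (q (x + hscaleC (\<i> ^ k) y) / \<i> ^ k) \<le> C * (norm x + norm y)\<^sup>2" for k
  proof -
    have "norm (x + hscaleC (\<i> ^ k) y) \<le> norm x + norm y"
      by (rule norm_triangle_le) (simp add: norm_power)
    then have "C * (norm (x + hscaleC (\<i> ^ k) y))\<^sup>2 \<le> C * (norm x + norm y)\<^sup>2"
      using assms(2) by (intro mult_left_mono power_mono) auto
    then show ?thesis using assms(1)[of "x + hscaleC (\<i> ^ k) y"] by (simp add: norm_divide norm_power)
  qed
  then have "cmod (\<Sum>k<4. q (x + hscaleC (\<i> ^ k) y) / \<i> ^ k) \<le> (\<Sum>k<(4::nat). C * (norm x + norm y)\<^sup>2)"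
    by (intro sum_norm_le) auto
  then show ?thesis unfolding polar_def by (simp add: norm_divide)
qed

lemma tendsto_polar:
  assumes "\<And>x. (\<lambda>n. q n x) \<longlonglongrightarrow> p x"
  shows "(\<lambda>n. polar (q n) x y) \<longlonglongrightarrow> polar p x y"
  unfolding polar_def by (intro tendsto_intros assms) auto

text \<open>The polarised limit inherits sesquilinearity from the forms of \<open>T n\<close>, and
  its bound comes from the bound on the diagonal, so no uniform bound on the operators is involved.
  Riesz then supplies \<open>S\<close>.\<close>

lemma bounded_form_limit_operator:
  fixes q :: "'a::chilbert \<Rightarrow> complex"
  assumes T: "\<And>n. bounded_clinear_op (T n)" and lim: "\<And>x. (\<lambda>n. hinner x (T n x)) \<longlonglongrightarrow> q x"
    and bd: "\<And>x. cmod (q x) \<le> C * (norm x)\<^sup>2" and C: "C \<ge> 0"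
  obtains S where "bounded_clinear_op S" "\<And>x. hinner x (S x) = q x"
proof -
  define b where "b = polar q"
  note Tl = bounded_clinear_opD[OF T]
  have bl: "(\<lambda>n. hinner x (T n y)) \<longlonglongrightarrow> b x y" for x y
    using tendsto_polar[of "\<lambda>n v. hinner v (T n v)" q x y] lim polarization[OF Tl(6)]
    unfolding b_def by simp
  have b_add1: "b (x + x') y = b x y + b x' y" for x x' y
    by (rule LIMSEQ_unique[OF bl]) (unfold hinner_add_left, intro tendsto_add bl)
  have b_add2: "b x (y + y') = b x y + b x y'" for x y y'
    by (rule LIMSEQ_unique[OF bl]) (unfold hinner_add_right Tl, intro tendsto_add bl)
  have b_sc1: "b (hscaleC c x) y = cnj c * b x y" for c x y
    by (rule LIMSEQ_unique[OF bl]) (unfold hinner_hscaleC_left, intro tendsto_mult tendsto_const bl)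
  have b_sc2: "b x (hscaleC c y) = c * b x y" for c x y
    by (rule LIMSEQ_unique[OF bl]) (unfold hinner_hscaleC_right Tl, intro tendsto_mult tendsto_const bl)
  have b_diag: "b x x = q x" for x by (rule LIMSEQ_unique[OF bl lim])
  have b0: "b 0 y = 0" "b x 0 = 0" for x y using b_sc1[of 0 0 y] b_sc2[of x 0 0] by auto
  \<comment> \<open>The factor 4 is \<open>(1 + 1)^2\<close>, the polar bound at two unit vectors;
    homogeneity extends it to all vectors.\<close>
  have bb: "cmod (b x y) \<le> 4 * C * norm x * norm y" for x y
  proof (cases "x = 0 \<or> y = 0")
    case False
    define u v where "u = hscaleC (complex_of_real (1 / norm x)) x" and "v = hscaleC (complex_of_real (1 / norm y)) y"
    have n: "norm u = 1" "norm v = 1" using False unfolding u_def v_def norm_hscaleC norm_of_real by auto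
    have xy: "x = hscaleC (complex_of_real (norm x)) u" "y = hscaleC (complex_of_real (norm y)) v"
      using False unfolding u_def v_def by (auto simp: hscaleC_hscaleC hscaleC_one)
    have "cmod (b u v) \<le> 4 * C"
      using norm_polar_le[OF bd C, of u v] n unfolding b_def by (simp add: mult.commute)
    moreover have "b x y = complex_of_real (norm x) * complex_of_real (norm y) * b u v"
      by (subst xy(1), subst xy(2)) (simp add: b_sc1 b_sc2)
    ultimately show ?thesis
      using mult_left_mono[of "cmod (b u v)" "4 * C" "norm x * norm y"] by (simp add: norm_mult mult_ac)
  qed (use b0 in auto)
  have "\<exists>z. \<forall>x. b x y = hinner x z" for y
  proof -
    have "cmod (b x y) \<le> (4 * C * norm y) * norm x" for x
      using bb[of x y] by (simp add: mult_ac)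
    \<comment> \<open>The form is conjugate-linear in \<open>x\<close>, so the Riesz representation
      is applied to its conjugate.\<close>
    then obtain z where z: "\<And>x. cnj (b x y) = hinner z x"
      by (rule_tac Riesz_representation[of UNIV "\<lambda>x. cnj (b x y)" "4 * C * norm y"])
        (auto simp: b_add1 b_sc1)
    have "b x y = hinner x z" for x using z[of x] by (metis complex_cnj_cnj hinner_conj)
    then show ?thesis by blast
  qed
  then obtain S where S: "\<And>x y. b x y = hinner x (S y)" by metis
  have "bounded_clinear_op S"
  proof (rule bounded_clinear_opI[where K="4*C"])
    show "S (x + y) = S x + S y" for x y
      by (rule hinner_eqI) (simp add: S[symmetric] b_add2 hinner_add_right)
    show "S (hscaleC c x) = hscaleC c (S x)" for c x
      by (rule hinner_eqI) (simp add: S[symmetric] b_sc2 hinner_hscaleC_right)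
    show "norm (S x) \<le> 4 * C * norm x" for x
    proof (cases "norm (S x) = 0")
      case False
      have "norm (S x) * norm (S x) = cmod (b (S x) x)"
        unfolding S hinner_self_norm norm_of_real by (simp add: power2_eq_square)
      also have "\<dots> \<le> norm (S x) * (4 * C * norm x)" using bb[of "S x" x] by (simp add: mult_ac)
      finally show ?thesis using False by (auto simp: mult_le_cancel_left)
    qed (use C in simp)
  qed
  moreover have "hinner x (S x) = q x" for x using S[of x x] b_diag by simp
  ultimately show thesis using that by blast
qed

lemma adjoint_exists:
  assumes T: "bounded_clinear_op (T :: 'a::chilbert \<Rightarrow> 'a)"
  obtains S where "bounded_clinear_op S" "\<And>x y. hinner (S x) y = hinner x (T y)"
proof -
  note Tl = bounded_clinear_opD[OF T]
  have bl: "bounded_linear T" using T by (rule bounded_clinear_op_bounded_linear)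
  have bd: "cmod (hinner x (T v)) \<le> (onorm T * norm x) * norm v" for x v
    using order_trans[OF hinner_Cauchy_Schwarz[of x "T v"] mult_left_mono[OF onorm[OF bl, of v] norm_ge_zero[of x]]]
    by (simp add: mult_ac)
  have "\<exists>w. \<forall>v. hinner x (T v) = hinner w v" for x
    by (rule Riesz_representation[of UNIV "\<lambda>v. hinner x (T v)", OF _ _ _ _ bd])
       (auto simp: Tl hinner_simps)
  then obtain S where S: "\<And>x v. hinner (S x) v = hinner x (T v)" by metis
  have S': "hinner v (S x) = hinner (T v) x" for x v
    by (subst (1 2) hinner_conj) (simp add: S)
  have "bounded_clinear_op S"
  proof (rule bounded_clinear_opI[where K="onorm T"])
    show "S (x + y) = S x + S y" for x y by (rule hinner_eqI) (simp add: S' hinner_simps)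
    show "S (hscaleC c x) = hscaleC c (S x)" for c x by (rule hinner_eqI) (simp add: S' hinner_simps)
    show "norm (S x) \<le> onorm T * norm x" for x
    proof (cases "norm (S x) = 0")
      case False
      have "norm (S x) * norm (S x) = cmod (hinner x (T (S x)))"
        unfolding S[symmetric] hinner_self_norm norm_of_real by (simp add: power2_eq_square)
      also have "\<dots> \<le> (onorm T * norm x) * norm (S x)" by (rule bd)
      finally show ?thesis using False by (auto simp: mult_le_cancel_right)
    qed (use onorm_pos_le[OF bl] in simp)
  qed
  then show thesis using S that by blast
qed

section \<open>The abstract bounded Borel calculus\<close>

text \<open>The description inside \<open>fcalc\<close> with the family of diagonal measures as a
  parameter, which makes it available before any projection-valued measure has been
  constructed.\<close>

definition opint :: "('a::chilbert \<Rightarrow> real measure) \<Rightarrow> (real \<Rightarrow> complex) \<Rightarrow> 'a \<Rightarrow> 'a" where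
  "opint \<mu> g = (THE F. bounded_clinear_op F \<and> (\<forall>x. hinner x (F x) = (LINT t|\<mu> x. g t)))"

lemma opint_eqI:
  assumes "bounded_clinear_op F" "\<And>x. hinner x (F x) = (LINT t|\<mu> x. g t)"
  shows "opint \<mu> g = F"
  unfolding opint_def
proof (rule the_equality)
  show "S = F" if "bounded_clinear_op S \<and> (\<forall>x. hinner x (S x) = (LINT t|\<mu> x. g t))" for S
    using bounded_clinear_op_eqI[of S F] that assms by simp
qed (use assms in blast)

text \<open>\<open>\<mu> x\<close> plays the part of the measure
  \<open>B \<mapsto> <x, E(B) x>\<close>. Linearity in the symbol follows from uniqueness of an
  operator with given diagonal, so the only algebraic laws listed are the product and the
  unit.\<close>

locale op_calculus =
  fixes \<mu> :: "'a::chilbert \<Rightarrow> real measure"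
  assumes finite: "finite_measure (\<mu> x)"
    and sets_eq [simp, measurable_cong]: "sets (\<mu> x) = sets borel"
    and opint_bounded: "g \<in> bounded_borel \<Longrightarrow> bounded_clinear_op (opint \<mu> g)"
    and hinner_opint: "g \<in> bounded_borel \<Longrightarrow> hinner x (opint \<mu> g x) = (LINT t|\<mu> x. g t)"
    and opint_mult: "g \<in> bounded_borel \<Longrightarrow> k \<in> bounded_borel \<Longrightarrow>
      opint \<mu> (\<lambda>t. g t * k t) x = opint \<mu> g (opint \<mu> k x)"
    and opint_one: "opint \<mu> (\<lambda>t. 1) x = x"

text \<open>A calculus is determined by a multiplicative generating family \<open>G\<close>: existence of the operators
  passes to bounded pointwise limits, and multiplicativity follows by extending first one factor
  and then the other.\<close>

theorem op_calculusI:
  fixes \<mu> :: "'a::chilbert \<Rightarrow> real measure"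
  assumes fin: "\<And>x. finite_measure (\<mu> x)" and sets: "\<And>x. sets (\<mu> x) = sets borel"
    and Gb: "G \<subseteq> bounded_borel" and gen: "bounded_borel \<subseteq> bgen G"
    and Gmult: "\<And>d e. d \<in> G \<Longrightarrow> e \<in> G \<Longrightarrow> (\<lambda>t. d t * e t) \<in> G" and G1: "(\<lambda>t. 1) \<in> G"
    and T: "\<And>d. d \<in> G \<Longrightarrow> bounded_clinear_op (T d)"
    and Tint: "\<And>d x. d \<in> G \<Longrightarrow> hinner x (T d x) = (LINT t|\<mu> x. d t)"
    and Tmult: "\<And>d e x. d \<in> G \<Longrightarrow> e \<in> G \<Longrightarrow> T (\<lambda>t. d t * e t) x = T d (T e x)"
    and T1: "\<And>x. T (\<lambda>t. 1) x = x"
  shows "op_calculus \<mu> \<and> (\<forall>d\<in>G. opint \<mu> d = T d)"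
proof -
  have int: "integrable (\<mu> x) g" if "g \<in> bounded_borel" for g x
    using integrable_bounded_borel[OF that fin sets] .
  \<comment> \<open>The constant 1 belongs to \<open>G\<close> and goes to the identity, so the
    total mass is \<open>|x|^2\<close>; this makes every integral a bounded quadratic form.\<close>
  have total: "measure (\<mu> x) (space (\<mu> x)) = (norm x)\<^sup>2" for x
    using Tint[OF G1, of x] T1[of x]
    by (metis hinner_self_norm lebesgue_integral_const of_real_eq_iff scaleR_conv_of_real mult.right_neutral)
  have bound: "cmod (LINT t|\<mu> x. g t) \<le> C * (norm x)\<^sup>2" if "\<And>t. cmod (g t) \<le> C" "g \<in> bounded_borel" for g C x
  proof -
    have "cmod (LINT t|\<mu> x. g t) \<le> (LINT t|\<mu> x. cmod (g t))" by (rule integral_norm_bound)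
    also have "\<dots> \<le> (LINT t|\<mu> x. C)"
      using that int by (intro integral_mono integrable_norm finite_measure.integrable_const fin) auto
    also have "\<dots> = C * (norm x)\<^sup>2" using total by simp
    finally show ?thesis .
  qed
  have conv: "(\<lambda>n. LINT t|\<mu> x. s n t) \<longlonglongrightarrow> (LINT t|\<mu> x. g t)"
    if "\<And>n. s n \<in> bounded_borel" "\<And>n t. cmod (s n t) \<le> C" "\<And>t. (\<lambda>n. s n t) \<longlonglongrightarrow> g t" for s C g x
  proof (rule integral_dominated_convergence[where w="\<lambda>t. C"])
    have meas: "k \<in> borel_measurable (\<mu> x)" if "k \<in> bounded_borel" for k
      using bounded_borel_measurable[OF that] measurable_cong_sets[OF sets refl] by blast
    show "g \<in> borel_measurable (\<mu> x)" using bounded_borel_lim[of s C g] that meas by blast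
    show "\<And>n. s n \<in> borel_measurable (\<mu> x)" using meas that by blast
  qed (use that finite_measure.integrable_const[OF fin] in auto)
  have ex: "\<exists>F. bounded_clinear_op F \<and> (\<forall>x. hinner x (F x) = (LINT t|\<mu> x. g t))" if "g \<in> bgen G" for g
    using that
  proof (induction rule: bgen.induct)
    case (base g)
    then show ?case using T Tint by blast
  next
    case (add g k)
    then obtain A B where A: "bounded_clinear_op A" "\<And>x. hinner x (A x) = (LINT t|\<mu> x. g t)"
      and B: "bounded_clinear_op B" "\<And>x. hinner x (B x) = (LINT t|\<mu> x. k t)" by blast
    show ?case
      using A B add(1,2)[THEN bgen_bounded_borel, OF Gb] int
      by (intro exI[of _ "\<lambda>x. A x + B x"]) (auto simp: bounded_clinear_op_add hinner_add_right)
  next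
    case (scale g c)
    then obtain A where A: "bounded_clinear_op A" "\<And>x. hinner x (A x) = (LINT t|\<mu> x. g t)" by blast
    show ?case
      using A by (intro exI[of _ "\<lambda>x. hscaleC c (A x)"]) (auto simp: bounded_clinear_op_scale hinner_hscaleC_right)
  next
    case (lim s C g)
    then obtain A where A: "\<And>n. bounded_clinear_op (A n)" "\<And>n x. hinner x (A n x) = (LINT t|\<mu> x. s n t)" by metis
    have sb: "s n \<in> bounded_borel" for n using lim(1) bgen_bounded_borel Gb by blast
    have C0: "0 \<le> C" using lim.hyps(2) norm_ge_zero order_trans by blast
    have gb: "g \<in> bounded_borel" using bounded_borel_lim[of s C g] sb lim by blast
    have gC: "cmod (g t) \<le> C" for t
      by (rule LIMSEQ_le_const2[OF tendsto_norm[OF lim.hyps(3)]]) (use lim.hyps(2) in auto)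
    show ?case
      by (rule bounded_form_limit_operator[of A "\<lambda>x. LINT t|\<mu> x. g t" C])
         (use A conv[of s C g, OF sb lim.hyps(2,3)] bound[OF gC gb] C0 in auto)
  qed
  have op: "bounded_clinear_op (opint \<mu> g)" "hinner x (opint \<mu> g x) = (LINT t|\<mu> x. g t)"
    if g: "g \<in> bounded_borel" for g x
  proof -
    obtain F where F: "bounded_clinear_op F" "\<And>x. hinner x (F x) = (LINT t|\<mu> x. g t)"
      using ex[OF subsetD[OF gen g]] by blast
    from opint_eqI[OF this] F show "bounded_clinear_op (opint \<mu> g)" "hinner x (opint \<mu> g x) = (LINT t|\<mu> x. g t)"
      by simp_all
  qed
  have opT: "\<And>d. d \<in> G \<Longrightarrow> opint \<mu> d = T d"
    using opint_eqI T Tint by blast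
  have o_add: "opint \<mu> (\<lambda>t. g t + k t) x = opint \<mu> g x + opint \<mu> k x"
    if "g \<in> bounded_borel" "k \<in> bounded_borel" for g k x
    using opint_eqI[of "\<lambda>x. opint \<mu> g x + opint \<mu> k x" \<mu> "\<lambda>t. g t + k t"] that op int
    by (simp add: bounded_clinear_op_add hinner_add_right)
  have o_scale: "opint \<mu> (\<lambda>t. c * g t) x = hscaleC c (opint \<mu> g x)"
    if "g \<in> bounded_borel" for g c x
    using opint_eqI[of "\<lambda>x. hscaleC c (opint \<mu> g x)" \<mu> "\<lambda>t. c * g t"] that op int
    by (simp add: bounded_clinear_op_scale hinner_hscaleC_right)
  \<comment> \<open>Weak convergence is all that the forms provide at this stage, since a norm
    formula for \<open>opint\<close> requires the multiplicativity still to be proved.\<close>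
  have o_lim: "(\<lambda>n. hinner x (opint \<mu> (s n) y)) \<longlonglongrightarrow> hinner x (opint \<mu> g y)"
    if s: "\<And>n. s n \<in> bounded_borel" "\<And>n t. cmod (s n t) \<le> C" "\<And>t. (\<lambda>n. s n t) \<longlonglongrightarrow> g t" for s C g x y
  proof -
    have g: "g \<in> bounded_borel" using bounded_borel_lim[of s C g] s by blast
    have eq: "hinner x (opint \<mu> k y) = polar (\<lambda>v. LINT t|\<mu> v. k t) x y" if "k \<in> bounded_borel" for k
      using polarization[OF bounded_clinear_opD(6)[OF op(1)[OF that]], of x y] op(2)[OF that] by simp
    show ?thesis unfolding eq[OF s(1)] eq[OF g]
      by (intro tendsto_polar conv[of s C] s)
  qed
  have m1: "opint \<mu> (\<lambda>t. d t * k t) x = opint \<mu> d (opint \<mu> k x)" if "d \<in> G" "k \<in> bgen G" for d k x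
    using that(2)
  proof (induction arbitrary: x rule: bgen.induct)
    case (base k)
    then show ?case using opT Tmult Gmult that(1) by simp
  next
    case (add g k)
    have b: "d \<in> bounded_borel" "g \<in> bounded_borel" "k \<in> bounded_borel"
      using add that(1) Gb bgen_bounded_borel by blast+
    show ?case
      using add b by (simp add: distrib_left o_add bounded_borel_mult bounded_clinear_opD(1)[OF op(1)[OF b(1)]])
  next
    case (scale g c)
    have b: "d \<in> bounded_borel" "g \<in> bounded_borel"
      using scale that(1) Gb bgen_bounded_borel by blast+
    have "opint \<mu> (\<lambda>t. c * (d t * g t)) x = hscaleC c (opint \<mu> d (opint \<mu> g x))"
      using scale b by (simp add: o_scale bounded_borel_mult)
    then show ?case
      using b by (simp add: mult.left_commute o_scale bounded_clinear_opD(2)[OF op(1)[OF b(1)]])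
  next
    case (lim s C g)
    have b: "d \<in> bounded_borel" "\<And>n. s n \<in> bounded_borel"
      using lim that(1) Gb bgen_bounded_borel by blast+
    obtain E where E: "0 \<le> E" "\<And>t. cmod (d t) \<le> E" using bounded_borel_bound[OF b(1)] by blast
    have bd: "cmod (d t * s n t) \<le> E * C" for n t
      unfolding norm_mult using E lim.hyps(2) by (intro mult_mono) auto
    show ?case
    proof (rule hinner_eqI)
      fix z
      have 1: "(\<lambda>n. hinner z (opint \<mu> (\<lambda>t. d t * s n t) x)) \<longlonglongrightarrow> hinner z (opint \<mu> (\<lambda>t. d t * g t) x)"
        by (rule o_lim[OF _ bd]) (use b lim in \<open>auto intro!: tendsto_mult tendsto_const bounded_borel_mult\<close>)
      \<comment> \<open>The adjoint moves the left operator onto \<open>z\<close>, so weak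
        convergence of the right factors against the fixed vector \<open>w\<close> is
        enough.\<close>
      obtain w where w: "\<And>v. hinner z (opint \<mu> d v) = hinner w v"
        by (rule adjoint_exists[OF op(1)[OF b(1)]]) metis
      have 2: "(\<lambda>n. hinner z (opint \<mu> d (opint \<mu> (s n) x))) \<longlonglongrightarrow> hinner z (opint \<mu> d (opint \<mu> g x))"
        unfolding w by (rule o_lim[OF b(2) lim.hyps(2,3)])
      show "hinner z (opint \<mu> (\<lambda>t. d t * g t) x) = hinner z (opint \<mu> d (opint \<mu> g x))"
        using LIMSEQ_unique[OF 1] 2 lim.IH by simp
    qed
  qed
  have m2: "opint \<mu> (\<lambda>t. g t * k t) x = opint \<mu> g (opint \<mu> k x)" if "g \<in> bgen G" and k: "k \<in> bounded_borel" for g k x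
    using that(1)
  proof (induction arbitrary: x rule: bgen.induct)
    case (base d)
    then show ?case using m1 k gen by blast
  next
    case (add g l)
    have b: "l \<in> bounded_borel" "g \<in> bounded_borel"
      using add Gb bgen_bounded_borel by blast+
    show ?case using add b k by (simp add: distrib_right o_add bounded_borel_mult)
  next
    case (scale g c)
    have b: "g \<in> bounded_borel" using scale Gb bgen_bounded_borel by blast
    show ?case using scale b k by (simp add: mult.assoc o_scale bounded_borel_mult)
  next
    case (lim s C g)
    have b: "\<And>n. s n \<in> bounded_borel"
      using lim that(1) Gb bgen_bounded_borel by blast+
    obtain E where E: "0 \<le> E" "\<And>t. cmod (k t) \<le> E" using bounded_borel_bound[OF k] by blast
    have C: "0 \<le> C" using lim.hyps(2) norm_ge_zero order_trans by blast
    have bd: "cmod (s n t * k t) \<le> C * E" for n t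
      unfolding norm_mult using E C lim.hyps(2) by (intro mult_mono) auto
    show ?case
    proof (rule hinner_eqI)
      fix z
      have 1: "(\<lambda>n. hinner z (opint \<mu> (\<lambda>t. s n t * k t) x)) \<longlonglongrightarrow> hinner z (opint \<mu> (\<lambda>t. g t * k t) x)"
        by (rule o_lim[OF _ bd]) (use b lim that in \<open>auto intro!: tendsto_mult tendsto_const bounded_borel_mult\<close>)
      have 2: "(\<lambda>n. hinner z (opint \<mu> (s n) (opint \<mu> k x))) \<longlonglongrightarrow> hinner z (opint \<mu> g (opint \<mu> k x))"
        by (rule o_lim[OF b lim.hyps(2,3)])
      show "hinner z (opint \<mu> (\<lambda>t. g t * k t) x) = hinner z (opint \<mu> g (opint \<mu> k x))"
        using LIMSEQ_unique[OF 1] 2 lim.IH by simp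
    qed
  qed
  have "op_calculus \<mu>"
    by (rule op_calculus.intro)
       (simp_all only: fin sets op m2[OF subsetD[OF gen]] opT[OF G1] T1)
  then show ?thesis using opT by blast
qed

section \<open>Projection-valued measures and unbounded operators\<close>

context op_calculus
begin

lemma integrable: "g \<in> bounded_borel \<Longrightarrow> integrable (\<mu> x) g"
  by (rule integrable_bounded_borel[OF _ finite sets_eq])

lemma measurable_mu: "g \<in> borel_measurable borel \<Longrightarrow> g \<in> borel_measurable (\<mu> x)"
  using measurable_cong_sets[OF sets_eq refl] by blast

lemma opint_add:
  "g \<in> bounded_borel \<Longrightarrow> k \<in> bounded_borel \<Longrightarrow> opint \<mu> (\<lambda>t. g t + k t) x = opint \<mu> g x + opint \<mu> k x"
  using opint_eqI[of "\<lambda>x. opint \<mu> g x + opint \<mu> k x" \<mu> "\<lambda>t. g t + k t"]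
  by (simp add: bounded_clinear_op_add hinner_add_right opint_bounded hinner_opint integrable)

lemma opint_scale: "g \<in> bounded_borel \<Longrightarrow> opint \<mu> (\<lambda>t. c * g t) x = hscaleC c (opint \<mu> g x)"
  using opint_eqI[of "\<lambda>x. hscaleC c (opint \<mu> g x)" \<mu> "\<lambda>t. c * g t"]
  by (simp add: bounded_clinear_op_scale hinner_hscaleC_right opint_bounded hinner_opint integrable)

lemma opint_diff:
  assumes "g \<in> bounded_borel" "k \<in> bounded_borel"
  shows "opint \<mu> (\<lambda>t. g t - k t) x = opint \<mu> g x - opint \<mu> k x"
  using opint_add[OF assms(1) bounded_borel_scale[OF assms(2), of "-1"]] opint_scale[OF assms(2), of "-1"]
  by (simp add: hscaleC_minus_left hscaleC_one)

text \<open>The adjoint has the conjugate diagonal, and uniqueness identifies it with the operator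
  of the conjugate symbol.\<close>

lemma hinner_opint_adjoint:
  assumes g: "g \<in> bounded_borel"
  shows "hinner (opint \<mu> (\<lambda>t. cnj (g t)) x) y = hinner x (opint \<mu> g y)"
proof -
  obtain S where S: "bounded_clinear_op S" "\<And>x y. hinner (S x) y = hinner x (opint \<mu> g y)"
    by (rule adjoint_exists[OF opint_bounded[OF g]]) blast
  have "hinner x (S x) = (LINT t|\<mu> x. cnj (g t))" for x
    by (subst hinner_conj) (simp add: S hinner_opint[OF g] integrable[OF g])
  then show ?thesis using opint_eqI[OF S(1)] S(2) by metis
qed

lemma hinner_opint_opint:
  assumes "g \<in> bounded_borel" "k \<in> bounded_borel"
  shows "hinner (opint \<mu> g x) (opint \<mu> k x) = (LINT t|\<mu> x. cnj (g t) * k t)"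
  using hinner_opint_adjoint[OF bounded_borel_cnj[OF assms(1)], of x "opint \<mu> k x"] assms
  by (simp add: opint_mult[symmetric] bounded_borel_cnj hinner_opint bounded_borel_mult)

text \<open>The isometry from \<open>L^2(\<mu> x)\<close> that later turns dominated convergence of
  symbols into norm convergence of vectors.\<close>

lemma norm_opint_sq:
  assumes "g \<in> bounded_borel"
  shows "(norm (opint \<mu> g x))\<^sup>2 = (LINT t|\<mu> x. (cmod (g t))\<^sup>2)"
proof -
  have "complex_of_real ((norm (opint \<mu> g x))\<^sup>2) = (LINT t|\<mu> x. cnj (g t) * g t)"
    using hinner_opint_opint[OF assms assms] by (simp add: hinner_self_norm)
  also have "\<dots> = (LINT t|\<mu> x. complex_of_real ((cmod (g t))\<^sup>2))"
    by (intro Bochner_Integration.integral_cong refl) (metis complex_norm_square mult.commute)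
  also have "\<dots> = complex_of_real (LINT t|\<mu> x. (cmod (g t))\<^sup>2)" by (rule integral_complex_of_real)
  finally show ?thesis using of_real_eq_iff by blast
qed

text \<open>By multiplicativity the mass of \<open>B\<close> is
  \<open><g(A) x, 1_B(A) g(A) x>\<close>, the integral of \<open>|g|^2\<close> over
  \<open>B\<close>. Domain questions about \<open>g(A) x\<close> thereby become integrability
  questions for \<open>\<mu> x\<close>.\<close>

lemma opint_measure_density:
  assumes g: "g \<in> bounded_borel"
  shows "\<mu> (opint \<mu> g x) = density (\<mu> x) (\<lambda>t. ennreal ((cmod (g t))\<^sup>2))"
proof (rule measure_eqI)
  note [measurable] = bounded_borel_measurable[OF g]
  have gm [measurable]: "g \<in> borel_measurable (\<mu> x)"
    using bounded_borel_measurable[OF g] by (rule measurable_mu)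
  fix B assume "B \<in> sets (\<mu> (opint \<mu> g x))"
  then have B: "B \<in> sets borel" by simp
  have iB: "indicator B \<in> bounded_borel" using B by (rule bounded_borel_indicator)
  have "complex_of_real (measure (\<mu> (opint \<mu> g x)) B) = (LINT t|\<mu> (opint \<mu> g x). indicator B t)"
  proof -
    have "(\<lambda>t. indicator B t :: complex) = (\<lambda>t. complex_of_real (indicator B t))" by (auto simp: indicator_def)
    then show ?thesis using B sets_eq_imp_space_eq[OF sets_eq] by simp
  qed
  also have "\<dots> = hinner (opint \<mu> g x) (opint \<mu> (indicator B) (opint \<mu> g x))"
    by (simp add: hinner_opint[OF iB])
  also have "\<dots> = (LINT t|\<mu> x. cnj (g t) * (indicator B t * g t))"
    using hinner_opint_opint[OF g bounded_borel_mult[OF iB g]] by (simp add: opint_mult[OF iB g])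
  also have "\<dots> = (LINT t|\<mu> x. complex_of_real (indicator B t * (cmod (g t))\<^sup>2))"
    by (intro Bochner_Integration.integral_cong refl)
       (auto simp: indicator_def complex_norm_square mult.commute simp del: of_real_power)
  also have "\<dots> = complex_of_real (LINT t|\<mu> x. indicator B t * (cmod (g t))\<^sup>2)"
    by (rule integral_complex_of_real)
  finally have eq: "measure (\<mu> (opint \<mu> g x)) B = (LINT t|\<mu> x. indicator B t * (cmod (g t))\<^sup>2)"
    using of_real_eq_iff by blast
  obtain C where C: "C \<ge> 0" "\<And>t. cmod (g t) \<le> C" using bounded_borel_bound[OF g] by blast
  have int: "integrable (\<mu> x) (\<lambda>t. indicator B t * (cmod (g t))\<^sup>2)"
  proof (rule finite_measure.integrable_const_bound[OF finite, of _ "C\<^sup>2"])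
    show "AE t in \<mu> x. norm (indicator B t * (cmod (g t))\<^sup>2) \<le> C\<^sup>2"
      using C by (intro AE_I2) (auto simp: indicator_def power_mono)
  qed (use B in measurable)
  have "emeasure (\<mu> (opint \<mu> g x)) B = ennreal (LINT t|\<mu> x. indicator B t * (cmod (g t))\<^sup>2)"
    using finite_measure.emeasure_eq_measure[OF finite] eq by simp
  also have "\<dots> = (\<integral>\<^sup>+ t. ennreal (indicator B t * (cmod (g t))\<^sup>2) \<partial>\<mu> x)"
    by (rule nn_integral_eq_integral[symmetric, OF int]) simp
  also have "\<dots> = emeasure (density (\<mu> x) (\<lambda>t. ennreal ((cmod (g t))\<^sup>2))) B"
    using B by (subst emeasure_density)
      (auto intro!: nn_integral_cong simp: indicator_def ennreal_mult'')
  finally show "emeasure (\<mu> (opint \<mu> g x)) B = emeasure (density (\<mu> x) (\<lambda>t. ennreal ((cmod (g t))\<^sup>2))) B" .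
qed simp

lemma proj_valued_measure: "proj_valued_measure (\<lambda>B. opint \<mu> (indicator B))"
  and spec_meas_eq: "spec_meas (\<lambda>B. opint \<mu> (indicator B)) x = \<mu> x"
proof -
  have ind: "ennreal (Re (hinner x (opint \<mu> (indicator B) x))) = emeasure (\<mu> x) B" if "B \<in> sets borel" for B x
  proof -
    have "(\<lambda>t. indicator B t :: complex) = (\<lambda>t. complex_of_real (indicator B t))" by (auto simp: indicator_def)
    then have "hinner x (opint \<mu> (indicator B) x) = complex_of_real (measure (\<mu> x) B)"
      using that hinner_opint[OF bounded_borel_indicator[OF that]] sets_eq_imp_space_eq[OF sets_eq] by simp
    then show ?thesis using finite_measure.emeasure_eq_measure[OF finite] by simp
  qed
  have ca: "countably_additive (sets borel) (\<lambda>B. ennreal (Re (hinner x (opint \<mu> (indicator B) x))))" for x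
    unfolding countably_additive_def using ind suminf_emeasure[of _ "\<mu> x"]
    by (auto simp: subset_eq image_subset_iff)
  have mult: "opint \<mu> (indicator (B \<inter> C)) = opint \<mu> (indicator B) \<circ> opint \<mu> (indicator C)"
    if "B \<in> sets borel" "C \<in> sets borel" for B C
    using opint_mult[OF bounded_borel_indicator bounded_borel_indicator, OF that]
    by (auto simp: indicator_inter_arith[abs_def] fun_eq_iff)
  have sa: "hinner (opint \<mu> (indicator B) x) y = hinner x (opint \<mu> (indicator B) y)" if "B \<in> sets borel" for B x y
  proof -
    have "(\<lambda>t. cnj (indicator B t)) = indicator B" by (auto simp: indicator_def)
    then show ?thesis using hinner_opint_adjoint[OF bounded_borel_indicator[OF that]] by simp
  qed
  show "proj_valued_measure (\<lambda>B. opint \<mu> (indicator B))"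
    unfolding proj_valued_measure_def
    using ca mult sa mult[of B B for B] opint_bounded bounded_borel_indicator opint_one
    by (auto simp: indicator_def[abs_def])
  show "spec_meas (\<lambda>B. opint \<mu> (indicator B)) x = \<mu> x"
  proof (rule measure_eqI)
    have sp: "sets borel \<subseteq> Pow (UNIV :: real set)" by auto
    show 1: "sets (spec_meas (\<lambda>B. opint \<mu> (indicator B)) x) = sets (\<mu> x)"
      unfolding spec_meas_def using sets.sigma_sets_eq[of borel] by (simp add: sets_measure_of)
    fix B assume "B \<in> sets (spec_meas (\<lambda>B. opint \<mu> (indicator B)) x)"
    then have "B \<in> sets borel" using 1 by simp
    then show "emeasure (spec_meas (\<lambda>B. opint \<mu> (indicator B)) x) B = emeasure (\<mu> x) B"
      unfolding spec_meas_def using ca[of x] ind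
      by (subst emeasure_measure_of_sigma)
         (auto simp: positive_def sets.sigma_algebra_axioms[of borel, simplified] space_borel)
  qed
qed

end

text \<open>\<open>proj_valued_measure\<close> does not list \<open>E {} = 0\<close>, which
  \<open>measure_of\<close> needs. The sequence of empty sets is disjoint with empty union, so
  \<open>f {}\<close> dominates \<open>2 * f {}\<close>, and finiteness leaves only 0.\<close>

lemma countably_additive_empty:
  assumes "countably_additive \<A> f" "{} \<in> \<A>" "f {} < \<infinity>"
  shows "f {} = (0::ennreal)"
proof (rule ccontr)
  assume ne: "f {} \<noteq> 0"
  have "(\<Sum>i::nat. f {}) = f {}"
    using assms(1,2) unfolding countably_additive_def
    by (elim allE[of _ "\<lambda>_. {}"]) (auto simp: disjoint_family_on_def)
  moreover have "of_nat n * f {} \<le> (\<Sum>i::nat. f {})" for n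
    using sum_le_suminf[of "\<lambda>i::nat. f {}" "{..<n}"] by simp
  ultimately have "2 * f {} \<le> f {}" by (metis of_nat_numeral)
  then have "f {} + f {} \<le> f {} + 0" by (simp add: mult_2)
  then show False using ne assms(3) by (simp add: ennreal_add_left_cancel_le)
qed

text \<open>Converse of the preceding passage, needed for the resolution selected in
  \<open>fcalc\<close>. The generating family consists of the indicators of Borel sets.\<close>

lemma proj_valued_measure_calculus:
  assumes E: "proj_valued_measure E"
  shows "op_calculus (spec_meas E)"
    and "B \<in> sets borel \<Longrightarrow> opint (spec_meas E) (indicator B) = E B"
proof -
  have bd: "\<And>B. B \<in> sets borel \<Longrightarrow> bounded_clinear_op (E B)"
    and idem: "\<And>B x. B \<in> sets borel \<Longrightarrow> E B (E B x) = E B x"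
    and sa: "\<And>B x y. B \<in> sets borel \<Longrightarrow> hinner (E B x) y = hinner x (E B y)"
    and E1: "E UNIV = id"
    and mult: "\<And>B C. B \<in> sets borel \<Longrightarrow> C \<in> sets borel \<Longrightarrow> E (B \<inter> C) = E B \<circ> E C"
    and ca: "\<And>x. countably_additive (sets borel) (\<lambda>B. ennreal (Re (hinner x (E B x))))"
    using E unfolding proj_valued_measure_def by (auto simp: fun_eq_iff)
  have pos: "hinner x (E B x) = complex_of_real ((norm (E B x))\<^sup>2)" if "B \<in> sets borel" for B x
    using sa[OF that, of x "E B x"] idem[OF that, of x] by (simp add: hinner_self_norm)
  have sets: "sets (spec_meas E x) = sets borel" for x
    unfolding spec_meas_def using sets.sigma_sets_eq[of borel] by (simp add: sets_measure_of)
  have em: "emeasure (spec_meas E x) B = ennreal (Re (hinner x (E B x)))" if "B \<in> sets borel" for B x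
    unfolding spec_meas_def
  proof (rule emeasure_measure_of_sigma)
    show "sigma_algebra UNIV (sets borel)"
      using sets.sigma_algebra_axioms[of borel] by (simp add: space_borel)
    show "positive (sets borel) (\<lambda>B. ennreal (Re (hinner x (E B x))))"
      using countably_additive_empty[OF ca[of x]] by (simp add: positive_def)
  qed (use ca that in auto)
  have fin: "finite_measure (spec_meas E x)" for x
    by (rule finite_measureI)
       (use em[of UNIV x] sets_eq_imp_space_eq[OF sets, of x] in \<open>simp add: space_borel\<close>)
  have m: "measure (spec_meas E x) B = (norm (E B x))\<^sup>2" if "B \<in> sets borel" for B x
    unfolding measure_def em[OF that] pos[OF that] by simp
  \<comment> \<open>The operator has to depend on the function and not on a set; the set is
    recovered as the place where the indicator equals 1.\<close>
  define T where "T d = E {t. d t = (1::complex)}" for d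
  have Ti: "T (indicator B) = E B" for B
    unfolding T_def by (simp add: indicator_def[abs_def])
  have inter: "(\<lambda>t. indicator B t * indicator C t :: complex) = indicator (B \<inter> C)" for B C :: "real set"
    by (simp add: indicator_inter_arith fun_eq_iff)
  have one: "(\<lambda>t. 1 :: complex) = indicator (UNIV :: real set)" by (simp add: fun_eq_iff)
  let ?G = "indicator ` sets (borel :: real measure) :: (real \<Rightarrow> complex) set"
  have *: "hinner x (T d x) = (LINT t|spec_meas E x. d t)" if d: "d \<in> ?G" for d x
  proof -
    obtain B where B: "B \<in> sets borel" "d = indicator B" using d by auto
    have "d = (\<lambda>t. complex_of_real (indicator B t))" unfolding B by (auto simp: indicator_def)
    then have "(LINT t|spec_meas E x. d t) = complex_of_real (measure (spec_meas E x) B)"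
      using B(1) sets_eq_imp_space_eq[OF sets] by (simp add: space_borel)
    then show ?thesis using pos[OF B(1)] m[OF B(1)] B Ti by simp
  qed
  have main: "op_calculus (spec_meas E) \<and> (\<forall>d\<in>?G. opint (spec_meas E) d = T d)"
  proof (rule op_calculusI[where G="?G" and T=T])
    show "bounded_borel \<subseteq> bgen ?G" by (rule bounded_borel_subset_bgen) (rule bgen.base, simp)
    show "(\<lambda>t. 1) \<in> ?G" unfolding one by (rule imageI) simp
    show "T (\<lambda>t. 1) x = x" for x unfolding one Ti E1 by simp
    show "(\<lambda>t. d t * e t) \<in> ?G" if "d \<in> ?G" "e \<in> ?G" for d e
      using that by (auto simp: inter)
    show "T (\<lambda>t. d t * e t) x = T d (T e x)" if "d \<in> ?G" "e \<in> ?G" for d e x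
      using that by (auto simp: inter Ti mult)
  qed (use fin sets bounded_borel_indicator bd Ti * in auto)
  show "op_calculus (spec_meas E)" using main by simp
  show "B \<in> sets borel \<Longrightarrow> opint (spec_meas E) (indicator B) = E B"
    using main Ti by simp
qed

section \<open>An unbounded operator and its calculus\<close>

locale spectral_operator = op_calculus \<mu> for \<mu> :: "'a::chilbert \<Rightarrow> real measure" +
  fixes D :: "'a set" and A :: "'a \<Rightarrow> 'a"
  assumes sa: "self_adjoint D A"
    and dom: "D = {x. integrable (\<mu> x) (\<lambda>t. t\<^sup>2)}"
    and form: "x \<in> D \<Longrightarrow> hinner x (A x) = complex_of_real (LINT t|\<mu> x. t)"
begin

lemmas A_linear = clinear_onD[OF self_adjointD(1)[OF sa]]
lemmas D_subspace = csubspaceD[OF self_adjointD(3)[OF sa]]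

lemma integrable_sq: "x \<in> D \<Longrightarrow> integrable (\<mu> x) (\<lambda>t. t\<^sup>2)"
  using dom by blast

lemma measurable_id_mu [measurable]: "(\<lambda>t. t) \<in> borel_measurable (\<mu> x)"
  by (rule measurable_mu) simp

lemma integrable_id:
  assumes "x \<in> D"
  shows "integrable (\<mu> x) (\<lambda>t. t)"
proof (rule Bochner_Integration.integrable_bound)
  show "integrable (\<mu> x) (\<lambda>t. 1 + t\<^sup>2)"
    by (intro Bochner_Integration.integrable_add integrable_sq[OF assms] finite_measure.integrable_const[OF finite])
  have "\<bar>t\<bar> \<le> 1 + t\<^sup>2" for t :: real
  proof -
    have "0 \<le> (\<bar>t\<bar> - 1)\<^sup>2" by simp
    then show ?thesis unfolding power2_diff by simp
  qed
  then show "AE t in \<mu> x. norm t \<le> norm (1 + t\<^sup>2)" by (simp add: abs_of_nonneg add_nonneg_nonneg)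
qed simp

lemma integrable_id_mult:
  assumes "x \<in> D" and g: "g \<in> bounded_borel"
  shows "integrable (\<mu> x) (\<lambda>t. complex_of_real t * g t)"
proof -
  obtain C where C: "C \<ge> 0" "\<And>t. cmod (g t) \<le> C" using bounded_borel_bound[OF g] by blast
  have [measurable]: "g \<in> borel_measurable (\<mu> x)"
    using bounded_borel_measurable[OF g] by (rule measurable_mu)
  show ?thesis
  proof (rule Bochner_Integration.integrable_bound)
    show "integrable (\<mu> x) (\<lambda>t. C * t)"
      using integrable_id[OF assms(1)] by simp
    show "AE t in \<mu> x. norm (complex_of_real t * g t) \<le> norm (C * t)"
      using C by (intro AE_I2) (auto simp: norm_mult abs_mult mult.commute[of C] intro!: mult_left_mono)
  qed measurable
qed

text \<open>The new spectral measure has the bounded density \<open>|g|^2\<close>, so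
  \<open>t^2\<close> stays integrable.\<close>

lemma opint_in_D:
  assumes x: "x \<in> D" and g: "g \<in> bounded_borel"
  shows "opint \<mu> g x \<in> D"
proof -
  obtain C where C: "C \<ge> 0" "\<And>t. cmod (g t) \<le> C" using bounded_borel_bound[OF g] by blast
  have [measurable]: "g \<in> borel_measurable (\<mu> x)"
    using bounded_borel_measurable[OF g] by (rule measurable_mu)
  have "integrable (\<mu> x) (\<lambda>t. (cmod (g t))\<^sup>2 *\<^sub>R t\<^sup>2)"
  proof (rule Bochner_Integration.integrable_bound)
    show "integrable (\<mu> x) (\<lambda>t. C\<^sup>2 * t\<^sup>2)"
      using integrable_sq[OF x] by simp
    show "AE t in \<mu> x. norm ((cmod (g t))\<^sup>2 *\<^sub>R t\<^sup>2) \<le> norm (C\<^sup>2 * t\<^sup>2)"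
      using C by (intro AE_I2) (auto simp: abs_mult intro!: mult_right_mono power_mono)
  qed measurable
  then show ?thesis
    unfolding dom mem_Collect_eq opint_measure_density[OF g]
    by (subst integrable_density) auto
qed

lemma form_opint:
  assumes x: "x \<in> D" and g: "g \<in> bounded_borel"
  shows "hinner (opint \<mu> g x) (A (opint \<mu> g x)) = (LINT t|\<mu> x. complex_of_real t * complex_of_real ((cmod (g t))\<^sup>2))"
proof -
  have [measurable]: "g \<in> borel_measurable (\<mu> x)"
    using bounded_borel_measurable[OF g] by (rule measurable_mu)
  have "hinner (opint \<mu> g x) (A (opint \<mu> g x)) = complex_of_real (LINT t|\<mu> x. (cmod (g t))\<^sup>2 *\<^sub>R t)"
    unfolding form[OF opint_in_D[OF x g]] opint_measure_density[OF g]
    by (subst integral_density) auto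
  also have "\<dots> = (LINT t|\<mu> x. complex_of_real ((cmod (g t))\<^sup>2 *\<^sub>R t))"
    by (rule integral_complex_of_real[symmetric])
  finally show ?thesis by (simp add: mult.commute)
qed

text \<open>Only diagonal values of \<open>A\<close> are given. The vectors entering the
  polarisation are \<open>x + \<i>^k g(A) x = (1 + \<i>^k g)(A) x\<close>, so all four spectral
  measures have densities relative to \<open>\<mu> x\<close>, and polarising the scalars
  \<open>|1 + \<i>^k g|^2\<close> leaves \<open>t g(t)\<close>.\<close>

lemma hinner_A_opint:
  assumes x: "x \<in> D" and g: "g \<in> bounded_borel"
  shows "hinner x (A (opint \<mu> g x)) = (LINT t|\<mu> x. complex_of_real t * g t)"
proof -
  have gk: "(\<lambda>t. 1 + \<i> ^ k * g t) \<in> bounded_borel" for k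
    using bounded_borel_add[OF bounded_borel_const bounded_borel_scale[OF g]] .
  have op: "opint \<mu> (\<lambda>t. 1 + \<i> ^ k * g t) x = x + hscaleC (\<i> ^ k) (opint \<mu> g x)" for k
    by (simp add: opint_add opint_scale bounded_borel_scale g opint_one)
  have sq: "(\<lambda>t. complex_of_real ((cmod (g t))\<^sup>2)) \<in> bounded_borel" if "g \<in> bounded_borel" for g
    unfolding complex_norm_square using bounded_borel_mult[OF that bounded_borel_cnj[OF that]] .
  have "hinner x (A (opint \<mu> g x)) = polar (\<lambda>v. hinner v (A v)) x (opint \<mu> g x)"
    using polarization[OF self_adjointD(1)[OF sa] x opint_in_D[OF x g]] by simp
  also have "\<dots> = (\<Sum>k<4. (LINT t|\<mu> x. complex_of_real t * complex_of_real ((cmod (1 + \<i> ^ k * g t))\<^sup>2)) / \<i> ^ k) / 4"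
    unfolding polar_def op[symmetric] form_opint[OF x gk] ..
  also have "\<dots> = (LINT t|\<mu> x. (\<Sum>k<4. complex_of_real t * complex_of_real ((cmod (1 + \<i> ^ k * g t))\<^sup>2) / \<i> ^ k) / 4)"
    by (simp only: integral_divide_zero)
       (subst Bochner_Integration.integral_sum, auto intro!: integrable_id_mult[OF x] sq gk simp del: of_real_power)
  also have "\<dots> = (LINT t|\<mu> x. complex_of_real t * g t)"
  proof (intro Bochner_Integration.integral_cong refl)
    fix t
    show "(\<Sum>k<4. complex_of_real t * complex_of_real ((cmod (1 + \<i> ^ k * g t))\<^sup>2) / \<i> ^ k) / 4 = complex_of_real t * g t"
      unfolding complex_norm_square sum_lt4 by (simp add: i_pow3 field_simps)
  qed
  finally show ?thesis .
qed

lemma hinner_opint_A: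
  assumes x: "x \<in> D" and g: "g \<in> bounded_borel"
  shows "hinner x (opint \<mu> g (A x)) = (LINT t|\<mu> x. complex_of_real t * g t)"
proof -
  have "hinner x (opint \<mu> g (A x)) = hinner (opint \<mu> (\<lambda>t. cnj (g t)) x) (A x)"
    by (simp add: hinner_opint_adjoint[OF g])
  also have "\<dots> = hinner (A (opint \<mu> (\<lambda>t. cnj (g t)) x)) x"
    using self_adjointD(4)[OF sa opint_in_D[OF x bounded_borel_cnj[OF g]] x] by simp
  also have "\<dots> = cnj (LINT t|\<mu> x. complex_of_real t * cnj (g t))"
    by (subst hinner_conj) (simp add: hinner_A_opint[OF x bounded_borel_cnj[OF g]])
  also have "\<dots> = (LINT t|\<mu> x. cnj (complex_of_real t * cnj (g t)))"
    by (rule integral_bounded_linear[OF bounded_linear_cnj integrable_id_mult[OF x bounded_borel_cnj[OF g]], symmetric])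
  finally show ?thesis by simp
qed

lemma clinear_on_opint_A:
  assumes g: "g \<in> bounded_borel"
  shows "clinear_on D (\<lambda>x. opint \<mu> g (A x))" "clinear_on D (\<lambda>x. A (opint \<mu> g x))" "clinear_on D (opint \<mu> g)"
  using A_linear opint_in_D[OF _ g] bounded_clinear_opD[OF opint_bounded[OF g]]
  unfolding clinear_on_def by auto

text \<open>Both orders have the diagonal given by the integral of \<open>t g(t)\<close>.\<close>

lemma opint_A_commute:
  assumes x: "x \<in> D" and g: "g \<in> bounded_borel"
  shows "A (opint \<mu> g x) = opint \<mu> g (A x)"
  by (rule polarization_eq[OF clinear_on_opint_A(2,1)[OF g] self_adjointD(2)[OF sa] _ x])
     (simp add: hinner_A_opint hinner_opint_A g)

lemma opint_id_mult:
  assumes x: "x \<in> D" and g: "g \<in> bounded_borel" and tg: "(\<lambda>t. complex_of_real t * g t) \<in> bounded_borel"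
  shows "opint \<mu> (\<lambda>t. complex_of_real t * g t) x = opint \<mu> g (A x)"
  by (rule polarization_eq[OF clinear_on_opint_A(3)[OF tg] clinear_on_opint_A(1)[OF g] self_adjointD(2)[OF sa] _ x])
     (simp add: hinner_opint_A hinner_opint g tg)

end

section \<open>Unitary operators\<close>

text \<open>The Moebius map from the real line onto the unit circle without the point 1; its integer
  powers replace the trigonometric monomials.\<close>

definition cay :: "real \<Rightarrow> complex" where
  "cay t = (complex_of_real t - \<i>) / (complex_of_real t + \<i>)"

lemma of_real_plus_i_nz: "complex_of_real t + \<i> \<noteq> 0" "complex_of_real t - \<i> \<noteq> 0"
  by (auto simp: complex_eq_iff)

lemma norm_cay [simp]: "cmod (cay t) = 1"
proof -
  have "cmod (complex_of_real t - \<i>) = cmod (complex_of_real t + \<i>)" by (simp add: cmod_def)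
  then show ?thesis using of_real_plus_i_nz(1)[of t] unfolding cay_def norm_divide by simp
qed

lemma cay_nz [simp]: "cay t \<noteq> 0"
  using norm_cay[of t] by (metis norm_zero zero_neq_one)

lemma cay_eq: "cay t = Complex ((t\<^sup>2 - 1) / (t\<^sup>2 + 1)) (- 2 * t / (t\<^sup>2 + 1))"
proof -
  have p: "t\<^sup>2 + 1 \<noteq> 0" by (metis add_nonneg_pos less_numeral_extra(1,3) zero_le_power2)
  have "complex_of_real t - \<i> = Complex ((t\<^sup>2 - 1) / (t\<^sup>2 + 1)) (- 2 * t / (t\<^sup>2 + 1)) * (complex_of_real t + \<i>)"
  proof (rule complex_eqI)
    have "((t\<^sup>2 - 1) * t + 2 * t) = t * (t\<^sup>2 + 1)" "(t\<^sup>2 - 1) - 2 * t * t = - (t\<^sup>2 + 1)"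
      by (simp_all add: algebra_simps power2_eq_square)
    then show "Re (complex_of_real t - \<i>) = Re (Complex ((t\<^sup>2 - 1) / (t\<^sup>2 + 1)) (- 2 * t / (t\<^sup>2 + 1)) * (complex_of_real t + \<i>))"
      "Im (complex_of_real t - \<i>) = Im (Complex ((t\<^sup>2 - 1) / (t\<^sup>2 + 1)) (- 2 * t / (t\<^sup>2 + 1)) * (complex_of_real t + \<i>))"
      using p by (simp_all add: add_divide_distrib[symmetric] diff_divide_distrib[symmetric])
         (simp_all add: field_simps)
  qed
  then show ?thesis unfolding cay_def using of_real_plus_i_nz(1)[of t] by (simp add: divide_eq_eq)
qed

lemma borel_measurable_cay [measurable]: "cay \<in> borel_measurable borel"
  unfolding cay_def[abs_def]
  by (intro borel_measurable_continuous_onI continuous_intros) (use of_real_plus_i_nz in auto)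

lemma bounded_borel_cay_power: "(\<lambda>t. cay t powi n) \<in> bounded_borel"
proof (rule bounded_borelI)
  show "cmod (cay t powi n) \<le> 1" for t by (simp add: norm_power_int)
  have "continuous_on UNIV (\<lambda>t. cay t powi n)"
    unfolding cay_def by (intro continuous_intros) (use of_real_plus_i_nz in auto)
  then show "(\<lambda>t. cay t powi n) \<in> borel_measurable borel" by (rule borel_measurable_continuous_onI)
qed

lemma bgen_real_polynomial:
  assumes mult: "\<And>d e. d \<in> G \<Longrightarrow> e \<in> G \<Longrightarrow> (\<lambda>t. d t * e t) \<in> G" and sub: "G \<subseteq> bounded_borel"
    and one: "(\<lambda>t. 1) \<in> G" and a: "(\<lambda>t. complex_of_real (a t)) \<in> bgen G"
    and p: "real_polynomial_function (p :: real \<Rightarrow> real)"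
  shows "(\<lambda>t. complex_of_real (p (a t))) \<in> bgen G"
  using p
proof (induction rule: real_polynomial_function.induct)
  case (linear f)
  have "f x = f 1 * x" for x
    using linear_scale[OF bounded_linear.linear[OF linear], of x 1] by simp
  then have "(\<lambda>t. complex_of_real (f (a t))) = (\<lambda>t. complex_of_real (f 1) * complex_of_real (a t))"
    by (metis of_real_mult)
  then show ?case using bgen.scale[OF a, of "complex_of_real (f 1)"] by simp
next
  case (const c)
  show ?case using bgen.scale[OF bgen.base[OF one], of "complex_of_real c"] by simp
next
  case (add f g)
  then show ?case using bgen.add by fastforce
next
  case (mult f g)
  have "(\<lambda>t. complex_of_real (f (a t)) * complex_of_real (g (a t))) \<in> bgen G"
    by (rule bgen_mult[OF assms(1) sub mult.IH])
  then show ?case by simp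
qed

text \<open>The jump at \<open>c\<close> is a bounded limit of continuous ramps, and by Weierstrass
  on \<open>[-1, 1]\<close> each ramp is nearly a polynomial; polynomials in \<open>a\<close> stay
  in \<open>bgen G\<close>.\<close>

lemma bgen_indicator_greater:
  assumes mult: "\<And>d e. d \<in> G \<Longrightarrow> e \<in> G \<Longrightarrow> (\<lambda>t. d t * e t) \<in> G" and sub: "G \<subseteq> bounded_borel"
    and one: "(\<lambda>t. 1) \<in> G" and a: "(\<lambda>t. complex_of_real (a t)) \<in> bgen G" and a1: "\<And>t. \<bar>a t\<bar> \<le> 1"
  shows "indicator {t. c < a t} \<in> bgen G"
proof -
  \<comment> \<open>A ramp equal to 0 up to \<open>c\<close> and, for positive \<open>n\<close>, to
    1 from \<open>c + 1/n\<close> on. At \<open>c\<close> itself it vanishes, which yields the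
    strict inequality in the limit.\<close>
  define \<phi> where "\<phi> n x = min 1 (max 0 (real n * (x - c)))" for n x
  have "\<exists>p. real_polynomial_function p \<and> (\<forall>x\<in>{-1..1}. \<bar>\<phi> n x - p x\<bar> < 1 / real (Suc n))" for n
  proof -
    have "continuous_on {-1..1} (\<phi> n)" unfolding \<phi>_def by (intro continuous_intros)
    then obtain p where "real_polynomial_function p" "\<And>x. x \<in> {-1..1} \<Longrightarrow> \<bar>\<phi> n x - p x\<bar> < 1 / real (Suc n)"
      using Stone_Weierstrass_real_polynomial_function[of "{-1..1}" "\<phi> n" "1 / real (Suc n)" thesis] by simp
    then show ?thesis by blast
  qed
  then obtain p where p: "\<And>n. real_polynomial_function (p n)"
    "\<And>n x. x \<in> {-1..1} \<Longrightarrow> \<bar>\<phi> n x - p n x\<bar> < 1 / real (Suc n)" by metis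
  have close: "\<bar>\<phi> n (a t) - p n (a t)\<bar> < 1 / real (Suc n)" for n t
    using p(2)[of "a t" n] a1[of t] by (auto simp: abs_le_iff)
  have \<phi>lim: "(\<lambda>n. \<phi> n x) \<longlonglongrightarrow> (if c < x then 1 else 0)" for x
  proof (cases "c < x")
    case True
    obtain N where N: "1 / (x - c) < real N" using reals_Archimedean2 by blast
    have "\<phi> n x = 1" if "n \<ge> N" for n
    proof -
      have "1 / (x - c) < real n" using N that by linarith
      then have "1 < real n * (x - c)" using True by (simp add: field_simps)
      then show ?thesis unfolding \<phi>_def by simp
    qed
    then have "eventually (\<lambda>n. \<phi> n x = 1) sequentially"
      unfolding eventually_sequentially by blast
    then show ?thesis using True by (simp add: tendsto_eventually)
  next
    case False
    then have "real n * (x - c) \<le> 0" for n by (simp add: mult_nonneg_nonpos)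
    then have "\<phi> n x = 0" for n unfolding \<phi>_def by (simp add: max_absorb1)
    then show ?thesis using False by simp
  qed
  show ?thesis
  \<comment> \<open>The ramp lies in \<open>[0, 1]\<close> and the polynomial within 1 of it, whence
    the uniform bound 2.\<close>
  proof (rule bgen.lim[where s="\<lambda>n t. complex_of_real (p n (a t))" and C=2])
    show "(\<lambda>t. complex_of_real (p n (a t))) \<in> bgen G" for n
      by (rule bgen_real_polynomial[OF mult sub one a p(1)])
    show "cmod (complex_of_real (p n (a t))) \<le> 2" for n t
    proof -
      have "0 \<le> \<phi> n (a t)" "\<phi> n (a t) \<le> 1" unfolding \<phi>_def by auto
      moreover have "1 / real (Suc n) \<le> 1" by simp
      ultimately show ?thesis using close[of n t] unfolding norm_of_real by linarith
    qed
    fix t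
    have "(\<lambda>n. \<phi> n (a t) - p n (a t)) \<longlonglongrightarrow> 0"
    proof (rule Lim_null_comparison)
      show "\<forall>\<^sub>F n in sequentially. norm (\<phi> n (a t) - p n (a t)) \<le> 1 / real (Suc n)"
        using close[of _ t] by (auto intro: always_eventually less_imp_le)
      show "(\<lambda>n. 1 / real (Suc n)) \<longlonglongrightarrow> 0" by (rule LIMSEQ_Suc[OF lim_1_over_n])
    qed
    then have "(\<lambda>n. \<phi> n (a t) - (\<phi> n (a t) - p n (a t))) \<longlonglongrightarrow> (if c < a t then 1 else 0) - 0"
      by (intro tendsto_diff \<phi>lim)
    then have "(\<lambda>n. complex_of_real (p n (a t))) \<longlonglongrightarrow> complex_of_real (if c < a t then 1 else 0)"
      by (intro tendsto_of_real) simp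
    then show "(\<lambda>n. complex_of_real (p n (a t))) \<longlonglongrightarrow> indicator {t. c < a t} t"
      by (simp add: indicator_def split: if_splits)
  qed
qed

text \<open>The sets with indicator in \<open>bgen G\<close> form a \<open>\<sigma>\<close>-algebra for which \<open>Re cay\<close> and \<open>Im cay\<close>, hence
  also \<open>t = - Im (cay t) / (1 - Re (cay t))\<close>, are measurable.\<close>

lemma bgen_cay_powers:
  defines "G \<equiv> range (\<lambda>n t. cay t powi n)"
  shows "bounded_borel \<subseteq> bgen G"
    and "d \<in> G \<Longrightarrow> e \<in> G \<Longrightarrow> (\<lambda>t. d t * e t) \<in> G" and "G \<subseteq> bounded_borel" and "(\<lambda>t. 1) \<in> G"
proof -
  show mult: "\<And>d e. d \<in> G \<Longrightarrow> e \<in> G \<Longrightarrow> (\<lambda>t. d t * e t) \<in> G"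
    unfolding G_def by (force simp: power_int_add[symmetric])
  show sub: "G \<subseteq> bounded_borel" unfolding G_def using bounded_borel_cay_power by auto
  show one: "(\<lambda>t. 1) \<in> G" unfolding G_def by (rule image_eqI[of _ _ 0]) auto
  have c1: "cay \<in> bgen G" by (rule bgen.base) (auto simp: G_def intro!: image_eqI[of _ _ 1])
  have c2: "(\<lambda>t. cnj (cay t)) \<in> bgen G"
  \<comment> \<open>On the unit circle conjugation is inversion, so the conjugate is the power with
    exponent -1.\<close>
  proof (rule bgen.base, unfold G_def, rule image_eqI[of _ _ "-1"], rule ext)
    fix t
    have "cnj (cay t) * cay t = 1" using complex_norm_square[of "cay t"] by (simp add: mult.commute)
    then show "cnj (cay t) = cay t powi -1" by (simp add: power_int_minus field_simps)
  qed simp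
  have Re: "(\<lambda>t. complex_of_real (Re (cay t))) \<in> bgen G"
  proof -
    have "(\<lambda>t. (1/2) * (cay t + cnj (cay t))) \<in> bgen G" by (intro bgen.scale bgen.add c1 c2)
    also have "(\<lambda>t. (1/2) * (cay t + cnj (cay t))) = (\<lambda>t. complex_of_real (Re (cay t)))"
      by (simp add: complex_add_cnj)
    finally show ?thesis .
  qed
  have Im: "(\<lambda>t. complex_of_real (Im (cay t))) \<in> bgen G"
  proof -
    have "(\<lambda>t. (1/(2*\<i>)) * (cay t + (-1) * cnj (cay t))) \<in> bgen G" by (intro bgen.scale bgen.add c1 c2)
    also have "(\<lambda>t. (1/(2*\<i>)) * (cay t + (-1) * cnj (cay t))) = (\<lambda>t. complex_of_real (Im (cay t)))"
      by (rule ext, rule complex_eqI) (auto simp: Re_divide Im_divide power2_eq_square)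
    finally show ?thesis .
  qed
  define \<B> where "\<B> = {B. (indicator B :: real \<Rightarrow> complex) \<in> bgen G}"
  have compl: "- B \<in> \<B>" if "B \<in> \<B>" for B
  proof -
    have "(\<lambda>t. 1 + (-1) * indicator B t) \<in> bgen G"
      using that unfolding \<B>_def by (intro bgen.add bgen.scale bgen.base[OF one]) auto
    also have "(\<lambda>t. 1 + (-1) * indicator B t) = (indicator (- B) :: real \<Rightarrow> complex)"
      by (auto simp: indicator_def)
    finally show ?thesis unfolding \<B>_def by simp
  qed
  have inter: "B \<inter> C \<in> \<B>" if "B \<in> \<B>" "C \<in> \<B>" for B C
  proof -
    have "(\<lambda>t. indicator B t * indicator C t) = (indicator (B \<inter> C) :: real \<Rightarrow> complex)"
      by (simp add: indicator_inter_arith fun_eq_iff)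
    then show ?thesis using bgen_mult[OF mult sub] that unfolding \<B>_def by fastforce
  qed
  have un: "B \<union> C \<in> \<B>" if "B \<in> \<B>" "C \<in> \<B>" for B C
    using compl[OF inter[OF compl[OF that(1)] compl[OF that(2)]]] by simp
  have UNIV: "UNIV \<in> \<B>"
    using bgen.base[OF one] unfolding \<B>_def by (simp add: indicator_def[abs_def])
  have empty: "{} \<in> \<B>" using compl[OF UNIV] by simp
  have fin: "(\<Union>i<n. F i) \<in> \<B>" if "\<And>i. F i \<in> \<B>" for F and n :: nat
    by (induction n) (auto simp: lessThan_Suc empty intro!: un that)
  have sa: "sigma_algebra UNIV \<B>"
    unfolding sigma_algebra_iff2
  proof (intro conjI ballI allI impI)
    fix F :: "nat \<Rightarrow> real set" assume "range F \<subseteq> \<B>"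
    then have F: "\<And>i. F i \<in> \<B>" by auto
    have "(indicator (\<Union>i. F i) :: real \<Rightarrow> complex) \<in> bgen G"
    proof (rule bgen.lim[where s="\<lambda>n. indicator (\<Union>i<n. F i)" and C=1])
      show "(\<lambda>n. indicator (\<Union>i<n. F i) t) \<longlonglongrightarrow> (indicator (\<Union>i. F i) t :: complex)" for t
        by (rule LIMSEQ_indicator_UN)
    qed (use fin[OF F] in \<open>auto simp: \<B>_def indicator_def\<close>)
    then show "(\<Union>i. F i) \<in> \<B>" unfolding \<B>_def by simp
  qed (use compl empty in \<open>auto simp: Compl_eq_Diff_UNIV[symmetric]\<close>)
  define N where "N = sigma UNIV \<B>"
  have N: "sets N = \<B>" "space N = UNIV"
    unfolding N_def using sigma_algebra.sigma_sets_eq[OF sa] by (auto simp: sets_measure_of)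
  have "a \<in> borel_measurable N" if "(\<lambda>t. complex_of_real (a t)) \<in> bgen G" "\<And>t. \<bar>a t\<bar> \<le> 1" for a
    unfolding borel_measurable_iff_greater N
  proof
    fix c
    have "indicator {t. c < a t} \<in> bgen G" by (rule bgen_indicator_greater[OF mult sub one that])
    then show "{w \<in> UNIV. c < a w} \<in> \<B>" unfolding \<B>_def mem_Collect_eq by (simp only: UNIV_I simp_thms)
  qed
  then have [measurable]: "(\<lambda>t. Re (cay t)) \<in> borel_measurable N" "(\<lambda>t. Im (cay t)) \<in> borel_measurable N"
    using Re Im abs_Re_le_cmod[of "cay _"] abs_Im_le_cmod[of "cay _"] by auto
  have "(\<lambda>t. - Im (cay t) / (1 - Re (cay t))) \<in> borel_measurable N" by measurable
  also have "(\<lambda>t. - Im (cay t) / (1 - Re (cay t))) = (\<lambda>t. t)"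
  proof
    fix t :: real
    have p: "t\<^sup>2 + 1 \<noteq> 0" by (metis add_nonneg_pos less_numeral_extra(1,3) zero_le_power2)
    have "1 - Re (cay t) = 2 / (t\<^sup>2 + 1)" unfolding cay_eq using p by (simp add: field_simps)
    then show "- Im (cay t) / (1 - Re (cay t)) = t" unfolding cay_eq using p by simp
  qed
  finally have id: "(\<lambda>t. t) \<in> borel_measurable N" .
  \<comment> \<open>Measurability of the identity from \<open>N\<close> to the Borel line says
    exactly that every Borel set belongs to \<open>\<B>\<close>.\<close>
  have "B \<in> \<B>" if "B \<in> sets borel" for B
    using measurable_sets[OF id that] N by simp
  then show "bounded_borel \<subseteq> bgen G"
    by (intro bounded_borel_subset_bgen) (auto simp: \<B>_def)
qed

section \<open>Integer powers of a unitary operator\<close>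

locale unitary_pair =
  fixes W W' :: "'a::chilbert \<Rightarrow> 'a"
  assumes W: "bounded_clinear_op W" and W': "bounded_clinear_op W'"
    and WW' [simp]: "W (W' x) = x" and W'W [simp]: "W' (W x) = x"
    and adj: "hinner (W x) y = hinner x (W' y)"
begin

definition upow :: "int \<Rightarrow> 'a \<Rightarrow> 'a" where
  "upow n = (if n \<ge> 0 then W ^^ nat n else W' ^^ nat (- n))"

lemma upow_0 [simp]: "upow 0 x = x" by (simp add: upow_def)

lemma upow_of_nat: "upow (int n) = W ^^ n" by (simp add: upow_def)

lemma upow_plus1: "upow (n + 1) x = W (upow n x)"
proof (cases "n \<ge> 0")
  case True
  then have "nat (n + 1) = Suc (nat n)" by simp
  then show ?thesis using True by (simp add: upow_def)
next
  case False
  then obtain m where m: "n = - int (Suc m)" using negD[of n] by auto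
  then have "nat (- n) = Suc m" by simp
  moreover have "upow (n + 1) = W' ^^ m"
  proof -
    have "n + 1 = - int m" using m by simp
    then show ?thesis by (cases "m = 0") (simp_all add: upow_def)
  qed
  ultimately show ?thesis using False by (simp add: upow_def)
qed

lemma upow_minus1: "upow (n - 1) x = W' (upow n x)"
  using upow_plus1[of "n - 1" x] by simp

lemma upow_add: "upow (m + n) x = upow m (upow n x)"
proof (induction m rule: int_induct[where k=0])
  case (step1 i)
  then show ?case using upow_plus1[of "i + n" x] upow_plus1[of i "upow n x"] by (simp add: algebra_simps)
next
  case (step2 i)
  then show ?case using upow_minus1[of "i + n" x] upow_minus1[of i "upow n x"] by (simp add: algebra_simps)
qed simp

lemma upow_bounded: "bounded_clinear_op (upow n)"
proof (induction n rule: int_induct[where k=0])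
  case base
  then show ?case using bounded_clinear_op_id by (simp add: upow_def id_def)
next
  case (step1 i)
  have "upow (i + 1) = (\<lambda>x. W (upow i x))" using upow_plus1 by blast
  then show ?case using bounded_clinear_op_compose[OF W step1.IH] by simp
next
  case (step2 i)
  have "upow (i - 1) = (\<lambda>x. W' (upow i x))" using upow_minus1 by blast
  then show ?case using bounded_clinear_op_compose[OF W' step2.IH] by simp
qed

lemma funpow_isometry: "hinner ((W ^^ j) x) ((W ^^ j) y) = hinner x y"
  by (induction j) (auto simp: adj)

text \<open>Negative moments are conjugates of positive ones, so the moment problem only has to be
  solved for natural exponents.\<close>

lemma upow_neg: "hinner x (upow (- int n) x) = cnj (hinner x (upow (int n) x))"
proof -
  have "hinner x (upow (- int n) x) = hinner (upow (int n) x) (upow (int n) (upow (- int n) x))"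
    using funpow_isometry[of n x "upow (- int n) x"] by (simp add: upow_of_nat)
  then show ?thesis using upow_add[of "int n" "- int n" x] by (subst hinner_conj) simp
qed

end

section \<open>Fejer densities and the trigonometric moment problem\<close>

lemma integral_iexp_period:
  "(LINT t:{0..2*pi}|lborel. iexp (of_int m * t)) = (if m = 0 then 2 * pi else 0)"
proof (cases "m = 0")
  case True
  then show ?thesis by (simp add: set_integral_const scaleR_conv_of_real)
next
  case False
  define F where "F t = iexp (of_int m * t) / (\<i> * of_int m)" for t :: real
  have "(LINT t:{0..2*pi}|lborel. iexp (of_int m * t)) = F (2*pi) - F 0"
    unfolding set_lebesgue_integral_def
  proof (rule integral_FTC_atLeastAtMost)
    show "(F has_vector_derivative iexp (of_int m * x)) (at x within {0..2*pi})" for x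
    proof -
      have "((\<lambda>z. exp (\<i> * (of_int m * z)) / (\<i> * of_int m)) has_field_derivative
          exp (\<i> * (of_int m * complex_of_real x))) (at (complex_of_real x))"
        using False by (auto intro!: derivative_eq_intros simp: field_simps)
      from has_vector_derivative_real_field[OF this] show ?thesis unfolding F_def by simp
    qed
    show "continuous_on {0..2*pi} (\<lambda>x. iexp (of_int m * x))" by (intro continuous_intros)
  qed simp
  also have "F (2*pi) = F 0"
  proof -
    have "iexp (of_int m * (2 * pi)) = exp (2 * of_int m * complex_of_real pi * \<i>)"
      by (simp add: mult_ac)
    also have "\<dots> = 1" using exp_integer_2pi[of "of_int m"] by simp
    finally show ?thesis unfolding F_def by simp
  qed
  finally show ?thesis using False by simp
qed


lemma cnj_iexp: "cnj (iexp x) = iexp (- x)"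
  by (simp add: exp_cnj)

context unitary_pair
begin

lemma norm_funpow: "norm ((W ^^ n) x) = norm x"
proof -
  have "(norm ((W ^^ n) x))\<^sup>2 = (norm x)\<^sup>2"
    using funpow_isometry[of n x x] unfolding hinner_self_norm by (simp only: of_real_eq_iff)
  then show ?thesis by simp
qed

text \<open>The Fejer mean of the formal series with coefficients
  \<open><\<psi>, W^n \<psi>>\<close>, written as a squared norm so that positivity is evident. The
  divisor \<open>2 pi N\<close> gives total mass \<open>|\<psi>|^2\<close> for positive
  \<open>N\<close>.\<close>

definition fejer :: "'a \<Rightarrow> nat \<Rightarrow> real \<Rightarrow> real" where
  "fejer \<psi> N \<theta> = (norm (\<Sum>k<N. hscaleC (iexp (- (real k * \<theta>))) ((W ^^ k) \<psi>)))\<^sup>2 / (2 * pi * real N)"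

lemma fejer_nonneg: "0 \<le> fejer \<psi> N \<theta>"
  unfolding fejer_def by simp

lemma continuous_fejer: "continuous_on S (fejer \<psi> N)"
  unfolding fejer_def divide_inverse by (intro continuous_intros continuous_on_hscaleC)

lemma fejer_expand:
  "complex_of_real (fejer \<psi> N \<theta>) * iexp (real n * \<theta>) =
    (\<Sum>j<N. \<Sum>k<N. iexp (of_int (int n + int j - int k) * \<theta>) * (hinner ((W ^^ j) \<psi>) ((W ^^ k) \<psi>) / (2 * pi * N)))"
proof -
  have e: "iexp (real j * \<theta>) * iexp (- (real k * \<theta>)) * iexp (real n * \<theta>)
      = iexp (of_int (int n + int j - int k) * \<theta>)" for j k
    by (simp add: exp_add[symmetric] algebra_simps)
  have "complex_of_real ((norm (\<Sum>k<N. hscaleC (iexp (- (real k * \<theta>))) ((W ^^ k) \<psi>)))\<^sup>2)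
      = (\<Sum>j<N. \<Sum>k<N. iexp (real j * \<theta>) * (iexp (- (real k * \<theta>)) * hinner ((W ^^ j) \<psi>) ((W ^^ k) \<psi>)))"
    unfolding hinner_self_norm[symmetric]
    by (simp only: hinner_sum_left)
       (simp only: hinner_sum_right hinner_hscaleC_left hinner_hscaleC_right cnj_iexp minus_minus mult.left_commute)
  then have "complex_of_real (fejer \<psi> N \<theta>) * iexp (real n * \<theta>)
      = (\<Sum>j<N. \<Sum>k<N. iexp (real j * \<theta>) * (iexp (- (real k * \<theta>)) * hinner ((W ^^ j) \<psi>) ((W ^^ k) \<psi>)))
        / complex_of_real (2 * pi * real N) * iexp (real n * \<theta>)"
    unfolding fejer_def of_real_divide by simp
  also have "\<dots> = (\<Sum>j<N. \<Sum>k<N. (iexp (real j * \<theta>) * iexp (- (real k * \<theta>)) * iexp (real n * \<theta>)) *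
      (hinner ((W ^^ j) \<psi>) ((W ^^ k) \<psi>) / (2 * pi * N)))"
    unfolding sum_divide_distrib sum_distrib_right by (intro sum.cong refl) (simp add: mult_ac)
  finally show ?thesis unfolding e .
qed

text \<open>Integration over a period keeps the index pairs with \<open>k = j + n\<close>. There are
  \<open>N - n\<close> of them, all contributing the same value because \<open>W\<close> is
  isometric; the truncated difference gives 0 when \<open>n\<close> reaches
  \<open>N\<close>.\<close>

lemma integral_fejer:
  assumes N: "N > 0"
  shows "(LINT \<theta>|lborel. indicator {0..2*pi} \<theta> *\<^sub>R (complex_of_real (fejer \<psi> N \<theta>) * iexp (real n * \<theta>)))
    = complex_of_real (real (N - n) / real N) * hinner \<psi> ((W ^^ n) \<psi>)"
proof -
  let ?a = "\<lambda>j k. hinner ((W ^^ j) \<psi>) ((W ^^ k) \<psi>)"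
  have int: "integrable lborel (\<lambda>\<theta>. indicator {0..2*pi} \<theta> *\<^sub>R (iexp (of_int m * \<theta>) * c))" for m c
    using borel_integrable_atLeastAtMost'[of 0 "2*pi" "\<lambda>\<theta>. iexp (of_int m * \<theta>) * c"]
    unfolding set_integrable_def by (simp add: continuous_intros)
  have period: "(LINT \<theta>|lborel. indicator {0..2*pi} \<theta> *\<^sub>R (iexp (of_int m * \<theta>) * c)) = (if m = 0 then 2 * pi * c else 0)" for m and c :: complex
    using integral_iexp_period[of m] unfolding set_lebesgue_integral_def mult_scaleR_left[symmetric]
    by (simp only: integral_mult_left_zero) simp
  have inner: "(\<Sum>k<N. if int n + int j - int k = 0 then 2 * pi * (?a j k / (2 * pi * N)) else 0)
      = (if j + n < N then hinner \<psi> ((W ^^ n) \<psi>) / N else 0)" for j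
  proof -
    have "?a j (j + n) = hinner \<psi> ((W ^^ n) \<psi>)"
      by (simp add: funpow_add funpow_isometry)
    moreover have "(\<Sum>k<N. if int n + int j - int k = 0 then 2 * pi * (?a j k / (2 * pi * N)) else 0)
      = (\<Sum>k<N. if k = j + n then ?a j k / N else 0)"
      using N by (intro sum.cong refl) auto
    ultimately show ?thesis by simp
  qed
  have "(LINT \<theta>|lborel. indicator {0..2*pi} \<theta> *\<^sub>R (complex_of_real (fejer \<psi> N \<theta>) * iexp (real n * \<theta>)))
    = (\<Sum>j<N. \<Sum>k<N. if int n + int j - int k = 0 then 2 * pi * (?a j k / (2 * pi * N)) else 0)"
    unfolding fejer_expand scaleR_sum_right
    by (simp only: Bochner_Integration.integral_sum Bochner_Integration.integrable_sum int period)
  also have "\<dots> = (\<Sum>j<N. if j + n < N then hinner \<psi> ((W ^^ n) \<psi>) / N else 0)"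
    unfolding inner ..
  also have "\<dots> = (\<Sum>j\<in>{..<N - n}. hinner \<psi> ((W ^^ n) \<psi>) / N)"
    by (intro sum.mono_neutral_cong_right) auto
  also have "\<dots> = complex_of_real (real (N - n) / real N) * hinner \<psi> ((W ^^ n) \<psi>)" by simp
  finally show ?thesis .
qed

text \<open>The shift to \<open>Suc N\<close> avoids index 0, where division by zero would produce
  the zero measure instead of a probability.\<close>

definition fejer_measure :: "'a \<Rightarrow> nat \<Rightarrow> real measure" where
  "fejer_measure \<psi> N = density lborel (\<lambda>\<theta>. ennreal (indicator {0..2*pi} \<theta> * fejer \<psi> (Suc N) \<theta>))"

lemma borel_measurable_fejer [measurable]: "fejer \<psi> N \<in> borel_measurable borel"
  by (rule borel_measurable_continuous_onI[OF continuous_fejer])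

lemma integral_fejer_measure:
  "(LINT \<theta>|fejer_measure \<psi> N. iexp (real n * \<theta>))
    = complex_of_real (real (Suc N - n) / real (Suc N)) * hinner \<psi> ((W ^^ n) \<psi>)"
proof -
  have "(LINT \<theta>|fejer_measure \<psi> N. iexp (real n * \<theta>))
    = (LINT \<theta>|lborel. indicator {0..2*pi} \<theta> *\<^sub>R (complex_of_real (fejer \<psi> (Suc N) \<theta>) * iexp (real n * \<theta>)))"
    unfolding fejer_measure_def
    by (subst integral_density) (auto simp: fejer_nonneg scaleR_conv_of_real mult.assoc)
  then show ?thesis using integral_fejer[of "Suc N"] by simp
qed

lemma fejer_measure_total:
  assumes "norm \<psi> = 1" "{0..2*pi} \<subseteq> S" "S \<in> sets borel"
  shows "emeasure (fejer_measure \<psi> N) S = 1"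
proof -
  have "complex_of_real (LINT \<theta>|lborel. indicator {0..2*pi} \<theta> * fejer \<psi> (Suc N) \<theta>) = 1"
  proof -
    have "complex_of_real (LINT \<theta>|lborel. indicator {0..2*pi} \<theta> * fejer \<psi> (Suc N) \<theta>)
      = (LINT \<theta>|lborel. complex_of_real (indicator {0..2*pi} \<theta> * fejer \<psi> (Suc N) \<theta>))"
      by (rule integral_complex_of_real[symmetric])
    also have "\<dots> = (LINT \<theta>|lborel. indicator {0..2*pi} \<theta> *\<^sub>R (complex_of_real (fejer \<psi> (Suc N) \<theta>) * iexp (real 0 * \<theta>)))"
      by (intro Bochner_Integration.integral_cong refl) (simp add: scaleR_conv_of_real)
    also have "\<dots> = 1" using integral_fejer[of "Suc N" \<psi> 0] assms(1) by (simp add: hinner_self_norm)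
    finally show ?thesis .
  qed
  then have 1: "(LINT \<theta>|lborel. indicator {0..2*pi} \<theta> * fejer \<psi> (Suc N) \<theta>) = 1"
    by (simp only: of_real_eq_1_iff)
  have int: "integrable lborel (\<lambda>\<theta>. indicator {0..2*pi} \<theta> * fejer \<psi> (Suc N) \<theta>)"
    using borel_integrable_atLeastAtMost'[OF continuous_fejer, of 0 "2*pi" \<psi> "Suc N"]
    unfolding set_integrable_def by simp
  have "emeasure (fejer_measure \<psi> N) S = (\<integral>\<^sup>+\<theta>. ennreal (indicator {0..2*pi} \<theta> * fejer \<psi> (Suc N) \<theta>) \<partial>lborel)"
    unfolding fejer_measure_def using assms(2,3)
    by (subst emeasure_density) (auto intro!: nn_integral_cong simp: indicator_def)
  also have "\<dots> = ennreal (LINT \<theta>|lborel. indicator {0..2*pi} \<theta> * fejer \<psi> (Suc N) \<theta>)"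
    by (rule nn_integral_eq_integral[OF int]) (simp add: fejer_nonneg)
  finally show ?thesis using 1 by simp
qed

lemma real_distribution_fejer_measure:
  assumes "norm \<psi> = 1"
  shows "real_distribution (fejer_measure \<psi> N)"
proof -
  have "prob_space (fejer_measure \<psi> N)"
    using fejer_measure_total[OF assms, of UNIV N] by (intro prob_spaceI) (simp add: fejer_measure_def)
  then show ?thesis
    by (intro real_distribution.intro real_distribution_axioms.intro) (auto simp: fejer_measure_def)
qed

text \<open>All densities live on one compact interval, so no mass escapes along a weakly convergent
  subsequence. The bounded continuous exponentials pass to the limit, and the Fejer weights tend to
  1.\<close>

theorem Herglotz:
  assumes \<psi>: "norm \<psi> = 1"
  shows "\<exists>M. real_distribution M \<and> (\<forall>n::nat. (LINT \<theta>|M. iexp (real n * \<theta>)) = hinner \<psi> ((W ^^ n) \<psi>))"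
proof -
  have "tight (fejer_measure \<psi>)"
    unfolding tight_def
  proof (intro conjI allI impI real_distribution_fejer_measure[OF \<psi>])
    fix e :: real assume e: "e > 0"
    \<comment> \<open>Tightness is phrased with intervals open on the left, so the left end must lie
      strictly below 0.\<close>
    have "{0..2*pi} \<subseteq> {-1<..2*pi}" by auto
    then have "measure (fejer_measure \<psi> n) {-1<..2*pi} > 1 - e" for n
      using fejer_measure_total[OF \<psi>, of "{-1<..2*pi}" n] e by (auto simp: measure_def)
    then show "\<exists>a b. a < b \<and> (\<forall>n. 1 - e < measure (fejer_measure \<psi> n) {a<..b})"
      using pi_gt_zero by (intro exI[of _ "-1"] exI[of _ "2*pi"] conjI allI) linarith+
  qed
  then obtain r M where r: "strict_mono r" and M: "real_distribution M"
    and conv: "weak_conv_m (fejer_measure \<psi> \<circ> id \<circ> r) M"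
    using tight_imp_convergent_subsubsequence[of "fejer_measure \<psi>" id] by (auto simp: strict_mono_id)
  have "(LINT \<theta>|M. iexp (real n * \<theta>)) = hinner \<psi> ((W ^^ n) \<psi>)" for n :: nat
  proof -
    have 1: "(\<lambda>k. LINT \<theta>|(fejer_measure \<psi> \<circ> id \<circ> r) k. iexp (real n * \<theta>)) \<longlonglongrightarrow> (LINT \<theta>|M. iexp (real n * \<theta>))"
      by (rule weak_conv_imp_integral_bdd_continuous_conv[OF _ M conv, where B=1])
         (auto intro!: real_distribution_fejer_measure[OF \<psi>] continuous_intros)
    have "(\<lambda>N. real (Suc N - n) / real (Suc N)) \<longlonglongrightarrow> 1"
    proof (rule Lim_transform_eventually)
      show "(\<lambda>N. 1 - real n * (1 / real (Suc N))) \<longlonglongrightarrow> 1"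
        using tendsto_diff[OF tendsto_const tendsto_mult[OF tendsto_const LIMSEQ_Suc[OF lim_1_over_n]], of 1 "real n"]
        by simp
      show "\<forall>\<^sub>F N in sequentially. 1 - real n * (1 / real (Suc N)) = real (Suc N - n) / real (Suc N)"
        using eventually_ge_at_top[of n] by eventually_elim (simp add: field_simps of_nat_diff)
    qed
    then have "(\<lambda>N. complex_of_real (real (Suc N - n) / real (Suc N)) * hinner \<psi> ((W ^^ n) \<psi>))
        \<longlonglongrightarrow> complex_of_real 1 * hinner \<psi> ((W ^^ n) \<psi>)"
      by (intro tendsto_mult tendsto_of_real tendsto_const)
    from LIMSEQ_subseq_LIMSEQ[OF this r]
    have 2: "(\<lambda>k. LINT \<theta>|(fejer_measure \<psi> \<circ> id \<circ> r) k. iexp (real n * \<theta>)) \<longlonglongrightarrow> hinner \<psi> ((W ^^ n) \<psi>)"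
      unfolding comp_def id_def integral_fejer_measure by simp
    show ?thesis by (rule LIMSEQ_unique[OF 1 2])
  qed
  then show ?thesis using M by blast
qed

section \<open>Ergodic averages and the absence of mass at 1\<close>

text \<open>On a vector \<open>y - W y\<close> the sum telescopes to two terms of norm
  \<open>|y|\<close>. The averages are contractions, so a dense set of such vectors
  suffices.\<close>

lemma mean_ergodic:
  assumes dense: "closure (range (\<lambda>x. x - W x)) = UNIV"
  shows "(\<lambda>N. scaleR (1 / real (Suc N)) (\<Sum>n<Suc N. (W ^^ n) x)) \<longlonglongrightarrow> 0"
proof -
  define S where "S N x = scaleR (1 / real (Suc N)) (\<Sum>n<Suc N. (W ^^ n) x)" for N x
  have Wn: "(W ^^ n) (x - y) = (W ^^ n) x - (W ^^ n) y" for n x y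
    by (induction n) (auto simp: bounded_clinear_opD[OF W])
  have Sdiff: "S N (x - y) = S N x - S N y" for N x y
    unfolding S_def Wn sum_subtractf scaleR_diff_right ..
  have Sbound: "norm (S N x) \<le> norm x" for N x
  proof -
    have "norm (\<Sum>n<Suc N. (W ^^ n) x) \<le> (\<Sum>n<Suc N. norm x)"
      by (rule sum_norm_le) (simp add: norm_funpow)
    then have "norm (\<Sum>n<Suc N. (W ^^ n) x) / real (Suc N) \<le> norm x"
      by (simp add: divide_le_eq mult.commute del: sum.lessThan_Suc)
    then show ?thesis unfolding S_def by (simp del: sum.lessThan_Suc)
  qed
  have S0: "norm (S N (y - W y)) \<le> 2 * norm y * (1 / real (Suc N))" for N y
  proof -
    have "(\<Sum>n<Suc N. (W ^^ n) (y - W y)) = y - (W ^^ Suc N) y"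
      by (induction N) (auto simp: Wn funpow_swap1)
    moreover have "norm (y - (W ^^ Suc N) y) \<le> 2 * norm y"
      using norm_triangle_ineq4[of y "(W ^^ Suc N) y"] by (simp only: norm_funpow mult_2)
    ultimately show ?thesis unfolding S_def
      by (simp only: norm_scaleR) (simp add: divide_right_mono)
  qed
  show ?thesis unfolding S_def[symmetric]
  proof (rule LIMSEQ_I)
    fix e :: real assume e: "e > 0"
    have "x \<in> closure (range (\<lambda>x. x - W x))" using dense by simp
    then obtain y where y: "dist (y - W y) x < e / 2"
      unfolding closure_approachable using e by (metis half_gt_zero rangeE)
    have "(\<lambda>N. 2 * norm y * (1 / real (Suc N))) \<longlonglongrightarrow> 2 * norm y * 0"
      by (intro tendsto_mult tendsto_const LIMSEQ_Suc[OF lim_1_over_n])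
    then obtain M where M: "\<And>N. N \<ge> M \<Longrightarrow> 2 * norm y * (1 / real (Suc N)) < e / 2"
      using LIMSEQ_D[of "\<lambda>N. 2 * norm y * (1 / real (Suc N))" 0 "e/2"] e by fastforce
    have "norm (S N x - 0) < e" if "N \<ge> M" for N
    proof -
      have "S N x = S N (x - (y - W y)) + S N (y - W y)" unfolding Sdiff by simp
      then have "norm (S N x) \<le> norm (x - (y - W y)) + norm (S N (y - W y))"
        using norm_triangle_ineq Sbound by (metis add_right_mono order_trans)
      then show ?thesis using y S0[of N y] M[OF that] by (simp add: dist_norm norm_minus_commute)
    qed
    then show "\<exists>no. \<forall>n\<ge>no. norm (S n x - 0) < e" by blast
  qed
qed

text \<open>The averages of \<open>e^(in\<theta>)\<close> converge boundedly to the indicator of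
  \<open>{\<theta>. iexp \<theta> = 1}\<close>, while their integrals are matrix elements of the
  ergodic averages and tend to 0. The null set covers every angle over the point 1, both ends of the
  period included.\<close>

lemma Herglotz_no_atom:
  assumes dense: "closure (range (\<lambda>x. x - W x)) = UNIV"
    and M: "real_distribution M" and mom: "\<And>n::nat. (LINT \<theta>|M. iexp (real n * \<theta>)) = hinner \<psi> ((W ^^ n) \<psi>)"
  shows "AE \<theta> in M. iexp \<theta> \<noteq> 1"
proof -
  interpret real_distribution M by (rule M)
  define a where "a N \<theta> = scaleR (1 / real (Suc N)) (\<Sum>n<Suc N. iexp (real n * \<theta>))" for N \<theta>
  have meas[measurable]: "{\<theta>. iexp \<theta> = 1} \<in> sets borel"
    by (intro borel_closed closed_Collect_eq continuous_intros)
  have int: "integrable M (\<lambda>\<theta>. iexp (real n * \<theta>))" for n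
    by (rule integrable_const_bound[where B=1]) auto
  have "(LINT \<theta>|M. a N \<theta>) = hinner \<psi> (scaleR (1 / real (Suc N)) (\<Sum>n<Suc N. (W ^^ n) \<psi>))" for N
    unfolding a_def hinner_scaleR_right hinner_sum_right mom[symmetric]
    by (simp only: integral_scaleR_right Bochner_Integration.integral_sum int)
  then have 1: "(\<lambda>N. LINT \<theta>|M. a N \<theta>) \<longlonglongrightarrow> hinner \<psi> 0"
    by (simp only:) (intro tendsto_hinner tendsto_const mean_ergodic[OF dense])
  have 2: "(\<lambda>N. LINT \<theta>|M. a N \<theta>) \<longlonglongrightarrow> (LINT \<theta>|M. complex_of_real (indicator {\<theta>. iexp \<theta> = 1} \<theta>))"
  proof (rule integral_dominated_convergence[where w="\<lambda>_. 1"])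
    show "AE \<theta> in M. norm (a N \<theta>) \<le> 1" for N
    proof (rule AE_I2)
      fix \<theta>
      have "norm (\<Sum>n<Suc N. iexp (real n * \<theta>)) \<le> (\<Sum>n<Suc N. 1)" by (rule sum_norm_le) simp
      then have "norm (\<Sum>n<Suc N. iexp (real n * \<theta>)) / real (Suc N) \<le> 1"
        by (simp add: divide_le_eq mult.commute del: sum.lessThan_Suc)
      then show "norm (a N \<theta>) \<le> 1" unfolding a_def by (simp del: sum.lessThan_Suc)
    qed
    show "AE \<theta> in M. (\<lambda>N. a N \<theta>) \<longlonglongrightarrow> complex_of_real (indicator {\<theta>. iexp \<theta> = 1} \<theta>)"
    proof (rule AE_I2)
      fix \<theta>
      have pw: "iexp (real n * \<theta>) = iexp \<theta> ^ n" for n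
        by (simp add: exp_of_nat_mult[symmetric] mult_ac)
      show "(\<lambda>N. a N \<theta>) \<longlonglongrightarrow> complex_of_real (indicator {\<theta>. iexp \<theta> = 1} \<theta>)"
      proof (cases "iexp \<theta> = 1")
        case True
        then have "a N \<theta> = 1" for N unfolding a_def pw
            by (simp add: scaleR_conv_of_real del: of_nat_Suc sum.lessThan_Suc)
        then show ?thesis using True by simp
      next
        case False
        have "norm (a N \<theta>) \<le> 2 / norm (iexp \<theta> - 1) * (1 / real (Suc N))" for N
        proof -
          have "norm (iexp \<theta> ^ Suc N - 1) \<le> 2"
            using norm_triangle_ineq4[of "iexp \<theta> ^ Suc N" 1] by (simp add: norm_power norm_mult)
          then have "norm (\<Sum>n<Suc N. iexp (real n * \<theta>)) \<le> 2 / norm (iexp \<theta> - 1)"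
            unfolding pw geometric_sum[OF False] norm_divide by (rule divide_right_mono) simp
          then have "norm (\<Sum>n<Suc N. iexp (real n * \<theta>)) * (1 / real (Suc N))
              \<le> 2 / norm (iexp \<theta> - 1) * (1 / real (Suc N))"
            by (rule mult_right_mono) simp
          then show ?thesis unfolding a_def norm_scaleR by (simp only: abs_of_nonneg zero_le_divide_1_iff of_nat_0_le_iff mult.commute)
        qed
        then have ev: "\<forall>\<^sub>F N in sequentially. norm (a N \<theta>) \<le> 2 / norm (iexp \<theta> - 1) * (1 / real (Suc N))"
          by (intro always_eventually allI)
        have "(\<lambda>N. a N \<theta>) \<longlonglongrightarrow> 0"
        proof (rule Lim_null_comparison[OF ev])
          show "(\<lambda>N. 2 / norm (iexp \<theta> - 1) * (1 / real (Suc N))) \<longlonglongrightarrow> 0"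
            by (rule tendsto_mult_right_zero[OF LIMSEQ_Suc[OF lim_1_over_n]])
        qed
        then show ?thesis using False by simp
      qed
    qed
  qed (auto simp: a_def)
  have "(LINT \<theta>|M. complex_of_real (indicator {\<theta>. iexp \<theta> = 1} \<theta>)) = 0"
    using LIMSEQ_unique[OF 1 2] by simp
  then have "prob {\<theta>. iexp \<theta> = 1} = 0" by (simp add: Int_absorb1)
  then show ?thesis
    by (subst AE_iff_measurable[OF _ refl]) (auto simp: emeasure_eq_measure)
qed

end

section \<open>Transport from the circle to the line\<close>

text \<open>At \<open>z = 1\<close> total division returns 0; this value is harmless below because
  the angles over 1 form a null set.\<close>

definition cay_inv :: "complex \<Rightarrow> real" where
  "cay_inv z = - Im z / (1 - Re z)"

lemma cay_cay_inv:
  assumes "cmod z = 1" "z \<noteq> 1"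
  shows "cay (cay_inv z) = z"
proof -
  define a b t where "a = Re z" and "b = Im z" and "t = cay_inv z"
  have ab: "a\<^sup>2 + b\<^sup>2 = 1" using assms(1) unfolding a_def b_def by (metis cmod_power2 one_power2)
  have "a \<noteq> 1" using ab assms(2) unfolding a_def b_def by (auto simp: complex_eq_iff)
  then have a: "1 - a \<noteq> 0" by simp
  have t: "t = - b / (1 - a)" unfolding t_def cay_inv_def a_def b_def ..
  have b2: "b\<^sup>2 = (1 - a) * (1 + a)" using ab by (simp add: power2_eq_square algebra_simps)
  have t2: "t\<^sup>2 = (1 + a) / (1 - a)"
    unfolding t power_divide power2_minus b2 using a by (simp add: power2_eq_square)
  have 1: "t\<^sup>2 + 1 = 2 / (1 - a)" "t\<^sup>2 - 1 = 2 * a / (1 - a)"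
    unfolding t2 using a by (auto simp: field_simps)
  have "(t\<^sup>2 - 1) / (t\<^sup>2 + 1) = a" unfolding 1 using a by (simp add: field_simps)
  moreover have "- 2 * t / (t\<^sup>2 + 1) = b" unfolding 1 using a t by (simp add: field_simps)
  ultimately show ?thesis
    unfolding t_def[symmetric] cay_eq by (simp add: a_def b_def complex_eq_iff)
qed

context unitary_pair
begin

text \<open>The measure of the unit vector is pushed forward by \<open>cay_inv\<close> and
  multiplied by the squared norm, the factor by which the moments scale.\<close>

theorem spectral_measure_exists:
  assumes dense: "closure (range (\<lambda>x. x - W x)) = UNIV"
  shows "\<exists>\<mu>. finite_measure \<mu> \<and> sets \<mu> = sets (borel :: real measure)
    \<and> (\<forall>n. (LINT t|\<mu>. cay t powi n) = hinner \<psi> (upow n \<psi>))"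
proof (cases "\<psi> = 0")
  case True
  then show ?thesis
    by (intro exI[of _ "null_measure borel"])
       (auto intro!: finite_measureI simp: bounded_clinear_opD[OF upow_bounded] integral_null_measure)
next
  case False
  define r where "r = norm \<psi>"
  define u where "u = scaleR (1 / r) \<psi>"
  have u: "norm u = 1" "\<psi> = hscaleC (complex_of_real r) u"
    using False unfolding u_def r_def by (auto simp: scaleR_hscaleC[symmetric])
  obtain M where M: "real_distribution M" and mom: "\<And>n::nat. (LINT \<theta>|M. iexp (real n * \<theta>)) = hinner u ((W ^^ n) u)"
    using Herglotz[OF u(1)] by blast
  interpret real_distribution M by (rule M)
  have ae: "AE \<theta> in M. iexp \<theta> \<noteq> 1" by (rule Herglotz_no_atom[OF dense M mom])
  have [measurable]: "(\<lambda>\<theta>. cay_inv (iexp \<theta>)) \<in> borel_measurable borel"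
    unfolding cay_inv_def by measurable
  define \<mu>0 where "\<mu>0 = distr M borel (\<lambda>\<theta>. cay_inv (iexp \<theta>))"
  have nat: "(LINT t|\<mu>0. cay t ^ n) = hinner u ((W ^^ n) u)" for n
  proof -
    have "(LINT t|\<mu>0. cay t ^ n) = (LINT \<theta>|M. cay (cay_inv (iexp \<theta>)) ^ n)"
      unfolding \<mu>0_def by (rule integral_distr) auto
    also have "\<dots> = (LINT \<theta>|M. iexp (real n * \<theta>))"
    proof (rule integral_cong_AE)
      show "AE \<theta> in M. cay (cay_inv (iexp \<theta>)) ^ n = iexp (real n * \<theta>)"
        using ae
      proof eventually_elim
        case (elim \<theta>)
        have "cay (cay_inv (iexp \<theta>)) = iexp \<theta>" using elim by (intro cay_cay_inv) auto
        then show ?case by (simp add: exp_of_nat_mult[symmetric] mult_ac)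
      qed
    qed auto
    finally show ?thesis using mom by simp
  qed
  have fin: "finite_measure \<mu>0"
    unfolding \<mu>0_def by (intro prob_space.axioms prob_space_distr) auto
  have int: "(LINT t|\<mu>0. cay t powi n) = hinner u (upow n u)" for n
  proof (cases "n \<ge> 0")
    case True
    then obtain m where "n = int m" using nonneg_int_cases by blast
    then show ?thesis using nat[of m] by (simp add: upow_of_nat)
  next
    case False
    then obtain m where m: "n = - int m" by (metis linear nonpos_int_cases)
    \<comment> \<open>Since \<open>cay t\<close> has modulus 1, its negative powers are conjugates,
      matching \<open>upow_neg\<close>.\<close>
    have "cay t powi n = cnj (cay t ^ m)" for t
    proof -
      have "cnj (cay t ^ m) * cay t ^ m = 1"
        using complex_norm_square[of "cay t ^ m"] by (simp add: norm_power mult.commute)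
      then show ?thesis unfolding m by (simp add: power_int_minus field_simps)
    qed
    then have "(LINT t|\<mu>0. cay t powi n) = (LINT t|\<mu>0. cnj (cay t ^ m))" by simp
    also have "\<dots> = cnj (LINT t|\<mu>0. cay t ^ m)"
      by (rule integral_bounded_linear[OF bounded_linear_cnj])
         (use integrable_bounded_borel[OF bounded_borel_cay_power[of "int m"] fin] in \<open>simp add: \<mu>0_def\<close>)
    finally show ?thesis unfolding m upow_neg nat by (simp add: upow_of_nat)
  qed
  define \<mu> where "\<mu> = density \<mu>0 (\<lambda>_. ennreal (r\<^sup>2))"
  have "(LINT t|\<mu>. cay t powi n) = hinner \<psi> (upow n \<psi>)" for n
  proof -
    have [measurable]: "(\<lambda>t. cay t powi n) \<in> borel_measurable \<mu>0"
      using bounded_borel_measurable[OF bounded_borel_cay_power[of n]] by (simp add: \<mu>0_def)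
    have "(LINT t|\<mu>. cay t powi n) = (LINT t|\<mu>0. r\<^sup>2 *\<^sub>R (cay t powi n))"
      unfolding \<mu>_def by (rule integral_density) auto
    also have "\<dots> = r\<^sup>2 *\<^sub>R hinner u (upow n u)" by (simp add: int)
    also have "\<dots> = hinner (hscaleC (complex_of_real r) u) (upow n (hscaleC (complex_of_real r) u))"
      by (simp add: hinner_simps bounded_clinear_opD[OF upow_bounded] scaleR_conv_of_real power2_eq_square)
    also have "\<dots> = hinner \<psi> (upow n \<psi>)" unfolding u(2)[symmetric] ..
    finally show ?thesis .
  qed
  moreover have "finite_measure \<mu>"
  proof (rule finite_measureI)
    have "emeasure \<mu> (space \<mu>) = ennreal (r\<^sup>2) * emeasure \<mu>0 (space \<mu>0)"
      unfolding \<mu>_def by (subst emeasure_density) (auto simp: nn_integral_cmult)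
    then show "emeasure \<mu> (space \<mu>) \<noteq> \<infinity>"
      using finite_measure.emeasure_finite[OF fin] by (simp add: ennreal_mult_eq_top_iff)
  qed
  moreover have "sets \<mu> = sets borel" unfolding \<mu>_def \<mu>0_def by simp
  ultimately show ?thesis by blast
qed

end

section \<open>The spectral theorem\<close>

definition cutoff :: "nat \<Rightarrow> real set" where
  "cutoff n = {- real n..real n}"

lemma cutoff_borel [measurable]: "cutoff n \<in> sets borel"
  by (simp add: cutoff_def)

lemma eventually_cutoff: "\<forall>\<^sub>F n in sequentially. t \<in> cutoff n"
proof -
  obtain N where "\<bar>t\<bar> < real N" using reals_Archimedean2 by blast
  then have "t \<in> cutoff n" if "n \<ge> N" for n using that unfolding cutoff_def by auto
  then show ?thesis unfolding eventually_sequentially by blast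
qed

lemma bounded_borel_id_cutoff: "(\<lambda>t. complex_of_real t * indicator (cutoff n) t) \<in> bounded_borel"
proof (rule bounded_borelI)
  show "cmod (complex_of_real t * indicator (cutoff n) t) \<le> real n" for t
    by (auto simp: cutoff_def indicator_def)
qed measurable

lemma tendsto_zero_norm_sq: "(\<lambda>n. (norm (X n))\<^sup>2) \<longlonglongrightarrow> 0 \<Longrightarrow> X \<longlonglongrightarrow> (0::'a::real_normed_vector)"
  using tendsto_real_sqrt[of "\<lambda>n. (norm (X n))\<^sup>2" 0] by (simp add: tendsto_norm_zero_iff)

context op_calculus
begin

text \<open>By \<open>norm_opint_sq\<close> the squared distance is the integral of
  \<open>|s n - g|^2\<close>, dominated by the constant \<open>(2 C)^2\<close> on a finite
  measure.\<close>

lemma opint_tendsto: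
  assumes s: "\<And>n. s n \<in> bounded_borel" "\<And>n t. cmod (s n t) \<le> C" "\<And>t. (\<lambda>n. s n t) \<longlonglongrightarrow> g t"
  shows "(\<lambda>n. opint \<mu> (s n) x) \<longlonglongrightarrow> opint \<mu> g x"
proof -
  have g: "g \<in> bounded_borel" using bounded_borel_lim[of s C g] s by blast
  have gC: "cmod (g t) \<le> C" for t
    by (rule LIMSEQ_le_const2[OF tendsto_norm[OF s(3)]]) (use s(2) in auto)
  have [measurable]: "g \<in> borel_measurable (\<mu> x)" "\<And>n. s n \<in> borel_measurable (\<mu> x)"
    using g s(1) measurable_mu bounded_borel_measurable by blast+
  have "(\<lambda>n. LINT t|\<mu> x. (cmod (s n t - g t))\<^sup>2) \<longlonglongrightarrow> (LINT t|\<mu> x. (cmod (g t - g t))\<^sup>2)"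
  proof (rule integral_dominated_convergence[where w="\<lambda>_. (C + C)\<^sup>2"])
    show "AE t in \<mu> x. norm ((cmod (s n t - g t))\<^sup>2) \<le> (C + C)\<^sup>2" for n
    proof (rule AE_I2)
      fix t
      have "cmod (s n t - g t) \<le> C + C"
        using norm_triangle_ineq4[of "s n t" "g t"] s(2)[of n t] gC[of t] by linarith
      then have "(cmod (s n t - g t))\<^sup>2 \<le> (C + C)\<^sup>2" by (rule power_mono) simp
      then show "norm ((cmod (s n t - g t))\<^sup>2) \<le> (C + C)\<^sup>2" by (simp only: real_norm_def abs_power2)
    qed
    show "AE t in \<mu> x. (\<lambda>n. (cmod (s n t - g t))\<^sup>2) \<longlonglongrightarrow> (cmod (g t - g t))\<^sup>2"
      using s(3) by (intro AE_I2 tendsto_intros) auto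
  qed (auto intro!: finite_measure.integrable_const[OF finite])
  moreover have "(LINT t|\<mu> x. (cmod (s n t - g t))\<^sup>2) = (norm (opint \<mu> (s n) x - opint \<mu> g x))\<^sup>2" for n
  proof -
    have "(\<lambda>t. s n t - g t) \<in> bounded_borel"
      using bounded_borel_add[OF s(1)[of n] bounded_borel_scale[OF g, of "-1"]] by simp
    then show ?thesis unfolding opint_diff[OF s(1) g, symmetric] by (simp add: norm_opint_sq)
  qed
  ultimately have "(\<lambda>n. (norm (opint \<mu> (s n) x - opint \<mu> g x))\<^sup>2) \<longlonglongrightarrow> 0" by simp
  then show ?thesis by (rule LIM_zero_cancel[OF tendsto_zero_norm_sq])
qed

lemma opint_cutoff_tendsto: "(\<lambda>n. opint \<mu> (indicator (cutoff n)) x) \<longlonglongrightarrow> x"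
proof -
  have "(\<lambda>n. opint \<mu> (indicator (cutoff n)) x) \<longlonglongrightarrow> opint \<mu> (\<lambda>t. 1) x"
  proof (rule opint_tendsto[where C=1])
    show "(\<lambda>n. indicator (cutoff n) t) \<longlonglongrightarrow> (1::complex)" for t
      by (rule tendsto_eventually) (use eventually_cutoff[of t] in eventually_elim, simp)
    show "indicator (cutoff n) \<in> bounded_borel" for n
      by (rule bounded_borel_indicator[OF cutoff_borel])
  qed (auto simp: indicator_def)
  then show ?thesis unfolding opint_one .
qed

end

section \<open>The Cayley transform and the construction of the resolution\<close>

text \<open>This is the density of the spectral measure of \<open>y - W y\<close> relative to that
  of \<open>y\<close>.\<close>

lemma norm_one_minus_cay_sq: "(cmod (1 - cay t))\<^sup>2 = 4 / (t\<^sup>2 + 1)"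
proof -
  have p: "t\<^sup>2 + 1 \<noteq> 0" by (metis add_nonneg_pos less_numeral_extra(1,3) zero_le_power2)
  have "1 - Re (cay t) = 2 / (t\<^sup>2 + 1)" unfolding cay_eq using p by (simp add: field_simps)
  moreover have "(cmod (1 - cay t))\<^sup>2 = 1 + (cmod (cay t))\<^sup>2 - 2 * Re (cay t)"
    unfolding cmod_power2 by (simp add: power2_eq_square algebra_simps)
  ultimately show ?thesis by simp
qed

text \<open>The symbols of \<open>y \<mapsto> y - W y\<close> and
  \<open>y \<mapsto> A (y - W y)\<close> are \<open>1 - cay t\<close> and
  \<open>\<i> (1 + cay t)\<close>; multiplying by the inverse of the former turns them into 1 and
  \<open>t\<close>.\<close>

lemma cay_moebius:
  "(1 - cay t) * ((complex_of_real t + \<i>) / (2 * \<i>)) = 1"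
  "(\<i> * (1 + cay t)) * ((complex_of_real t + \<i>) / (2 * \<i>)) = complex_of_real t"
  using of_real_plus_i_nz(1)[of t] unfolding cay_def by (simp_all add: field_simps)

text \<open>The scalar form of \<open><y - W y, A (y - W y)>\<close>: the value is \<open>t\<close>
  times the density \<open>|1 - cay t|^2\<close>.\<close>

lemma cay_form: "cnj (1 - cay t) * (\<i> * (1 + cay t)) = complex_of_real (4 / (t\<^sup>2 + 1) * t)"
proof -
  have "cnj (cay t) * cay t = 1" using complex_norm_square[of "cay t"] by (simp add: mult.commute)
  then have "cnj (1 - cay t) * (\<i> * (1 + cay t)) = \<i> * (cay t - cnj (cay t))"
    by (simp add: algebra_simps)
  also have "\<dots> = complex_of_real (- 2 * Im (cay t))"
    by (simp add: complex_eq_iff)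
  also have "- 2 * Im (cay t) = 4 / (t\<^sup>2 + 1) * t" unfolding cay_eq by simp
  finally show ?thesis .
qed

text \<open>\<open>W\<close> sends \<open>A x + \<i> x\<close> to \<open>A x - \<i> x\<close>; both
  vectors have the same norm by symmetry and both shifts are onto. With
  \<open>R = (A + \<i>)^-1\<close> one gets \<open>y - W y = 2 \<i> R y\<close>, so the range of
  \<open>1 - W\<close> is \<open>D\<close>.\<close>

lemma Cayley_transform:
  assumes sa: "self_adjoint D A"
  obtains W W' where "unitary_pair W W'"
    "\<And>y. y - W y \<in> D" "\<And>y. A (y - W y) = hscaleC \<i> (y + W y)"
    "\<And>x. x \<in> D \<Longrightarrow> \<exists>y. x = y - W y"
proof -
  note Al = clinear_onD[OF self_adjointD(1)[OF sa]] and Ds = csubspaceD[OF self_adjointD(3)[OF sa]]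
  define P M where "P x = A x + hscaleC \<i> x" and "M x = A x - hscaleC \<i> x" for x
  have ex: "\<exists>x\<in>D. P x = y" "\<exists>x\<in>D. M x = y" for y
    using self_adjoint_shift_surj[OF sa, of "-1" y] self_adjoint_shift_surj[OF sa, of 1 y]
    unfolding P_def M_def by (auto simp: hscaleC_minus_left)
  have inj: "P x = P y \<Longrightarrow> x = y" "M x = M y \<Longrightarrow> x = y" if "x \<in> D" "y \<in> D" for x y
    using self_adjoint_shift_inj[OF sa _ that, of "-1"] self_adjoint_shift_inj[OF sa _ that, of 1]
    unfolding P_def M_def by (auto simp: hscaleC_minus_left)
  obtain R where R: "\<And>y. R y \<in> D" "\<And>y. P (R y) = y" using ex(1) by metis
  obtain R' where R': "\<And>y. R' y \<in> D" "\<And>y. M (R' y) = y" using ex(2) by metis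
  define W where "W y = M (R y)" for y
  define W' where "W' y = P (R' y)" for y
  have WP: "W (P x) = M x" if "x \<in> D" for x
    unfolding W_def using inj(1)[OF R(1)[of "P x"] that] R(2) by simp
  have WM: "W' (M x) = P x" if "x \<in> D" for x
    unfolding W'_def using inj(2)[OF R'(1)[of "M x"] that] R'(2) by simp
  have lin: "P (x + y) = P x + P y" "M (x + y) = M x + M y"
    "P (hscaleC c x) = hscaleC c (P x)" "M (hscaleC c x) = hscaleC c (M x)" if "x \<in> D" "y \<in> D" for x y c
    unfolding P_def M_def using Al that
    by (simp_all add: hscaleC_add_right hscaleC_diff_right hscaleC_hscaleC mult.commute)
  have inner: "hinner (M x) (M y) = hinner (P x) (P y)" if "x \<in> D" "y \<in> D" for x y
    unfolding P_def M_def using self_adjointD(4)[OF sa that] by (simp add: hinner_simps algebra_simps)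
  have normPM: "norm (M x) = norm (P x)" if "x \<in> D" for x
  proof -
    have "(norm (M x))\<^sup>2 = (norm (P x))\<^sup>2"
      using inner[OF that that] unfolding hinner_self_norm by (simp only: of_real_eq_iff)
    then show ?thesis by simp
  qed
  have bW: "bounded_clinear_op W"
  proof (rule bounded_clinear_opI[where K=1])
    fix x y c
    show "W (x + y) = W x + W y"
      using WP[OF Ds(2)[OF R(1) R(1)], of x y] lin(1,2)[OF R(1) R(1)] R(2) by (simp add: W_def)
    show "W (hscaleC c x) = hscaleC c (W x)"
      using WP[OF Ds(3)[OF R(1)], of c x] lin(3,4)[OF R(1) R(1)] R(2) by (simp add: W_def)
    show "norm (W x) \<le> 1 * norm x" using normPM[OF R(1)] R(2) by (simp add: W_def)
  qed
  have bW': "bounded_clinear_op W'"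
  proof (rule bounded_clinear_opI[where K=1])
    fix x y c
    show "W' (x + y) = W' x + W' y"
      using WM[OF Ds(2)[OF R'(1) R'(1)], of x y] lin(1,2)[OF R'(1) R'(1)] R'(2) by (simp add: W'_def)
    show "W' (hscaleC c x) = hscaleC c (W' x)"
      using WM[OF Ds(3)[OF R'(1)], of c x] lin(3,4)[OF R'(1) R'(1)] R'(2) by (simp add: W'_def)
    show "norm (W' x) \<le> 1 * norm x" using normPM[OF R'(1), of x] R'(2)[of x] by (simp add: W'_def)
  qed
  have up: "unitary_pair W W'"
  proof (rule unitary_pair.intro[OF bW bW'])
    show "W (W' x) = x" for x using WP[OF R'(1)[of x]] R'(2) by (simp add: W'_def)
    show "W' (W x) = x" for x using WM[OF R(1)[of x]] R(2) by (simp add: W_def)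
    show "hinner (W x) y = hinner x (W' y)" for x y
      using inner[OF R(1)[of x] R'(1)[of y]] R(2) R'(2) by (simp add: W_def W'_def)
  qed
  have diff: "y - W y = hscaleC (2 * \<i>) (R y)" for y
  proof -
    have "y - W y = P (R y) - M (R y)" using R(2) by (simp add: W_def)
    also have "\<dots> = hscaleC \<i> (R y) + hscaleC \<i> (R y)" unfolding P_def M_def by simp
    finally show ?thesis unfolding mult_2 hscaleC_add_left .
  qed
  have "A (y - W y) = hscaleC \<i> (y + W y)" for y
  proof -
    have "y + W y = P (R y) + M (R y)" using R(2) by (simp add: W_def)
    also have "\<dots> = hscaleC 2 (A (R y))"
      using hscaleC_add_left[of 1 1 "A (R y)"] unfolding P_def M_def by (simp add: hscaleC_one)
    finally show ?thesis unfolding diff using Al(3)[OF R(1)] by (simp add: hscaleC_hscaleC mult.commute)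
  qed
  moreover have "\<exists>y. x = y - W y" if "x \<in> D" for x
  proof
    have "R (hscaleC (1 / (2 * \<i>)) (P x)) = hscaleC (1 / (2 * \<i>)) x"
      by (rule inj(1)[OF R(1) Ds(3)[OF that]]) (simp add: R(2) lin(3)[OF that that])
    then show "x = hscaleC (1 / (2 * \<i>)) (P x) - W (hscaleC (1 / (2 * \<i>)) (P x))"
      unfolding diff by (simp add: hscaleC_hscaleC hscaleC_one)
  qed
  moreover have "y - W y \<in> D" for y unfolding diff using Ds(3) R(1) by blast
  ultimately show thesis using that up by blast
qed

text \<open>On \<open>D\<close>, the range of \<open>1 - W\<close>, the density
  \<open>4 / (t^2 + 1)\<close> makes \<open>t^2\<close> integrable and gives the form of
  \<open>A\<close>. Conversely, if \<open>t^2\<close> is integrable for \<open>x\<close>, the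
  truncations of \<open>x\<close> lie in \<open>D\<close>, their images under \<open>A\<close> are
  Cauchy, and closedness of \<open>A\<close> puts \<open>x\<close> into \<open>D\<close>.\<close>

theorem spectral_theorem:
  assumes sa: "self_adjoint D A"
  shows "\<exists>E. spectral_resolution D A E"
proof -
  obtain W W' where up: "unitary_pair W W'" and WD: "\<And>y. y - W y \<in> D"
    and AW: "\<And>y. A (y - W y) = hscaleC \<i> (y + W y)" and DW: "\<And>x. x \<in> D \<Longrightarrow> \<exists>y. x = y - W y"
    using Cayley_transform[OF sa] by blast
  interpret unitary_pair W W' by (rule up)
  have "D \<subseteq> range (\<lambda>x. x - W x)" using DW by auto
  then have dense: "closure (range (\<lambda>x. x - W x)) = UNIV"
    using closure_mono self_adjointD(2)[OF sa] by blast
  obtain \<mu> where fin: "\<And>\<psi>. finite_measure (\<mu> \<psi>)" and sets: "\<And>\<psi>. sets (\<mu> \<psi>) = sets borel"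
    and mom: "\<And>\<psi> n. (LINT t|\<mu> \<psi>. cay t powi n) = hinner \<psi> (upow n \<psi>)"
    using spectral_measure_exists[OF dense] by metis
  have pw: "opint \<mu> (\<lambda>t. cay t powi n) = upow n" for n
    by (rule opint_eqI[OF upow_bounded mom[symmetric]])
  let ?G = "range (\<lambda>n t. cay t powi n)"
  \<comment> \<open>The assignment on generators is \<open>opint \<mu>\<close> itself, already
    computed by \<open>pw\<close>; the second conjunct is then trivial.\<close>
  have "op_calculus \<mu> \<and> (\<forall>d\<in>?G. opint \<mu> d = opint \<mu> d)"
  proof (rule op_calculusI[where G="?G" and T="opint \<mu>"])
    show "opint \<mu> (\<lambda>t. d t * e t) x = opint \<mu> d (opint \<mu> e x)" if de: "d \<in> ?G" "e \<in> ?G" for d e x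
    proof -
      obtain m n where mn: "d = (\<lambda>t. cay t powi m)" "e = (\<lambda>t. cay t powi n)" using de by auto
      have "(\<lambda>t. d t * e t) = (\<lambda>t. cay t powi (m + n))" unfolding mn by (simp add: power_int_add)
      then show ?thesis unfolding mn by (simp only: pw upow_add)
    qed
    show "opint \<mu> (\<lambda>t. 1) x = x" for x using pw[of 0] by simp
    show "bounded_clinear_op (opint \<mu> d)" if "d \<in> ?G" for d using that pw upow_bounded by auto
    show "hinner x (opint \<mu> d x) = (LINT t|\<mu> x. d t)" if "d \<in> ?G" for d x using that pw mom by auto
  qed (use fin sets bgen_cay_powers in auto)
  then interpret op_calculus \<mu> by blast
  have bc: "cay \<in> bounded_borel" using bounded_borel_cay_power[of 1] by simp
  have bm: "(\<lambda>t. 1 - cay t) \<in> bounded_borel"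
    using bounded_borel_add[OF bounded_borel_const bounded_borel_scale[OF bc, of "-1"], of 1] by simp
  have bp: "(\<lambda>t. \<i> * (1 + cay t)) \<in> bounded_borel"
    by (rule bounded_borel_scale[OF bounded_borel_add[OF bounded_borel_const bc]])
  have cW: "opint \<mu> cay = W" using pw[of 1] upow_of_nat[of 1] by simp
  have om: "opint \<mu> (\<lambda>t. 1 - cay t) y = y - W y" for y
    using opint_diff[OF bounded_borel_const bc, of 1 y] by (simp add: opint_one cW)
  have op: "opint \<mu> (\<lambda>t. \<i> * (1 + cay t)) y = A (y - W y)" for y
    using opint_scale[OF bounded_borel_add[OF bounded_borel_const bc], of \<i> 1 y]
      opint_add[OF bounded_borel_const bc, of 1 y] by (simp add: opint_one cW AW)
  have meas: "\<mu> (y - W y) = density (\<mu> y) (\<lambda>t. ennreal (4 / (t\<^sup>2 + 1)))" for y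
    unfolding om[symmetric] opint_measure_density[OF bm] norm_one_minus_cay_sq ..
  have pos: "0 \<le> 4 / (t\<^sup>2 + 1)" for t :: real by (simp add: add_nonneg_nonneg)
  have [measurable]: "(\<lambda>t. t) \<in> borel_measurable (\<mu> y)" for y by (rule measurable_mu) simp
  have form: "hinner x (A x) = complex_of_real (LINT t|\<mu> x. t)" if xD: "x \<in> D" for x
  proof -
    obtain y where y: "x = y - W y" using DW xD by blast
    have "hinner x (A x) = (LINT t|\<mu> y. complex_of_real (4 / (t\<^sup>2 + 1) * t))"
      using hinner_opint_opint[OF bm bp, of y] unfolding om op y cay_form .
    also have "\<dots> = complex_of_real (LINT t|\<mu> y. (4 / (t\<^sup>2 + 1)) *\<^sub>R t)"
      unfolding real_scaleR_def by (rule integral_complex_of_real)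
    also have "(LINT t|\<mu> y. (4 / (t\<^sup>2 + 1)) *\<^sub>R t) = (LINT t|\<mu> x. t)"
      unfolding y meas by (rule integral_density[symmetric]) (use pos in auto)
    finally show ?thesis .
  qed
  have D1: "integrable (\<mu> x) (\<lambda>t. t\<^sup>2)" if xD: "x \<in> D" for x
  proof -
    obtain y where y: "x = y - W y" using DW xD by blast
    have "integrable (\<mu> y) (\<lambda>t. (4 / (t\<^sup>2 + 1)) *\<^sub>R t\<^sup>2)"
    proof (rule finite_measure.integrable_const_bound[OF finite, of _ 4])
      have "\<bar>4 / (t\<^sup>2 + 1) * t\<^sup>2\<bar> \<le> 4" for t :: real
        by (simp add: abs_mult divide_le_eq add_nonneg_pos)
      then show "AE t in \<mu> y. norm ((4 / (t\<^sup>2 + 1)) *\<^sub>R t\<^sup>2) \<le> 4" by simp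
    qed measurable
    then show ?thesis unfolding y meas by (subst integrable_density) (use pos in auto)
  qed
  have D2: "x \<in> D" if int: "integrable (\<mu> x) (\<lambda>t. t\<^sup>2)" for x
  proof -
    \<comment> \<open>The truncated inverse of the symbol \<open>1 - cay t\<close>: it produces
      \<open>v n\<close> with \<open>v n - W (v n)\<close> equal to the truncation of
      \<open>x\<close>.\<close>
    define g where "g n t = indicator (cutoff n) t * ((complex_of_real t + \<i>) / (2 * \<i>))" for n t
    have g1: "(\<lambda>t. (1 - cay t) * g n t) = indicator (cutoff n)" for n
      unfolding g_def mult.left_commute[of _ "indicator (cutoff n) _"] cay_moebius(1) by simp
    have g2: "(\<lambda>t. (\<i> * (1 + cay t)) * g n t) = (\<lambda>t. complex_of_real t * indicator (cutoff n) t)" for n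
      unfolding g_def mult.left_commute[of _ "indicator (cutoff n) _"] cay_moebius(2) by (simp add: mult.commute)
    have bg: "g n \<in> bounded_borel" for n
    proof (rule bounded_borelI)
      show "cmod (g n t) \<le> real n + 1" for t
      proof (cases "t \<in> cutoff n")
        case True
        then have "\<bar>t\<bar> \<le> real n" unfolding cutoff_def by auto
        then have "cmod (complex_of_real t + \<i>) \<le> real n + 1"
          using norm_triangle_ineq[of "complex_of_real t" \<i>] by simp
        then show ?thesis
          using True norm_ge_zero[of "complex_of_real t + \<i>"] by (simp add: g_def norm_divide norm_mult)
      qed (simp add: g_def)
    qed (unfold g_def, measurable)
    define v where "v n = opint \<mu> (g n) x" for n
    have x1: "v n - W (v n) = opint \<mu> (indicator (cutoff n)) x" for n
      unfolding om[symmetric] v_def opint_mult[OF bm bg, symmetric] g1 ..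
    have x2: "A (v n - W (v n)) = opint \<mu> (\<lambda>t. complex_of_real t * indicator (cutoff n) t) x" for n
      unfolding op[symmetric] v_def opint_mult[OF bp bg, symmetric] g2 ..
    have lim1: "(\<lambda>n. v n - W (v n)) \<longlonglongrightarrow> x" unfolding x1 by (rule opint_cutoff_tendsto)
    define a where "a n = (LINT t|\<mu> x. t\<^sup>2 * indicator (cutoff n) t)" for n
    have "a \<longlonglongrightarrow> (LINT t|\<mu> x. t\<^sup>2)"
      unfolding a_def
    proof (rule integral_dominated_convergence[where w="\<lambda>t. t\<^sup>2"])
      show "AE t in \<mu> x. (\<lambda>n. t\<^sup>2 * indicator (cutoff n) t) \<longlonglongrightarrow> t\<^sup>2"
      proof (intro AE_I2 tendsto_eventually)
        show "\<forall>\<^sub>F n in sequentially. t\<^sup>2 * indicator (cutoff n) t = t\<^sup>2" for t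
          using eventually_cutoff[of t] by eventually_elim simp
      qed
    qed (auto simp: int indicator_def)
    then have ca: "Cauchy a" by (rule LIMSEQ_imp_Cauchy)
    \<comment> \<open>The squared distance is the integral of \<open>t^2\<close> over the part of
      \<open>cutoff n\<close> outside \<open>cutoff m\<close>, a difference of terms of a convergent
      real sequence.\<close>
    have dist: "(norm (A (v n - W (v n)) - A (v m - W (v m))))\<^sup>2 = a n - a m" if mn: "m \<le> n" for m n
    proof -
      have ia: "integrable (\<mu> x) (\<lambda>t. t\<^sup>2 * indicator (cutoff n) t)" for n
        by (rule Bochner_Integration.integrable_bound[OF int]) (auto simp: indicator_def)
      have b: "(\<lambda>t. complex_of_real t * indicator (cutoff n) t - complex_of_real t * indicator (cutoff m) t) \<in> bounded_borel"
        using bounded_borel_add[OF bounded_borel_id_cutoff[of n] bounded_borel_scale[OF bounded_borel_id_cutoff[of m], of "-1"]] by simp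
      have "cutoff m \<subseteq> cutoff n" using mn unfolding cutoff_def by auto
      then have pt: "(cmod (complex_of_real t * indicator (cutoff n) t - complex_of_real t * indicator (cutoff m) t))\<^sup>2
          = t\<^sup>2 * indicator (cutoff n) t - t\<^sup>2 * indicator (cutoff m) t" for t
        by (auto simp: indicator_def)
      show ?thesis
        unfolding x2 opint_diff[OF bounded_borel_id_cutoff bounded_borel_id_cutoff, symmetric] norm_opint_sq[OF b] pt a_def
        by (rule Bochner_Integration.integral_diff[OF ia ia])
    qed
    have "Cauchy (\<lambda>n. A (v n - W (v n)))"
    proof (rule CauchyI')
      fix e :: real assume e: "e > 0"
      then obtain M where M: "\<And>m n. m \<ge> M \<Longrightarrow> n \<ge> M \<Longrightarrow> dist (a m) (a n) < e\<^sup>2"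
        using metric_CauchyD[OF ca, of "e\<^sup>2"] by auto
      have "dist (A (v m - W (v m))) (A (v n - W (v n))) < e" if "m \<ge> M" "n > m" for m n
      proof -
        have "(dist (A (v m - W (v m))) (A (v n - W (v n))))\<^sup>2 < e\<^sup>2"
          using dist[of m n] M[of m n] that by (auto simp: dist_norm norm_minus_commute)
        then show ?thesis using e by (simp add: power_less_imp_less_base)
      qed
      then show "\<exists>M. \<forall>m\<ge>M. \<forall>n>m. dist (A (v m - W (v m))) (A (v n - W (v n))) < e" by blast
    qed
    then obtain z where "(\<lambda>n. A (v n - W (v n))) \<longlonglongrightarrow> z"
      using Cauchy_convergent_iff convergent_def by blast
    then show "x \<in> D" using self_adjoint_closed(1)[OF sa WD lim1] by blast
  qed
  have "spectral_resolution D A (\<lambda>B. opint \<mu> (indicator B))"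
    unfolding spectral_resolution_def spec_meas_eq
    using proj_valued_measure D1 D2 form by auto
  then show ?thesis by blast
qed

text \<open>Existence makes the choice inside \<open>fcalc\<close> a genuine resolution. Everything
  later uses only the defining properties of the chosen \<open>E\<close>, so it holds for whichever
  one is picked.\<close>

lemma spectral_operator_SOME:
  assumes sa: "self_adjoint D A"
  defines "\<mu> \<equiv> spec_meas (SOME E. spectral_resolution D A E)"
  shows "spectral_operator \<mu> D A" and "fcalc D A g = opint \<mu> g"
proof -
  let ?E = "SOME E. spectral_resolution D A E"
  have E: "spectral_resolution D A ?E" using spectral_theorem[OF sa] by (rule someI_ex)
  then show "spectral_operator \<mu> D A"
    unfolding \<mu>_def spectral_resolution_def
    by (intro spectral_operator.intro spectral_operator_axioms.intro proj_valued_measure_calculus(1) sa) auto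
  show "fcalc D A g = opint \<mu> g" unfolding fcalc_def opint_def \<mu>_def Let_def ..
qed

section \<open>The unitary group of a self-adjoint operator\<close>

text \<open>Difference quotients along sequences are the form to which dominated convergence
  applies.\<close>

lemma has_vector_derivative_sequentiallyI:
  fixes f :: "real \<Rightarrow> 'a::real_normed_vector"
  assumes "\<And>X. (\<And>n. X n \<noteq> 0) \<Longrightarrow> X \<longlonglongrightarrow> 0 \<Longrightarrow> (\<lambda>n. scaleR (1 / X n) (f (x + X n) - f x)) \<longlonglongrightarrow> d"
  shows "(f has_vector_derivative d) (at x)"
  unfolding has_vector_derivative_def has_derivative_at tendsto_at_iff_sequentially
proof (intro conjI allI impI bounded_linear_scaleR_left)
  fix X :: "nat \<Rightarrow> real" assume X: "\<forall>i. X i \<in> UNIV - {0}" "X \<longlonglongrightarrow> 0"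
  have "norm (f (x + X n) - f x - X n *\<^sub>R d) / norm (X n) = norm (scaleR (1 / X n) (f (x + X n) - f x) - d)" for n
  proof -
    have "X n \<noteq> 0" using X(1) by auto
    then have "f (x + X n) - f x - X n *\<^sub>R d = X n *\<^sub>R (scaleR (1 / X n) (f (x + X n) - f x) - d)"
      by (simp add: scaleR_diff_right)
    then show ?thesis using \<open>X n \<noteq> 0\<close> by simp
  qed
  moreover have "(\<lambda>n. norm (scaleR (1 / X n) (f (x + X n) - f x) - d)) \<longlonglongrightarrow> 0"
    using assms[of X] X by (intro tendsto_norm_zero LIM_zero) auto
  ultimately show "((\<lambda>h. norm (f (x + h) - f x - h *\<^sub>R d) / norm h) \<circ> X) \<longlonglongrightarrow> 0"
    by (simp add: comp_def)
qed

text \<open>\<open>expint x t\<close> is \<open>\<integral>\<^sub>0\<^sup>t e\<^sup>i\<^sup>x\<^sup>s ds\<close>.\<close>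

definition expint :: "real \<Rightarrow> real \<Rightarrow> complex" where
  "expint x t = (if x = 0 then complex_of_real t else (iexp (x * t) - 1) / (\<i> * complex_of_real x))"

lemma expint_zero [simp]: "expint x 0 = 0"
  by (simp add: expint_def)

text \<open>The integral from \<open>l\<close> to \<open>l + k\<close> is the one from 0 to
  \<open>k\<close> up to a phase, so increments at \<open>l\<close> reduce to increments at
  0.\<close>

lemma expint_add: "expint x (l + k) - expint x l = iexp (x * l) * expint x k"
  by (cases "x = 0") (simp_all add: expint_def distrib_left exp_add field_simps)

lemma norm_expint_le: "cmod (expint x t) \<le> \<bar>t\<bar>"
proof (cases "x = 0")
  case False
  have "cmod (iexp (x * t) - 1) \<le> \<bar>x * t\<bar>" using iexp_approx1[of "x * t" 0] by simp
  then show ?thesis using False by (simp add: expint_def norm_divide norm_mult divide_le_eq abs_mult mult.commute)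
qed (simp add: expint_def)

lemma norm_expint_diff_le: "cmod (expint x t - complex_of_real t) \<le> \<bar>x\<bar> * t\<^sup>2"
proof (cases "x = 0")
  case False
  have "cmod (iexp (x * t) - (1 + \<i> * complex_of_real (x * t))) \<le> (x * t)\<^sup>2 / 2"
    using iexp_approx1[of "x * t" 1] by (simp add: numeral_2_eq_2)
  also have "\<dots> \<le> (x * t)\<^sup>2" by simp
  finally have "cmod (iexp (x * t) - (1 + \<i> * complex_of_real (x * t))) \<le> (\<bar>x\<bar> * t\<^sup>2) * \<bar>x\<bar>"
    by (simp add: power_mult_distrib power2_eq_square mult_ac flip: abs_mult)
  moreover have "expint x t - complex_of_real t = (iexp (x * t) - (1 + \<i> * complex_of_real (x * t))) / (\<i> * complex_of_real x)"
    using False by (simp add: expint_def field_simps)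
  ultimately show ?thesis using False by (simp add: norm_divide norm_mult divide_le_eq)
qed (simp add: expint_def)

lemma norm_expint_le_const: "x \<noteq> 0 \<Longrightarrow> cmod (expint x t) \<le> 2 / \<bar>x\<bar>"
  using norm_triangle_ineq4[of "iexp (x * t)" 1]
  by (simp add: expint_def norm_divide norm_mult divide_right_mono)

lemma borel_measurable_expint: "(\<lambda>p. expint (fst p) (snd p)) \<in> borel_measurable (borel \<Otimes>\<^sub>M borel)"
  unfolding expint_def by measurable

lemma borel_measurable_expint1 [measurable]: "expint x \<in> borel_measurable borel"
  unfolding expint_def[abs_def] by measurable

lemma borel_measurable_expint2 [measurable]: "(\<lambda>x. expint x t) \<in> borel_measurable borel"
  unfolding expint_def by measurable

lemma bounded_borel_expint: "x \<noteq> 0 \<Longrightarrow> expint x \<in> bounded_borel"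
  by (rule bounded_borelI[where C="2 / \<bar>x\<bar>"]) (auto intro: norm_expint_le_const)

lemma bounded_borel_iexp: "(\<lambda>t. iexp (s * t)) \<in> bounded_borel"
  by (rule bounded_borelI[where C=1]) auto

lemma integrable_expint_mult:
  assumes "cmeasure_rep \<rho> h"
  shows "integrable \<rho> (\<lambda>x. expint x t * h x)"
proof (rule Bochner_Integration.integrable_bound)
  have h: "integrable \<rho> h" and s [measurable_cong]: "sets \<rho> = sets borel"
    using assms unfolding cmeasure_rep_def by auto
  note [measurable] = borel_measurable_integrable[OF h]
  show "integrable \<rho> (\<lambda>x. t *\<^sub>R h x)" using h by simp
  show "(\<lambda>x. expint x t * h x) \<in> borel_measurable \<rho>" by measurable
  show "AE x in \<rho>. norm (expint x t * h x) \<le> norm (t *\<^sub>R h x)"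
    by (intro AE_I2) (simp add: norm_mult mult_right_mono norm_expint_le)
qed

text \<open>The quotient \<open>expint x k / k\<close> has modulus at most 1 for every
  \<open>x\<close>, so \<open>|h|\<close> dominates and no moment of the measure is
  required.\<close>

lemma fourier_primitive_derivative:
  assumes rep: "cmeasure_rep \<rho> h"
  shows "((\<lambda>t. LINT x|\<rho>. expint x t * h x) has_vector_derivative (LINT x|\<rho>. iexp (x * l) * h x)) (at l)"
proof (rule has_vector_derivative_sequentiallyI)
  fix X :: "nat \<Rightarrow> real" assume X: "\<And>n. X n \<noteq> 0" "X \<longlonglongrightarrow> 0"
  have h: "integrable \<rho> h" and s [measurable_cong]: "sets \<rho> = sets borel"
    using rep unfolding cmeasure_rep_def by auto
  note [measurable] = borel_measurable_integrable[OF h]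
  have "scaleR (1 / X n) ((LINT x|\<rho>. expint x (l + X n) * h x) - (LINT x|\<rho>. expint x l * h x))
    = (LINT x|\<rho>. scaleR (1 / X n) (iexp (x * l) * expint x (X n) * h x))" for n
    unfolding expint_add[symmetric] left_diff_distrib
    using integrable_expint_mult[OF rep] by simp
  moreover have "(\<lambda>n. LINT x|\<rho>. scaleR (1 / X n) (iexp (x * l) * expint x (X n) * h x)) \<longlonglongrightarrow> (LINT x|\<rho>. iexp (x * l) * h x)"
  proof (rule integral_dominated_convergence[where w="\<lambda>x. cmod (h x)"])
    show "integrable \<rho> (\<lambda>x. cmod (h x))" using h by simp
    show "AE x in \<rho>. norm (scaleR (1 / X n) (iexp (x * l) * expint x (X n) * h x)) \<le> cmod (h x)" for n
    proof (rule AE_I2)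
      fix x
      have "cmod (expint x (X n)) / \<bar>X n\<bar> \<le> 1" using norm_expint_le[of x "X n"] X(1)[of n] by (simp add: divide_le_eq)
      then have "cmod (expint x (X n)) / \<bar>X n\<bar> * cmod (h x) \<le> 1 * cmod (h x)" by (rule mult_right_mono) simp
      then show "norm (scaleR (1 / X n) (iexp (x * l) * expint x (X n) * h x)) \<le> cmod (h x)"
        by (simp add: norm_mult)
    qed
    show "AE x in \<rho>. (\<lambda>n. scaleR (1 / X n) (iexp (x * l) * expint x (X n) * h x)) \<longlonglongrightarrow> iexp (x * l) * h x"
    proof (rule AE_I2)
      fix x
      have "(\<lambda>n. scaleR (1 / X n) (expint x (X n))) \<longlonglongrightarrow> 1"
      proof (rule LIM_zero_cancel, rule Lim_null_comparison)
        show "(\<lambda>n. \<bar>x\<bar> * \<bar>X n\<bar>) \<longlonglongrightarrow> 0" using X(2) by (intro tendsto_mult_right_zero tendsto_rabs_zero)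
        have "norm (scaleR (1 / X n) (expint x (X n)) - 1) \<le> \<bar>x\<bar> * \<bar>X n\<bar>" for n
        proof -
          have "scaleR (1 / X n) (expint x (X n)) - 1 = scaleR (1 / X n) (expint x (X n) - complex_of_real (X n))"
            using X(1)[of n] by (simp add: scaleR_conv_of_real diff_divide_distrib)
          then have "norm (scaleR (1 / X n) (expint x (X n)) - 1) = cmod (expint x (X n) - complex_of_real (X n)) / \<bar>X n\<bar>"
            by simp
          also have "\<dots> \<le> (\<bar>x\<bar> * (X n)\<^sup>2) / \<bar>X n\<bar>" by (intro divide_right_mono norm_expint_diff_le) simp
          also have "\<dots> = \<bar>x\<bar> * \<bar>X n\<bar>" using X(1)[of n] 
            by (simp add: power2_eq_square abs_if)
          finally show ?thesis .
        qed
        then show "\<forall>\<^sub>F n in sequentially. norm (scaleR (1 / X n) (expint x (X n)) - 1) \<le> \<bar>x\<bar> * \<bar>X n\<bar>" by simp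
      qed
      then have "(\<lambda>n. iexp (x * l) * scaleR (1 / X n) (expint x (X n)) * h x) \<longlonglongrightarrow> iexp (x * l) * 1 * h x"
        by (intro tendsto_intros)
      then show "(\<lambda>n. scaleR (1 / X n) (iexp (x * l) * expint x (X n) * h x)) \<longlonglongrightarrow> iexp (x * l) * h x"
        by (simp add: mult_ac)
    qed
  qed measurable
  ultimately show "(\<lambda>n. scaleR (1 / X n) ((LINT x|\<rho>. expint x (l + X n) * h x) - (LINT x|\<rho>. expint x l * h x)))
    \<longlonglongrightarrow> (LINT x|\<rho>. iexp (x * l) * h x)" by (simp only:)
qed

text \<open>Recovers a possibly unbounded \<open>G\<close> from the Fourier data of its derivative;
  the integration constant is \<open>G 0\<close> because \<open>expint x 0 = 0\<close>.\<close>

lemma fourier_primitive_eq: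
  assumes rep: "cmeasure_rep \<rho> h"
    and der: "\<And>l. (G has_vector_derivative (LINT x|\<rho>. iexp (x * l) * h x)) (at l)"
  shows "G t = G 0 + (LINT x|\<rho>. expint x t * h x)"
proof -
  have "((\<lambda>t. G t - (LINT x|\<rho>. expint x t * h x)) has_vector_derivative 0) (at l within UNIV)" for l
    using has_vector_derivative_diff[OF der fourier_primitive_derivative[OF rep], of l] by simp
  then obtain c where "\<And>t. G t - (LINT x|\<rho>. expint x t * h x) = c"
    using has_vector_derivative_zero_constant[of UNIV "\<lambda>t. G t - (LINT x|\<rho>. expint x t * h x)"] by auto
  from this[of t] this[of 0] show ?thesis by (simp add: algebra_simps)
qed

section \<open>The unitary group and its generator\<close>

context spectral_operator
begin

definition U :: "real \<Rightarrow> 'a \<Rightarrow> 'a" where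
  "U s = opint \<mu> (\<lambda>t. iexp (s * t))"

lemmas U_linear = bounded_clinear_opD[OF opint_bounded[OF bounded_borel_iexp], folded U_def]

lemma U_0 [simp]: "U 0 x = x"
  unfolding U_def using opint_one by simp

lemma U_add: "U (a + b) x = U a (U b x)"
  unfolding U_def opint_mult[OF bounded_borel_iexp bounded_borel_iexp, symmetric]
  by (simp add: exp_add[symmetric] algebra_simps)

lemma norm_U [simp]: "norm (U s x) = norm x"
proof -
  have "(norm (U s x))\<^sup>2 = (norm (opint \<mu> (\<lambda>t. 1) x))\<^sup>2"
    unfolding U_def norm_opint_sq[OF bounded_borel_iexp] norm_opint_sq[OF bounded_borel_const] by simp
  then show ?thesis unfolding opint_one by simp
qed

lemma hinner_U: "hinner (U (- s) x) y = hinner x (U s y)"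
  using hinner_opint_adjoint[OF bounded_borel_iexp, of s x y] unfolding U_def cnj_iexp minus_mult_left .

lemma U_in_D: "x \<in> D \<Longrightarrow> U s x \<in> D"
  unfolding U_def by (rule opint_in_D[OF _ bounded_borel_iexp])

lemma A_U: "x \<in> D \<Longrightarrow> A (U s x) = U s (A x)"
  unfolding U_def by (rule opint_A_commute[OF _ bounded_borel_iexp])

lemma isCont_U: "isCont (\<lambda>s. U s x) s"
proof (rule continuous_at_sequentiallyI)
  fix X assume X: "X \<longlonglongrightarrow> s"
  show "(\<lambda>n. U (X n) x) \<longlonglongrightarrow> U s x"
    unfolding U_def
    by (rule opint_tendsto[where C=1]) (auto simp: bounded_borel_iexp[simplified] intro!: tendsto_intros X)
qed

text \<open>Strong continuity in the time variable becomes joint continuity because every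
  \<open>U s\<close> is an isometry. This makes the integrand of the double operator integral
  continuous in both real variables.\<close>

lemma tendsto_U:
  assumes "(f \<longlongrightarrow> a) F" "(v \<longlongrightarrow> w) F"
  shows "((\<lambda>q. U (f q) (v q)) \<longlongrightarrow> U a w) F"
proof -
  have "((\<lambda>q. norm (U (f q) (v q - w))) \<longlongrightarrow> 0) F"
    using tendsto_norm_zero[OF LIM_zero[OF assms(2)]] by simp
  then have "((\<lambda>q. U (f q) (v q - w)) \<longlongrightarrow> 0) F" by (rule tendsto_norm_zero_cancel)
  moreover have "((\<lambda>q. U (f q) w) \<longlongrightarrow> U a w) F"
    by (rule isCont_tendsto_compose[OF isCont_U assms(1)])
  ultimately have "((\<lambda>q. U (f q) (v q - w) + U (f q) w) \<longlongrightarrow> 0 + U a w) F" by (rule tendsto_add)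
  then show ?thesis by (simp add: U_linear)
qed

lemma continuous_on_U:
  "continuous_on S f \<Longrightarrow> continuous_on S v \<Longrightarrow> continuous_on S (\<lambda>q. U (f q) (v q))"
  unfolding continuous_on_def using tendsto_U by blast

text \<open>Extends the isometry to the unbounded symbol \<open>g t - t\<close>. The operators of
  the truncations of \<open>t\<close> converge to \<open>A\<close> on \<open>D\<close>, and
  \<open>2 C^2 + 2 t^2\<close> dominates the squares.\<close>

lemma norm_opint_diff_A:
  assumes x: "x \<in> D" and g: "g \<in> bounded_borel"
  shows "(norm (opint \<mu> g x - A x))\<^sup>2 = (LINT t|\<mu> x. (cmod (g t - complex_of_real t))\<^sup>2)"
proof -
  note tJ = bounded_borel_id_cutoff
  have "(\<lambda>n. opint \<mu> (\<lambda>t. complex_of_real t * indicator (cutoff n) t) x) \<longlonglongrightarrow> A x"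
    using opint_cutoff_tendsto[of "A x"]
    unfolding opint_id_mult[OF x bounded_borel_indicator[OF cutoff_borel] tJ] .
  then have "(\<lambda>n. (norm (opint \<mu> g x - opint \<mu> (\<lambda>t. complex_of_real t * indicator (cutoff n) t) x))\<^sup>2)
      \<longlonglongrightarrow> (norm (opint \<mu> g x - A x))\<^sup>2"
    by (intro tendsto_intros)
  moreover have "(norm (opint \<mu> g x - opint \<mu> (\<lambda>t. complex_of_real t * indicator (cutoff n) t) x))\<^sup>2
      = (LINT t|\<mu> x. (cmod (g t - complex_of_real t * indicator (cutoff n) t))\<^sup>2)" for n
  proof -
    have "(\<lambda>t. g t - complex_of_real t * indicator (cutoff n) t) \<in> bounded_borel"
      using bounded_borel_add[OF g bounded_borel_scale[OF tJ[of n], of "-1"]] by simp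
    then show ?thesis unfolding opint_diff[OF g tJ, symmetric] by (rule norm_opint_sq)
  qed
  moreover have "(\<lambda>n. LINT t|\<mu> x. (cmod (g t - complex_of_real t * indicator (cutoff n) t))\<^sup>2)
      \<longlonglongrightarrow> (LINT t|\<mu> x. (cmod (g t - complex_of_real t))\<^sup>2)"
  proof -
    obtain C where C: "C \<ge> 0" "\<And>t. cmod (g t) \<le> C" using bounded_borel_bound[OF g] by blast
    have [measurable]: "g \<in> borel_measurable (\<mu> x)"
      using bounded_borel_measurable[OF g] by (rule measurable_mu)
    show ?thesis
    proof (rule integral_dominated_convergence[where w="\<lambda>t. 2 * C\<^sup>2 + 2 * t\<^sup>2"])
      show "integrable (\<mu> x) (\<lambda>t. 2 * C\<^sup>2 + 2 * t\<^sup>2)"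
        by (intro Bochner_Integration.integrable_add Bochner_Integration.integrable_mult_right
            integrable_sq[OF x] finite_measure.integrable_const[OF finite])
      show "AE t in \<mu> x. norm ((cmod (g t - complex_of_real t * indicator (cutoff n) t))\<^sup>2) \<le> 2 * C\<^sup>2 + 2 * t\<^sup>2" for n
      proof (rule AE_I2)
        fix t
        have "cmod (g t - complex_of_real t * indicator (cutoff n) t) \<le> C + \<bar>t\<bar>"
          using norm_triangle_ineq4[of "g t" "complex_of_real t * indicator (cutoff n) t"] C(2)[of t]
          by (auto simp: indicator_def split: if_splits)
        then have "(cmod (g t - complex_of_real t * indicator (cutoff n) t))\<^sup>2 \<le> (C + \<bar>t\<bar>)\<^sup>2"
          by (rule power_mono) simp
        also have "\<dots> \<le> 2 * C\<^sup>2 + 2 * t\<^sup>2"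
          using zero_le_power2[of "C - \<bar>t\<bar>"] unfolding power2_sum power2_diff by simp
        finally show "norm ((cmod (g t - complex_of_real t * indicator (cutoff n) t))\<^sup>2) \<le> 2 * C\<^sup>2 + 2 * t\<^sup>2" by simp
      qed
      show "AE t in \<mu> x. (\<lambda>n. (cmod (g t - complex_of_real t * indicator (cutoff n) t))\<^sup>2)
          \<longlonglongrightarrow> (cmod (g t - complex_of_real t))\<^sup>2"
      proof (intro AE_I2 tendsto_eventually)
        show "\<forall>\<^sub>F n in sequentially. (cmod (g t - complex_of_real t * indicator (cutoff n) t))\<^sup>2 = (cmod (g t - complex_of_real t))\<^sup>2" for t
          using eventually_cutoff[of t] by eventually_elim simp
      qed
    qed measurable
  qed
  ultimately show ?thesis using LIMSEQ_unique by simp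
qed

text \<open>The symbols tend to \<open>t\<close> pointwise, and the squared errors are below
  \<open>4 t^2\<close>, integrable because \<open>x\<close> lies in \<open>D\<close>.\<close>

lemma opint_expint_tendsto:
  assumes x: "x \<in> D" and X: "\<And>n. X n \<noteq> 0" "X \<longlonglongrightarrow> 0"
  shows "(\<lambda>n. opint \<mu> (expint (X n)) x) \<longlonglongrightarrow> A x"
proof -
  have [measurable]: "expint y \<in> borel_measurable (\<mu> x)" for y by (rule measurable_mu) measurable
  have "(\<lambda>n. LINT t|\<mu> x. (cmod (expint (X n) t - complex_of_real t))\<^sup>2) \<longlonglongrightarrow> (LINT t|\<mu> x. 0)"
  proof (rule integral_dominated_convergence[where w="\<lambda>t. 4 * t\<^sup>2"])
    show "AE t in \<mu> x. norm ((cmod (expint (X n) t - complex_of_real t))\<^sup>2) \<le> 4 * t\<^sup>2" for n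
    proof (rule AE_I2)
      fix t
      have "cmod (expint (X n) t - complex_of_real t) \<le> 2 * \<bar>t\<bar>"
        using norm_triangle_ineq4[of "expint (X n) t" "complex_of_real t"] norm_expint_le[of "X n" t] by simp
      then have "(cmod (expint (X n) t - complex_of_real t))\<^sup>2 \<le> (2 * \<bar>t\<bar>)\<^sup>2" by (rule power_mono) simp
      then show "norm ((cmod (expint (X n) t - complex_of_real t))\<^sup>2) \<le> 4 * t\<^sup>2" by (simp add: power_mult_distrib)
    qed
    show "AE t in \<mu> x. (\<lambda>n. (cmod (expint (X n) t - complex_of_real t))\<^sup>2) \<longlonglongrightarrow> 0"
    proof (rule AE_I2)
      fix t
      have "(\<lambda>n. expint (X n) t - complex_of_real t) \<longlonglongrightarrow> 0"
      proof (rule Lim_null_comparison)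
        show "\<forall>\<^sub>F n in sequentially. norm (expint (X n) t - complex_of_real t) \<le> \<bar>X n\<bar> * t\<^sup>2"
          by (simp add: norm_expint_diff_le)
        show "(\<lambda>n. \<bar>X n\<bar> * t\<^sup>2) \<longlonglongrightarrow> 0" using X(2) by (intro tendsto_mult_left_zero tendsto_rabs_zero)
      qed
      then have "(\<lambda>n. (cmod (expint (X n) t - complex_of_real t))\<^sup>2) \<longlonglongrightarrow> 0\<^sup>2" by (intro tendsto_power tendsto_norm_zero)
      then show "(\<lambda>n. (cmod (expint (X n) t - complex_of_real t))\<^sup>2) \<longlonglongrightarrow> 0" by simp
    qed
  qed (use integrable_sq[OF x] in auto)
  then have "(\<lambda>n. (norm (opint \<mu> (expint (X n)) x - A x))\<^sup>2) \<longlonglongrightarrow> 0"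
    unfolding norm_opint_diff_A[OF x bounded_borel_expint[OF X(1)]] by simp
  then show ?thesis by (rule LIM_zero_cancel[OF tendsto_zero_norm_sq])
qed

lemma U_has_vector_derivative:
  assumes x: "x \<in> D"
  shows "((\<lambda>s. U s x) has_vector_derivative hscaleC \<i> (U s (A x))) (at s)"
proof (rule has_vector_derivative_sequentiallyI)
  fix X :: "nat \<Rightarrow> real" assume X: "\<And>n. X n \<noteq> 0" "X \<longlonglongrightarrow> 0"
  have "scaleR (1 / X n) (U (s + X n) x - U s x) = hscaleC \<i> (U s (opint \<mu> (expint (X n)) x))" for n
  proof -
    \<comment> \<open>The arguments of \<open>expint\<close> have other roles than in the Fourier
      primitive: \<open>X n\<close> is the time step and \<open>t\<close> the spectral
      variable.\<close>
    have "(\<lambda>t. iexp (X n * t) - 1) = (\<lambda>t. (\<i> * complex_of_real (X n)) * expint (X n) t)"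
      using X(1)[of n] by (simp add: expint_def)
    then have "U (X n) x - x = hscaleC (\<i> * complex_of_real (X n)) (opint \<mu> (expint (X n)) x)"
      using opint_diff[OF bounded_borel_iexp bounded_borel_const, of "X n" 1 x]
        opint_scale[OF bounded_borel_expint[OF X(1)], of "\<i> * complex_of_real (X n)" n x]
      unfolding U_def opint_one by simp
    moreover have "U (s + X n) x - U s x = U s (U (X n) x - x)" by (simp add: U_add U_linear)
    ultimately show ?thesis using X(1)[of n] by (simp add: U_linear scaleR_hscaleC hscaleC_hscaleC)
  qed
  then show "(\<lambda>n. scaleR (1 / X n) (U (s + X n) x - U s x)) \<longlonglongrightarrow> hscaleC \<i> (U s (A x))"
    by (simp only:) (intro tendsto_hscaleC tendsto_const tendsto_U opint_expint_tendsto[OF x] X)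
qed

lemma hinner_opint_shift:
  assumes x: "x \<in> D" and g: "g \<in> bounded_borel"
  shows "hinner x (opint \<mu> g (A x - hscaleC \<i> x)) = (LINT t|\<mu> x. g t * (complex_of_real t - \<i>))"
proof -
  have "hinner x (opint \<mu> g (A x - hscaleC \<i> x)) = (LINT t|\<mu> x. complex_of_real t * g t) - \<i> * (LINT t|\<mu> x. g t)"
    using bounded_clinear_opD[OF opint_bounded[OF g]]
    by (simp add: hinner_simps hinner_opint_A[OF x g] hinner_opint[OF g])
  also have "\<dots> = (LINT t|\<mu> x. complex_of_real t * g t - \<i> * g t)"
    using integrable_id_mult[OF x g] integrable[OF g] by simp
  finally show ?thesis by (simp add: algebra_simps)
qed

text \<open>For \<open>y\<close> other than 0 the symbol is bounded and belongs to the group; at 0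
  it is \<open>t\<close> itself and produces the quadratic form of \<open>A\<close>.\<close>

lemma integral_expint:
  assumes x: "x \<in> D"
  shows "(LINT t|\<mu> x. expint y t) =
    (if y = 0 then hinner x (A x) else (hinner x (U y x) - hinner x x) / (\<i> * complex_of_real y))"
proof (cases "y = 0")
  case True
  then show ?thesis using form[OF x] by (simp add: expint_def)
next
  case False
  have "(LINT t|\<mu> x. 1) = hinner x x"
    using hinner_opint[OF bounded_borel_const, of x 1] opint_one[of x] by simp
  then show ?thesis
    using False integrable[OF bounded_borel_iexp, of x y] integrable[OF bounded_borel_const, of x 1]
      hinner_opint[OF bounded_borel_iexp, of x y]
    by (simp add: expint_def U_def)
qed

text \<open>Fubini with majorant \<open>|h y| |t|\<close>, integrable on the product because
  \<open>\<rho>\<close> carries \<open>|h|\<close> and a vector of \<open>D\<close> has integrable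
  \<open>t\<close>.\<close>

lemma integral_fourier_primitive:
  assumes x: "x \<in> D" and rep: "cmeasure_rep \<rho> h" and G: "\<And>t. G t = G 0 + (LINT y|\<rho>. expint y t * h y)"
  shows "(LINT t|\<mu> x. G t) = G 0 * hinner x x + (LINT y|\<rho>. (LINT t|\<mu> x. expint y t) * h y)"
    and "integrable \<rho> (\<lambda>y. (LINT t|\<mu> x. expint y t) * h y)"
proof -
  have h: "integrable \<rho> h" and s [measurable_cong]: "sets \<rho> = sets borel" and fin: "finite_measure \<rho>"
    using rep unfolding cmeasure_rep_def by auto
  note [measurable] = borel_measurable_integrable[OF h]
  interpret pair_sigma_finite \<rho> "\<mu> x"
    using fin finite unfolding pair_sigma_finite_def by (auto intro: finite_measure.axioms)
  have sets2: "sets (\<rho> \<Otimes>\<^sub>M \<mu> x) = sets (borel \<Otimes>\<^sub>M borel)" by (rule sets_pair_measure_cong[OF s sets_eq])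
  have e2: "(\<lambda>p. expint (fst p) (snd p)) \<in> borel_measurable (\<rho> \<Otimes>\<^sub>M \<mu> x)"
    using borel_measurable_expint measurable_cong_sets[OF sets2 refl] by blast
  have m: "(\<lambda>(y, t). expint y t * h y) \<in> borel_measurable (\<rho> \<Otimes>\<^sub>M \<mu> x)"
    using e2 by (simp add: case_prod_beta)
  have ie: "integrable (\<mu> x) (\<lambda>t. expint y t)" for y
    by (rule Bochner_Integration.integrable_bound[OF integrable_id[OF x]])
       (auto simp: norm_expint_le intro: measurable_mu)
  have int: "integrable (\<rho> \<Otimes>\<^sub>M \<mu> x) (\<lambda>(y, t). expint y t * h y)"
  proof (rule Bochner_Integration.integrable_bound)
    show "integrable (\<rho> \<Otimes>\<^sub>M \<mu> x) (\<lambda>(y, t). h y * complex_of_real t)"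
    proof (rule Fubini_integrable)
      show "(\<lambda>(y, t). h y * complex_of_real t) \<in> borel_measurable (\<rho> \<Otimes>\<^sub>M \<mu> x)" by measurable
      show "integrable \<rho> (\<lambda>y. LINT t|\<mu> x. norm (case (y, t) of (y, t) \<Rightarrow> h y * complex_of_real t))"
        using h by (simp add: norm_mult)
      show "AE y in \<rho>. integrable (\<mu> x) (\<lambda>t. case (y, t) of (y, t) \<Rightarrow> h y * complex_of_real t)"
        using integrable_id[OF x] by simp
    qed
    show "AE p in \<rho> \<Otimes>\<^sub>M \<mu> x. norm (case p of (y, t) \<Rightarrow> expint y t * h y) \<le> norm (case p of (y, t) \<Rightarrow> h y * complex_of_real t)"
      by (intro AE_I2) (auto simp: norm_mult mult.commute[of "cmod (h _)"] intro!: mult_right_mono norm_expint_le)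
  qed (rule m)
  have eq: "(LINT t|\<mu> x. expint y t * h y) = (LINT t|\<mu> x. expint y t) * h y" for y by simp
  show "integrable \<rho> (\<lambda>y. (LINT t|\<mu> x. expint y t) * h y)"
    using integrable_fst[OF int] unfolding eq .
  have one: "(LINT t|\<mu> x. c) = c * hinner x x" for c
    using hinner_opint[OF bounded_borel_const, of x c] opint_scale[OF bounded_borel_const, of c 1 x] opint_one[of x]
    by (simp add: hinner_hscaleC_right)
  have "(LINT t|\<mu> x. G t) = (LINT t|\<mu> x. G 0 + (LINT y|\<rho>. expint y t * h y))"
    by (rule Bochner_Integration.integral_cong[OF refl G])
  also have "\<dots> = G 0 * hinner x x + (LINT t|\<mu> x. LINT y|\<rho>. expint y t * h y)"
    unfolding one[symmetric]
    by (rule Bochner_Integration.integral_add[OF integrable[OF bounded_borel_const] integrable_snd[OF int]])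
  also have "(LINT t|\<mu> x. LINT y|\<rho>. expint y t * h y) = (LINT y|\<rho>. LINT t|\<mu> x. expint y t * h y)"
    by (rule Fubini_integral[OF int])
  finally show "(LINT t|\<mu> x. G t) = G 0 * hinner x x + (LINT y|\<rho>. (LINT t|\<mu> x. expint y t) * h y)"
    unfolding eq .
qed

end

section \<open>Duhamel formula and the double operator integral\<close>

text \<open>The definite description ranges over functions: surjectivity of \<open>A - \<i>\<close>
  supplies one, injectivity makes it unique.\<close>

lemma resolv_i:
  assumes sa: "self_adjoint D A"
  shows "resolv_i D A \<psi> \<in> D" "A (resolv_i D A \<psi>) - hscaleC \<i> (resolv_i D A \<psi>) = \<psi>"
    and "x \<in> D \<Longrightarrow> A x - hscaleC \<i> x = \<psi> \<Longrightarrow> resolv_i D A \<psi> = x"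
proof -
  have ex: "\<exists>x. x \<in> D \<and> A x - hscaleC \<i> x = \<psi>" for \<psi>
    using self_adjoint_shift_surj[OF sa, of 1 \<psi>] by auto
  have inj: "x = y" if "x \<in> D" "y \<in> D" "A x - hscaleC \<i> x = A y - hscaleC \<i> y" for x y
    using self_adjoint_shift_inj[OF sa _ that(1,2), of 1] that(3) by simp
  obtain S where S: "\<And>\<psi>. S \<psi> \<in> D" "\<And>\<psi>. A (S \<psi>) - hscaleC \<i> (S \<psi>) = \<psi>" using ex by metis
  have "resolv_i D A = S"
    unfolding resolv_i_def
  proof (rule the_equality)
    fix R assume R: "\<forall>\<psi>. R \<psi> \<in> D \<and> A (R \<psi>) - hscaleC \<i> (R \<psi>) = \<psi>"
    show "R = S" by (rule ext, rule inj) (use R S in auto)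
  qed (use S in blast)
  then show "resolv_i D A \<psi> \<in> D" "A (resolv_i D A \<psi>) - hscaleC \<i> (resolv_i D A \<psi>) = \<psi>"
    using S by auto
  then show "x \<in> D \<Longrightarrow> A x - hscaleC \<i> x = \<psi> \<Longrightarrow> resolv_i D A \<psi> = x"
    using inj by blast
qed

lemma clinear_on_compose:
  assumes "bounded_clinear_op S" "clinear_on D N"
  shows "clinear_on D (\<lambda>x. S (N x))"
  using bounded_clinear_opD[OF assms(1)] clinear_onD[OF assms(2)] unfolding clinear_on_def by auto

lemma clinear_on_diff:
  assumes "clinear_on D M" "clinear_on D N"
  shows "clinear_on D (\<lambda>x. M x - N x)"
  using clinear_onD[OF assms(1)] clinear_onD[OF assms(2)]
  unfolding clinear_on_def by (auto simp: hscaleC_diff_right)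

lemma clinear_on_scale:
  assumes "csubspace D"
  shows "clinear_on D (hscaleC c)"
  using assms unfolding clinear_on_def by (auto simp: hscaleC_add_right hscaleC_hscaleC mult.commute)

lemma W0_bounded_borel:
  assumes "W0 f"
  shows "f \<in> bounded_borel"
proof -
  obtain \<rho> h where rep: "cmeasure_rep \<rho> h"
    and f: "\<And>x. f x = (LINT y|\<rho>. exp (\<i> * complex_of_real (x * y)) * h y)" and c: "continuous_on UNIV f"
    using assms unfolding W0_def by auto
  show ?thesis
  proof (rule bounded_borelI)
    show "f \<in> borel_measurable borel" using c by (rule borel_measurable_continuous_onI)
    show "cmod (f x) \<le> (LINT y|\<rho>. cmod (h y))" for x
      unfolding f using integral_norm_bound[of \<rho> "\<lambda>y. exp (\<i> * complex_of_real (x * y)) * h y"]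
      by (simp add: norm_mult)
  qed
qed

section \<open>Two operators with a common domain\<close>

text \<open>The perturbation is represented by \<open>A - B\<close> on the common domain, with one
  constant absorbing both coefficients of the relative bound.\<close>

locale perturbed_pair =
  A: spectral_operator \<mu> D A + B: spectral_operator \<nu> D B
  for \<mu> \<nu> :: "'a::chilbert \<Rightarrow> real measure" and D A B +
  fixes a :: real
  assumes rel_bound: "x \<in> D \<Longrightarrow> norm (A x - B x) \<le> a * (norm (B x) + norm x)" and a: "0 \<le> a"
begin

definition R :: "'a \<Rightarrow> 'a" where "R = resolv_i D B"

text \<open>In the application this is \<open>V (H - \<i>)^-1\<close>, everywhere defined and
  bounded although \<open>V\<close> is not.\<close>

definition K :: "'a \<Rightarrow> 'a" where "K \<psi> = A (R \<psi>) - B (R \<psi>)"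

lemmas R_in_D = resolv_i(1)[OF B.sa, folded R_def]
lemmas B_R = resolv_i(2)[OF B.sa, folded R_def]
lemmas R_eqI = resolv_i(3)[OF B.sa, folded R_def]

lemma R_add: "R (x + y) = R x + R y"
proof (rule R_eqI)
  show "R x + R y \<in> D" by (intro B.D_subspace R_in_D)
  have "B (R x + R y) - hscaleC \<i> (R x + R y) = (B (R x) - hscaleC \<i> (R x)) + (B (R y) - hscaleC \<i> (R y))"
    by (simp add: B.A_linear R_in_D hscaleC_add_right)
  then show "B (R x + R y) - hscaleC \<i> (R x + R y) = x + y" unfolding B_R .
qed

lemma R_scale: "R (hscaleC c x) = hscaleC c (R x)"
proof (rule R_eqI)
  show "hscaleC c (R x) \<in> D" by (intro B.D_subspace R_in_D)
  have "B (hscaleC c (R x)) - hscaleC \<i> (hscaleC c (R x)) = hscaleC c (B (R x) - hscaleC \<i> (R x))"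
    by (simp add: B.A_linear R_in_D hscaleC_diff_right hscaleC_hscaleC mult.commute)
  then show "B (hscaleC c (R x)) - hscaleC \<i> (hscaleC c (R x)) = hscaleC c x" unfolding B_R .
qed

lemma R_U: "R (B.U s x) = B.U s (R x)"
proof (rule R_eqI)
  show "B.U s (R x) \<in> D" by (intro B.U_in_D R_in_D)
  have "B (B.U s (R x)) - hscaleC \<i> (B.U s (R x)) = B.U s (B (R x) - hscaleC \<i> (R x))"
    by (simp add: B.A_U R_in_D B.U_linear)
  then show "B (B.U s (R x)) - hscaleC \<i> (B.U s (R x)) = B.U s x" unfolding B_R .
qed

lemma norm_K: "norm (K x) \<le> 2 * a * norm x"
proof -
  have eq: "(norm x)\<^sup>2 = (norm (B (R x)))\<^sup>2 + (norm (R x))\<^sup>2"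
    using norm_shift_sq[of B "R x" 1] self_adjointD(4)[OF B.sa R_in_D R_in_D] B_R[of x] by simp
  have "norm (B (R x)) \<le> norm x" "norm (R x) \<le> norm x"
    by (rule power2_le_imp_le; use eq in simp)+
  then have "norm (B (R x)) + norm (R x) \<le> 2 * norm x" by linarith
  then have "a * (norm (B (R x)) + norm (R x)) \<le> a * (2 * norm x)" using a by (rule mult_left_mono)
  then show ?thesis using rel_bound[OF R_in_D[of x]] unfolding K_def by (simp add: mult_ac)
qed

lemma K_bounded: "bounded_clinear_op K"
proof (rule bounded_clinear_opI[OF _ _ norm_K])
  show "K (x + y) = K x + K y" for x y
    unfolding K_def R_add by (simp add: A.A_linear B.A_linear R_in_D)
  show "K (hscaleC c x) = hscaleC c (K x)" for c x
    unfolding K_def R_scale by (simp add: A.A_linear B.A_linear R_in_D hscaleC_diff_right)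
qed

lemmas K_linear = bounded_clinear_opD[OF K_bounded]

definition integrand :: "real \<Rightarrow> 'a \<Rightarrow> real \<Rightarrow> 'a" where
  "integrand x \<psi> s = A.U (s * x) (K (B.U ((1 - s) * x) \<psi>))"

definition J :: "real \<Rightarrow> 'a \<Rightarrow> 'a" where
  "J x \<psi> = (LINT s:{0..1}|lborel. integrand x \<psi> s)"

lemma continuous_on_integrand:
  assumes "continuous_on S g" "continuous_on S k"
  shows "continuous_on S (\<lambda>p. integrand (g p) \<psi> (k p))"
  unfolding integrand_def
  by (intro A.continuous_on_U B.continuous_on_U continuous_intros assms
      bounded_linear.continuous_on[OF bounded_clinear_op_bounded_linear[OF K_bounded]])

lemma set_integrable_integrand: "set_integrable lborel {0..1} (integrand x \<psi>)"
  by (rule borel_integrable_atLeastAtMost') (intro continuous_on_integrand continuous_intros)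

lemma integrand_add: "integrand x (\<phi> + \<psi>) s = integrand x \<phi> s + integrand x \<psi> s"
  unfolding integrand_def by (simp add: A.U_linear B.U_linear K_linear)

lemma integrand_scale: "integrand x (hscaleC c \<psi>) s = hscaleC c (integrand x \<psi> s)"
  unfolding integrand_def by (simp add: A.U_linear B.U_linear K_linear)

lemma norm_J: "norm (J x \<psi>) \<le> 2 * a * norm \<psi>"
proof -
  have "norm (J x \<psi>) \<le> (LINT s|lborel. indicator {0..1::real} s *\<^sub>R (2 * a * norm \<psi>))"
    unfolding J_def set_lebesgue_integral_def
  proof (rule Bochner_Integration.integral_norm_bound_integral)
    show "integrable lborel (\<lambda>s. indicator {0..1} s *\<^sub>R integrand x \<psi> s)"
      using set_integrable_integrand unfolding set_integrable_def .
    show "integrable lborel (\<lambda>s. indicator {0..1::real} s *\<^sub>R (2 * a * norm \<psi>))"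
      using borel_integrable_atLeastAtMost'[of 0 1 "\<lambda>_. 2 * a * norm \<psi>"] unfolding set_integrable_def by simp
    have "norm (integrand x \<psi> s) \<le> 2 * a * norm \<psi>" for s
      unfolding integrand_def using norm_K[of "B.U ((1 - s) * x) \<psi>"] by simp
    then show "norm (indicator {0..1} s *\<^sub>R integrand x \<psi> s) \<le> indicator {0..1} s *\<^sub>R (2 * a * norm \<psi>)" for s
      by (simp add: indicator_def)
  qed
  then show ?thesis by simp
qed

lemma J_add: "J x (\<phi> + \<psi>) = J x \<phi> + J x \<psi>"
  unfolding J_def integrand_add by (rule set_integral_add(2)[OF set_integrable_integrand set_integrable_integrand])

lemma J_scale: "J x (hscaleC c \<psi>) = hscaleC c (J x \<psi>)"
proof -
  have "(LINT s|lborel. hscaleC c (indicator {0..1} s *\<^sub>R integrand x \<psi> s)) = hscaleC c (J x \<psi>)"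
    unfolding J_def set_lebesgue_integral_def
    by (rule integral_bounded_linear[OF bounded_bilinear.bounded_linear_right[OF bounded_bilinear_hscaleC]])
       (use set_integrable_integrand in \<open>simp add: set_integrable_def\<close>)
  then show ?thesis unfolding J_def[of x "hscaleC c \<psi>"] integrand_scale set_lebesgue_integral_def
    by (simp add: scaleR_hscaleC hscaleC_hscaleC mult.commute)
qed

text \<open>Joint continuity of the integrand in \<open>x\<close> and \<open>s\<close> gives product
  measurability, which survives integration over \<open>s\<close>.\<close>

lemma borel_measurable_J: "(\<lambda>x. J x \<psi>) \<in> borel_measurable borel"
proof -
  have "(\<lambda>p. integrand (fst p) \<psi> (snd p)) \<in> borel_measurable (borel :: (real \<times> real) measure)"
    by (intro borel_measurable_continuous_onI continuous_on_integrand continuous_intros)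
  then have [measurable]: "(\<lambda>p. integrand (fst p) \<psi> (snd p)) \<in> borel_measurable (borel \<Otimes>\<^sub>M lborel)"
    by (simp add: borel_prod[symmetric] cong: measurable_cong_sets)
  have "(\<lambda>x. LINT s|lborel. indicator {0..1} s *\<^sub>R integrand x \<psi> s) \<in> borel_measurable borel"
    by (rule lborel.borel_measurable_lebesgue_integral) (simp add: case_prod_beta)
  then show ?thesis unfolding J_def set_lebesgue_integral_def .
qed

text \<open>Duhamel's formula on the diagonal. Pairing with \<open>\<xi>\<close> moves
  \<open>e^(isxA)\<close> to the left entry, so the product rule is applied to the inner product of
  two orbits starting in \<open>D\<close>, each norm differentiable. At \<open>x = 0\<close> the
  integrand is constant and both sides are \<open><\<xi>, A \<xi> - B \<xi>>\<close>.\<close>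

lemma hinner_J:
  assumes \<xi>: "\<xi> \<in> D"
  shows "hinner \<xi> (J x (B \<xi> - hscaleC \<i> \<xi>)) = (LINT t|\<mu> \<xi>. expint x t) - (LINT t|\<nu> \<xi>. expint x t)"
proof -
  let ?\<psi> = "B \<xi> - hscaleC \<i> \<xi>"
  \<comment> \<open>The argument \<open>(B - \<i>) \<xi>\<close> is chosen so that the resolvent in
    \<open>K\<close> cancels and the bare difference \<open>A - B\<close> acts on an orbit inside
    \<open>D\<close>.\<close>
  have R\<xi>: "R ?\<psi> = \<xi>" by (rule R_eqI[OF \<xi> refl])
  have I: "integrand x ?\<psi> s = A.U (s * x) (A (B.U ((1 - s) * x) \<xi>) - B (B.U ((1 - s) * x) \<xi>))" for s
    unfolding integrand_def K_def R_U R\<xi> ..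
  show ?thesis
  proof (cases "x = 0")
    case True
    then have "J x ?\<psi> = A \<xi> - B \<xi>" unfolding J_def I by (simp add: set_integral_const)
    then show ?thesis
      using True by (simp add: A.integral_expint[OF \<xi>] B.integral_expint[OF \<xi>] hinner_diff_right)
  next
    case False
    let ?a = "\<lambda>s. A.U (- (s * x)) \<xi>" and ?b = "\<lambda>s. B.U ((1 - s) * x) \<xi>"
    have da: "(?a has_vector_derivative (- x) *\<^sub>R hscaleC \<i> (A.U (- (s * x)) (A \<xi>))) (at s within S)" for s S
    proof -
      have "((\<lambda>s. - (s * x)) has_vector_derivative - x) (at s)"
        unfolding has_real_derivative_iff_has_vector_derivative[symmetric] by (auto intro!: derivative_eq_intros)
      from vector_diff_chain_within[OF has_vector_derivative_at_within[OF this]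
          has_vector_derivative_at_within[OF A.U_has_vector_derivative[OF \<xi>]]]
      show ?thesis by (simp add: comp_def)
    qed
    have db: "(?b has_vector_derivative (- x) *\<^sub>R hscaleC \<i> (B.U ((1 - s) * x) (B \<xi>))) (at s within S)" for s S
    proof -
      have "((\<lambda>s. (1 - s) * x) has_vector_derivative - x) (at s)"
        unfolding has_real_derivative_iff_has_vector_derivative[symmetric] by (auto intro!: derivative_eq_intros)
      from vector_diff_chain_within[OF has_vector_derivative_at_within[OF this]
          has_vector_derivative_at_within[OF B.U_has_vector_derivative[OF \<xi>]]]
      show ?thesis by (simp add: comp_def)
    qed
    have der: "((\<lambda>s. hinner (?a s) (?b s)) has_vector_derivative \<i> * complex_of_real x * hinner \<xi> (integrand x ?\<psi> s)) (at s within S)" for s S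
    proof -
      have aD: "?a s \<in> D" and bD: "?b s \<in> D" using A.U_in_D[OF \<xi>] B.U_in_D[OF \<xi>] by auto
      have "hinner (?a s) ((- x) *\<^sub>R hscaleC \<i> (B.U ((1 - s) * x) (B \<xi>)))
          + hinner ((- x) *\<^sub>R hscaleC \<i> (A.U (- (s * x)) (A \<xi>))) (?b s)
        = \<i> * complex_of_real x * (hinner (A (?a s)) (?b s) - hinner (?a s) (B (?b s)))"
        unfolding A.A_U[OF \<xi>, symmetric] B.A_U[OF \<xi>, symmetric]
        by (simp add: hinner_scaleR_left hinner_scaleR_right hinner_simps scaleR_conv_of_real algebra_simps)
      also have "hinner (A (?a s)) (?b s) - hinner (?a s) (B (?b s)) = hinner \<xi> (integrand x ?\<psi> s)"
        unfolding self_adjointD(4)[OF A.sa aD bD] I by (simp add: A.hinner_U hinner_diff_right A.U_linear)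
      finally show ?thesis
        using bounded_bilinear.has_vector_derivative[OF bounded_bilinear_hinner da db, of s S] by simp
    qed
    have "(LINT s|lborel. indicator {0..1} s *\<^sub>R (\<i> * complex_of_real x * hinner \<xi> (integrand x ?\<psi> s)))
        = hinner (?a 1) (?b 1) - hinner (?a 0) (?b 0)"
      by (rule integral_FTC_atLeastAtMost[OF _ der])
         (auto intro!: continuous_intros continuous_on_hinner continuous_on_integrand)
    also have "\<dots> = hinner \<xi> (A.U x \<xi>) - hinner \<xi> (B.U x \<xi>)" using A.hinner_U[of x \<xi> \<xi>] by simp
    also have "(LINT s|lborel. indicator {0..1} s *\<^sub>R (\<i> * complex_of_real x * hinner \<xi> (integrand x ?\<psi> s)))
        = \<i> * complex_of_real x * hinner \<xi> (J x ?\<psi>)"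
    proof -
      have "(LINT s|lborel. hinner \<xi> (indicator {0..1} s *\<^sub>R integrand x ?\<psi> s)) = hinner \<xi> (J x ?\<psi>)"
        unfolding J_def set_lebesgue_integral_def
        by (rule integral_bounded_linear[OF bounded_bilinear.bounded_linear_right[OF bounded_bilinear_hinner]])
           (use set_integrable_integrand in \<open>simp add: set_integrable_def\<close>)
      then show ?thesis by (simp add: hinner_scaleR_right flip: mult_scaleR_right)
    qed
    finally have "hinner \<xi> (J x ?\<psi>) = (hinner \<xi> (A.U x \<xi>) - hinner \<xi> (B.U x \<xi>)) / (\<i> * complex_of_real x)"
      using False by (simp add: field_simps)
    then show ?thesis
      using False by (simp add: A.integral_expint[OF \<xi>] B.integral_expint[OF \<xi>] diff_divide_distrib)
  qed
qed

definition T :: "real measure \<Rightarrow> (real \<Rightarrow> complex) \<Rightarrow> 'a \<Rightarrow> 'a" where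
  "T \<rho> h \<psi> = (LINT x|\<rho>. hscaleC (h x) (J x \<psi>))"

lemma integrable_T:
  assumes "cmeasure_rep \<rho> h"
  shows "integrable \<rho> (\<lambda>x. hscaleC (h x) (J x \<psi>))"
proof (rule Bochner_Integration.integrable_bound)
  have h: "integrable \<rho> h" and s: "sets \<rho> = sets borel"
    using assms unfolding cmeasure_rep_def by auto
  show "integrable \<rho> (\<lambda>x. (2 * a * norm \<psi>) *\<^sub>R h x)" using h by simp
  have "(\<lambda>x. J x \<psi>) \<in> borel_measurable \<rho>"
    using borel_measurable_J measurable_cong_sets[OF s refl] by blast
  then show "(\<lambda>x. hscaleC (h x) (J x \<psi>)) \<in> borel_measurable \<rho>"
  proof (rule borel_measurable_continuous_Pair[OF borel_measurable_integrable[OF h]])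
    show "continuous_on UNIV (\<lambda>p. hscaleC (fst p) (snd p))"
      by (intro continuous_on_hscaleC continuous_intros)
  qed
  show "AE x in \<rho>. norm (hscaleC (h x) (J x \<psi>)) \<le> norm ((2 * a * norm \<psi>) *\<^sub>R h x)"
  proof (rule AE_I2)
    fix x
    have "cmod (h x) * norm (J x \<psi>) \<le> cmod (h x) * (2 * a * norm \<psi>)"
      by (intro mult_left_mono norm_J) simp
    then show "norm (hscaleC (h x) (J x \<psi>)) \<le> norm ((2 * a * norm \<psi>) *\<^sub>R h x)"
      using a by (simp add: mult_ac)
  qed
qed

lemma T_bounded:
  assumes rep: "cmeasure_rep \<rho> h"
  shows "bounded_clinear_op (T \<rho> h)"
proof (rule bounded_clinear_opI)
  have h: "integrable \<rho> h" using rep unfolding cmeasure_rep_def by auto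
  show "T \<rho> h (x + y) = T \<rho> h x + T \<rho> h y" for x y
    unfolding T_def J_add hscaleC_add_right
    by (rule Bochner_Integration.integral_add[OF integrable_T[OF rep] integrable_T[OF rep]])
  show "T \<rho> h (hscaleC c x) = hscaleC c (T \<rho> h x)" for c x
  proof -
    have "(LINT y|\<rho>. hscaleC c (hscaleC (h y) (J y x))) = hscaleC c (T \<rho> h x)"
      unfolding T_def
      by (rule integral_bounded_linear[OF bounded_bilinear.bounded_linear_right[OF bounded_bilinear_hscaleC] integrable_T[OF rep]])
    then show ?thesis unfolding T_def[of \<rho> h "hscaleC c x"] J_scale by (simp add: hscaleC_hscaleC mult.commute)
  qed
  show "norm (T \<rho> h x) \<le> ((LINT y|\<rho>. cmod (h y)) * (2 * a)) * norm x" for x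
  proof -
    have "norm (T \<rho> h x) \<le> (LINT y|\<rho>. cmod (h y) * (2 * a * norm x))"
      unfolding T_def
    proof (rule Bochner_Integration.integral_norm_bound_integral[OF integrable_T[OF rep]])
      show "integrable \<rho> (\<lambda>y. cmod (h y) * (2 * a * norm x))" using h by simp
      show "norm (hscaleC (h y) (J y x)) \<le> cmod (h y) * (2 * a * norm x)" for y
        unfolding norm_hscaleC by (intro mult_left_mono norm_J) simp
    qed
    also have "\<dots> = ((LINT y|\<rho>. cmod (h y)) * (2 * a)) * norm x" by simp
    finally show ?thesis .
  qed
qed

theorem T_eq:
  assumes rep: "cmeasure_rep \<rho> h" and f: "f \<in> bounded_borel"
    and der: "\<And>l. ((\<lambda>t. f t * (complex_of_real t - \<i>)) has_vector_derivative (LINT x|\<rho>. iexp (x * l) * h x)) (at l)"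
  shows "T \<rho> h \<psi> = opint \<mu> f (\<psi> + K \<psi>) - opint \<nu> f \<psi>"
proof -
  define G where "G t = f t * (complex_of_real t - \<i>)" for t
  have G: "G t = G 0 + (LINT x|\<rho>. expint x t * h x)" for t
    using fourier_primitive_eq[OF rep der, of t] unfolding G_def .
  have linA: "clinear_on D (\<lambda>\<xi>. A \<xi> - hscaleC \<i> \<xi>)" and linB: "clinear_on D (\<lambda>\<xi>. B \<xi> - hscaleC \<i> \<xi>)"
    using self_adjointD(1)[OF A.sa] self_adjointD(1)[OF B.sa] clinear_on_scale[OF self_adjointD(3)[OF A.sa]]
    by (intro clinear_on_diff; simp)+
  have main: "T \<rho> h (B \<xi> - hscaleC \<i> \<xi>)
      = opint \<mu> f (A \<xi> - hscaleC \<i> \<xi>) - opint \<nu> f (B \<xi> - hscaleC \<i> \<xi>)" if \<xi>: "\<xi> \<in> D" for \<xi>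
  proof (rule polarization_eq[OF _ _ self_adjointD(2)[OF A.sa] _ \<xi>])
    show "clinear_on D (\<lambda>\<xi>. T \<rho> h (B \<xi> - hscaleC \<i> \<xi>))"
      by (rule clinear_on_compose[OF T_bounded[OF rep] linB])
    show "clinear_on D (\<lambda>\<xi>. opint \<mu> f (A \<xi> - hscaleC \<i> \<xi>) - opint \<nu> f (B \<xi> - hscaleC \<i> \<xi>))"
      by (intro clinear_on_diff clinear_on_compose[OF A.opint_bounded[OF f] linA]
          clinear_on_compose[OF B.opint_bounded[OF f] linB])
    fix \<xi> assume \<xi>: "\<xi> \<in> D"
    have "hinner \<xi> (T \<rho> h (B \<xi> - hscaleC \<i> \<xi>)) = (LINT x|\<rho>. hinner \<xi> (hscaleC (h x) (J x (B \<xi> - hscaleC \<i> \<xi>))))"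
      unfolding T_def
      by (rule integral_bounded_linear[symmetric, OF bounded_bilinear.bounded_linear_right[OF bounded_bilinear_hinner] integrable_T[OF rep]])
    also have "\<dots> = (LINT x|\<rho>. (LINT t|\<mu> \<xi>. expint x t) * h x - (LINT t|\<nu> \<xi>. expint x t) * h x)"
      unfolding hinner_hscaleC_right hinner_J[OF \<xi>] by (simp add: algebra_simps)
    also have "\<dots> = (LINT x|\<rho>. (LINT t|\<mu> \<xi>. expint x t) * h x) - (LINT x|\<rho>. (LINT t|\<nu> \<xi>. expint x t) * h x)"
      by (rule Bochner_Integration.integral_diff[OF A.integral_fourier_primitive(2)[OF \<xi> rep G] B.integral_fourier_primitive(2)[OF \<xi> rep G]])
    \<comment> \<open>Both spectral measures have mass \<open>|\<xi>|^2\<close>, so the two terms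
      with \<open>G 0\<close> cancel.\<close>
    also have "\<dots> = (LINT t|\<mu> \<xi>. G t) - (LINT t|\<nu> \<xi>. G t)"
      unfolding A.integral_fourier_primitive(1)[OF \<xi> rep G] B.integral_fourier_primitive(1)[OF \<xi> rep G] by simp
    also have "\<dots> = hinner \<xi> (opint \<mu> f (A \<xi> - hscaleC \<i> \<xi>) - opint \<nu> f (B \<xi> - hscaleC \<i> \<xi>))"
      unfolding hinner_diff_right A.hinner_opint_shift[OF \<xi> f] B.hinner_opint_shift[OF \<xi> f] G_def ..
    finally show "hinner \<xi> (T \<rho> h (B \<xi> - hscaleC \<i> \<xi>))
      = hinner \<xi> (opint \<mu> f (A \<xi> - hscaleC \<i> \<xi>) - opint \<nu> f (B \<xi> - hscaleC \<i> \<xi>))" .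
  qed
  have "A (R \<psi>) - hscaleC \<i> (R \<psi>) = (B (R \<psi>) - hscaleC \<i> (R \<psi>)) + K \<psi>" unfolding K_def by simp
  then show ?thesis using main[OF R_in_D[of \<psi>]] unfolding B_R by simp
qed

end

theorem theorem4p5:
  fixes H V :: "'a::chilbert \<Rightarrow> 'a" and DH DV :: "'a set"
    and f :: "real \<Rightarrow> complex" and \<rho> :: "real measure" and h :: "real \<Rightarrow> complex"
  assumes "self_adjoint DH H"
    and "symmetric_op DV V"
    and "rel_bounded DH H DV V"
    and "rel_bound DH H V < 1"
    and "W1 f"
    and "cmeasure_rep \<rho> h"
    and "\<forall>l. fu_deriv f l = (LINT x|\<rho>. exp (\<i> * complex_of_real (x * l)) * h x)"
  shows "(\<lambda>\<psi>. fcalc DH (\<lambda>\<phi>. H \<phi> + V \<phi>) f \<psi> - fcalc DH H f \<psi>)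
       = (\<lambda>\<psi>. DOI DH (\<lambda>\<phi>. H \<phi> + V \<phi>) DH H \<rho> h (\<lambda>\<phi>. V (resolv_i DH H \<phi>)) \<psi>
             - fcalc DH (\<lambda>\<phi>. H \<phi> + V \<phi>) f (V (resolv_i DH H \<psi>)))"
proof -
  let ?A = "\<lambda>\<phi>. H \<phi> + V \<phi>"
  have saA: "self_adjoint DH ?A" by (rule Kato_Rellich[OF assms(1-4)])
  define \<mu> where "\<mu> = spec_meas (SOME E. spectral_resolution DH ?A E)"
  define \<nu> where "\<nu> = spec_meas (SOME E. spectral_resolution DH H E)"
  have opA: "spectral_operator \<mu> DH ?A" and fA: "fcalc DH ?A g = opint \<mu> g" for g
    using spectral_operator_SOME[OF saA] unfolding \<mu>_def by auto
  have opH: "spectral_operator \<nu> DH H" and fH: "fcalc DH H g = opint \<nu> g" for g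
    using spectral_operator_SOME[OF assms(1)] unfolding \<nu>_def by auto
  obtain a b where ab: "0 \<le> a" "0 \<le> b" "\<And>x. x \<in> DH \<Longrightarrow> norm (V x) \<le> a * norm (H x) + b * norm x"
    using assms(3) unfolding rel_bounded_def by auto
  \<comment> \<open>The bound below 1 has done its work in \<open>Kato_Rellich\<close>; here any
    admissible pair of constants serves, and \<open>a + b\<close> dominates both.\<close>
  interpret perturbed_pair \<mu> \<nu> DH ?A H "a + b"
  proof (intro perturbed_pair.intro perturbed_pair_axioms.intro opA opH)
    fix x assume "x \<in> DH"
    then have "norm (V x) \<le> a * norm (H x) + b * norm x" by (rule ab(3))
    also have "\<dots> \<le> (a + b) * norm (H x) + (a + b) * norm x"
      using ab by (intro add_mono mult_right_mono) auto
    finally show "norm (?A x - H x) \<le> (a + b) * (norm (H x) + norm x)" by (simp add: distrib_left)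
  qed (use ab in simp)
  have K: "K = (\<lambda>\<phi>. V (resolv_i DH H \<phi>))" unfolding K_def R_def by auto
  have DOI: "DOI DH ?A DH H \<rho> h (\<lambda>\<phi>. V (resolv_i DH H \<phi>)) \<psi> = T \<rho> h \<psi>" for \<psi>
    unfolding DOI_def T_def J_def integrand_def A.U_def B.U_def K fA fH ..
  have f: "f \<in> bounded_borel" using assms(5) W0_bounded_borel unfolding W1_def by blast
  \<comment> \<open>\<open>fu_deriv\<close> is only the value of a choice-based derivative operator;
    differentiability of both factors makes it an actual derivative.\<close>
  have der: "((\<lambda>t. f t * (complex_of_real t - \<i>)) has_vector_derivative (LINT x|\<rho>. iexp (x * l) * h x)) (at l)" for l
  proof -
    have "f differentiable (at l)" using assms(5) unfolding W1_def by blast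
    moreover have "(\<lambda>t. complex_of_real t - \<i>) differentiable (at l)"
      by (intro differentiable_diff differentiable_const bounded_linear_imp_differentiable bounded_linear_of_real)
    ultimately have "(\<lambda>t. f t * (complex_of_real t - \<i>)) differentiable (at l)"
      by (rule differentiable_mult)
    then show ?thesis using assms(7) unfolding fu_deriv_def by (metis vector_derivative_works)
  qed
  show ?thesis
  proof
    fix \<psi>
    have "opint \<mu> f (\<psi> + K \<psi>) = opint \<mu> f \<psi> + opint \<mu> f (K \<psi>)"
      by (rule bounded_clinear_opD(1)[OF A.opint_bounded[OF f]])
    then show "fcalc DH ?A f \<psi> - fcalc DH H f \<psi>
      = DOI DH ?A DH H \<rho> h (\<lambda>\<phi>. V (resolv_i DH H \<phi>)) \<psi> - fcalc DH ?A f (V (resolv_i DH H \<psi>))"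
      unfolding DOI fA fH T_eq[OF assms(6) f der] by (simp add: K)
  qed
qed

end
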